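(* Let $\mathscr{H}$ and $\mathscr{K}$ be complex Hilbert spaces and let $T:\mathscr{H}\to\mathscr{K}$ be a bounded linear map. Then the following conditions are equivalent. (i) For every $\sigma$-algebra $\mathscr{A}$ (of subsets of some set), every $\sigma$-algebra $\mathscr{B}$ (of subsets of some set), every $\mathscr{K}$-valued measure $\xi$ on $\mathscr{A}$ and every $\mathscr{H}$-valued measure $\eta$ on $\mathscr{B}$, the semi-measure $(\xi|T\eta)$ on $\mathscr{A}\otimes\mathscr{B}$ extends to a complex measure on $\mathscr{A}\otimes_\sigma\mathscr{B}$. (ii) For every $\overline{T\mathscr{H}}$-valued orthogonal measure $\xi$ on $2^{\mathbb{N}}$ and every $\ker(T)^\perp$-valued orthogonal measure $\eta$ on $2^{\mathbb{N}}$, the semi-measure $(\xi|T\eta)$ on $2^{\mathbb{N}}\otimes 2^{\mathbb{N}}$ is bounded. (iii) $T$ is in the Hilbert-Schmidt class.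
   Context: Inner products $(\cdot|\cdot)$ are conjugate-linear in the first variable and linear in the second. For a Banach space $V$ and a Boolean algebra $\mathscr{B}$ of subsets of a set $S$ (containing $S$), a $V$-valued semi-measure is a finitely additive map $\phi:\mathscr{B}\to V$. It is a measure if $\mathscr{B}$ is a $\sigma$-algebra and $\phi$ is countably additive (in norm). A complex measure is a $\mathbb{C}$-valued measure. A Hilbert-space-valued semi-measure $\phi$ is orthogonal if $\phi(A)\perp\phi(B)$ whenever $A\cap B=\emptyset$ in $\mathscr{B}$. $2^{\mathbb{N}}$ denotes the power set of $\mathbb{N}$. For $\sigma$-algebras $\mathscr{A}$ on $S$ and $\mathscr{B}$ on $S'$, $\mathscr{A}\otimes\mathscr{B}$ denotes the Boolean algebra of subsets of $S\times S'$ generated by the rectangles $A\times B$ ($A\in\mathscr{A}$, $B\in\mathscr{B}$), and $\mathscr{A}\otimes_\sigma\mathscr{B}$ the $\sigma$-algebra generated by these rectangles. The complex semi-measure $(\xi|T\eta)$ on $\mathscr{A}\otimes\mathscr{B}$ is the unique finitely additive function satisfying $(\xi|T\eta)(A\times B)=(\xi(A)|T\eta(B))$ for $A\in\mathscr{A}$, $B\in\mathscr{B}$. A complex semi-measure $\lambda$ on a Boolean algebra of subsets of a set $S$ is bounded if its total variation $\sup\{\sum_j|\lambda(A_j)| : \{A_j\}\text{ a finite partition of }S\text{ in the Boolean algebra}\}$ is finite. *)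

theory Defs
  imports "HOL-Analysis.Analysis"
begin

section \<open>Complex Hilbert spaces\<close>

text \<open>
  A complex inner product space is presented on top of the library class \<^class>\<open>real_inner\<close>,
  whose inner product is the real part of the Hermitian one. By conjugate symmetry
  \<open>cinner x x\<close> is real, so \<open>norm x = sqrt (cinner x x)\<close> and the norm, metric and topology
  are those of the Hermitian inner product; positive definiteness is inherited as well.
  The inner product is linear in the second variable and conjugate-linear in the first.
\<close>

class complex_inner_space = real_inner +
  fixes scaleC :: "complex \<Rightarrow> 'a \<Rightarrow> 'a"  (infixr \<open>*\<^sub>C\<close> 75)
    and cinner :: "'a \<Rightarrow> 'a \<Rightarrow> complex"
  assumes scaleC_add_right: "a *\<^sub>C (x + y) = a *\<^sub>C x + a *\<^sub>C y"
    and scaleC_add_left: "(a + b) *\<^sub>C x = a *\<^sub>C x + b *\<^sub>C x"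
    and scaleC_scaleC: "a *\<^sub>C (b *\<^sub>C x) = (a * b) *\<^sub>C x"
    and scaleR_scaleC: "r *\<^sub>R x = complex_of_real r *\<^sub>C x"
    and cinner_commute: "cinner x y = cnj (cinner y x)"
    and cinner_add_right: "cinner x (y + z) = cinner x y + cinner x z"
    and cinner_scaleC_right: "cinner x (a *\<^sub>C y) = a * cinner x y"
    and inner_eq_Re_cinner: "inner x y = Re (cinner x y)"

class complex_hilbert_space = complex_inner_space + complete_space
begin

subclass banach ..

end

lemma scaleC_one: "1 *\<^sub>C x = (x :: 'a :: complex_inner_space)"
  using scaleR_scaleC[of 1 x] by simp

global_interpretation complex_vector:
  vector_space "scaleC :: complex \<Rightarrow> 'a \<Rightarrow> 'a :: complex_inner_space"
  by standard (simp_all add: scaleC_add_right scaleC_add_left scaleC_scaleC scaleC_one)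

lemma cinner_self: "cinner x x = complex_of_real ((norm x)\<^sup>2)"
  for x :: "'a :: complex_inner_space"
proof -
  have "cnj (cinner x x) = cinner x x"
    using cinner_commute[of x x] by simp
  then have "Im (cinner x x) = 0"
    by (metis Reals_cnj_iff complex_is_Real_iff)
  moreover have "Re (cinner x x) = (norm x)\<^sup>2"
    by (simp add: power2_norm_eq_inner inner_eq_Re_cinner)
  ultimately show ?thesis
    by (simp add: complex_eq_iff)
qed

instantiation complex :: complex_hilbert_space
begin

definition scaleC_complex :: "complex \<Rightarrow> complex \<Rightarrow> complex"
  where "scaleC_complex a x = a * x"

definition cinner_complex :: "complex \<Rightarrow> complex \<Rightarrow> complex"
  where "cinner_complex x y = cnj x * y"

instance
  by standard
    (simp_all add: scaleC_complex_def cinner_complex_def algebra_simps inner_complex_def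
      scaleR_conv_of_real)

end

definition bounded_clinear ::
    "('a :: complex_inner_space \<Rightarrow> 'b :: complex_inner_space) \<Rightarrow> bool"
  where "bounded_clinear T \<longleftrightarrow> bounded_linear T \<and> (\<forall>c x. T (c *\<^sub>C x) = c *\<^sub>C T x)"

definition orthogonal_complement :: "'a :: complex_inner_space set \<Rightarrow> 'a set"
  where "orthogonal_complement M = {x. \<forall>y\<in>M. cinner y x = 0}"

definition orthonormal_basis :: "'a :: complex_inner_space set \<Rightarrow> bool"
  where "orthonormal_basis E \<longleftrightarrow>
    (\<forall>x\<in>E. norm x = 1) \<and>
    (\<forall>x\<in>E. \<forall>y\<in>E. x \<noteq> y \<longrightarrow> cinner x y = 0) \<and>
    closure (complex_vector.span E) = UNIV"

definition hilbert_schmidt ::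
    "('a :: complex_hilbert_space \<Rightarrow> 'b :: complex_hilbert_space) \<Rightarrow> bool"
  where "hilbert_schmidt T \<longleftrightarrow>
    bounded_clinear T \<and>
    (\<exists>E. orthonormal_basis E \<and> (\<lambda>e. (norm (T e))\<^sup>2) summable_on E)"


section \<open>Vector-valued measures and semi-measures\<close>

text \<open>
  A set function is a total function on the sets over the ambient type; only its values on the
  given Boolean algebra \<open>M\<close> of subsets of \<open>\<Omega>\<close> are relevant. Quantification over all sets \<open>\<Omega>\<close>
  is rendered as quantification over the subsets of an arbitrary infinite type: a type variable
  cannot be quantified inside a formula, and every set (in particular every finite one) is in
  bijection with a subset of some infinite type.
\<close>

definition semi_measure :: "'s set \<Rightarrow> 's set set \<Rightarrow> ('s set \<Rightarrow> 'v :: banach) \<Rightarrow> bool"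
  where "semi_measure \<Omega> M \<phi> \<longleftrightarrow> algebra \<Omega> M \<and> additive M \<phi>"

definition vector_measure :: "'s set \<Rightarrow> 's set set \<Rightarrow> ('s set \<Rightarrow> 'v :: banach) \<Rightarrow> bool"
  where "vector_measure \<Omega> M \<phi> \<longleftrightarrow>
    semi_measure \<Omega> M \<phi> \<and> sigma_algebra \<Omega> M \<and>
    (\<forall>A :: nat \<Rightarrow> 's set. range A \<subseteq> M \<longrightarrow> disjoint_family A \<longrightarrow>
      (\<lambda>i. \<phi> (A i)) sums \<phi> (\<Union>i. A i))"

definition orthogonal_on :: "'s set set \<Rightarrow> ('s set \<Rightarrow> 'v :: complex_hilbert_space) \<Rightarrow> bool"
  where "orthogonal_on M \<phi> \<longleftrightarrow>
    (\<forall>A\<in>M. \<forall>B\<in>M. A \<inter> B = {} \<longrightarrow> cinner (\<phi> A) (\<phi> B) = 0)"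

definition total_variation :: "'s set \<Rightarrow> 's set set \<Rightarrow> ('s set \<Rightarrow> complex) \<Rightarrow> ennreal"
  where "total_variation \<Omega> M \<phi> =
    (SUP P \<in> {P. finite P \<and> P \<subseteq> M \<and> partition_on \<Omega> P}. ennreal (\<Sum>A\<in>P. norm (\<phi> A)))"

definition bounded_semi_measure :: "'s set \<Rightarrow> 's set set \<Rightarrow> ('s set \<Rightarrow> complex) \<Rightarrow> bool"
  where "bounded_semi_measure \<Omega> M \<phi> \<longleftrightarrow>
    semi_measure \<Omega> M \<phi> \<and> total_variation \<Omega> M \<phi> < \<infinity>"


section \<open>Products\<close>

definition rectangles :: "'s set set \<Rightarrow> 't set set \<Rightarrow> ('s \<times> 't) set set"
  where "rectangles \<A> \<B> = {A \<times> B | A B. A \<in> \<A> \<and> B \<in> \<B>}"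

definition product_algebra ::
    "'s set \<Rightarrow> 's set set \<Rightarrow> 't set \<Rightarrow> 't set set \<Rightarrow> ('s \<times> 't) set set"
  where "product_algebra S \<A> S' \<B> = algebra (S \<times> S') hull rectangles \<A> \<B>"

definition product_sigma_algebra ::
    "'s set \<Rightarrow> 's set set \<Rightarrow> 't set \<Rightarrow> 't set set \<Rightarrow> ('s \<times> 't) set set"
  where "product_sigma_algebra S \<A> S' \<B> = sigma_sets (S \<times> S') (rectangles \<A> \<B>)"

text \<open>
  The semi-measure \<open>(\<xi>|T\<eta>)\<close> on the product algebra. Being a total function, it is made unique by
  the convention that it vanishes off the product algebra.
\<close>

definition product_semi_measure ::
    "'s set \<Rightarrow> 's set set \<Rightarrow> 't set \<Rightarrow> 't set set \<Rightarrow>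
     ('s set \<Rightarrow> 'k :: complex_hilbert_space) \<Rightarrow> ('h :: complex_hilbert_space \<Rightarrow> 'k) \<Rightarrow>
     ('t set \<Rightarrow> 'h) \<Rightarrow> ('s \<times> 't) set \<Rightarrow> complex"
  where "product_semi_measure S \<A> S' \<B> \<xi> T \<eta> =
    (THE \<mu>. semi_measure (S \<times> S') (product_algebra S \<A> S' \<B>) \<mu> \<and>
       (\<forall>A\<in>\<A>. \<forall>B\<in>\<B>. \<mu> (A \<times> B) = cinner (\<xi> A) (T (\<eta> B))) \<and>
       (\<forall>X. X \<notin> product_algebra S \<A> S' \<B> \<longrightarrow> \<mu> X = 0))"

definition extends_to_measure ::
    "'s set \<Rightarrow> 's set set \<Rightarrow> 's set set \<Rightarrow> ('s set \<Rightarrow> complex) \<Rightarrow> bool"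
  where "extends_to_measure \<Omega> M N \<phi> \<longleftrightarrow>
    (\<exists>\<psi>. vector_measure \<Omega> N \<psi> \<and> (\<forall>X\<in>M. \<psi> X = \<phi> X))"

end

theory Submission
  imports Defs
begin

text \<open>
  If \<open>T\<close> is Hilbert-Schmidt, then it is absolutely summing (by the Khintchine inequality), so \<open>T \<eta>\<close> has
  bounded variation while \<open>\<xi>\<close> is bounded; this bounds \<open>(\<xi>|T \<eta>)\<close> by the Hilbert-Schmidt norm of \<open>T\<close>.
  Expanding \<open>T\<close> along an orthonormal basis therefore gives a uniformly convergent sum of products of
  complex measures.

  If \<open>T\<close> is not Hilbert-Schmidt, there are finite orthonormal blocks \<open>e\<^sub>j\<close> in the orthogonal complement
  of the kernel, orthogonal to each other, on which the square sum of \<open>T e\<^sub>j\<close> is as large as desired.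
  In the range of \<open>T\<close>, a randomly signed discrete Fourier transform provides an orthonormal system
  whose coefficients \<open>(f\<^sub>i|T e\<^sub>j)\<close> are flat in \<open>i\<close>. Weighting the blocks geometrically yields orthogonal
  atomic measures for which the absolute values of \<open>(\<xi>|T \<eta>)\<close> on the atoms have infinite sum.
\<close>

section \<open>Complex inner product spaces\<close>

text \<open>Flatness is what makes the counterexample work. If the \<open>T e\<close> were
  orthogonal and paired only with their own normalized images, the matrix (f_i|T e_j) would be
  diagonal, and weights of bounded square sum would give at most the operator norm, however large
  the Hilbert-Schmidt norm is. For m vectors f_i with |(f_i|v)| of order |v|/sqrt m for every i,
  weights 1/sqrt m give back |v| after summation over i; a second weight proportional to |v_j| then
  recovers the square root of the sum of the |v_j|^2. A fixed Fourier matrix need not be flat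
  against given vectors, hence the random signs. Khintchine's inequality thus serves twice: it
  bounds norms from above by averages in the summing estimate, and it yields one good choice of
  signs here. In the positive direction the variation estimate is applied only to finite partial
  sums, each of which is already a countably additive measure. It makes them uniformly Cauchy, and
  countable additivity is inherited by the limit.\<close>

lemma cinner_add_left: "cinner (x + y) z = cinner x z + cinner (y :: 'a :: complex_inner_space) z"
  by (metis cinner_add_right cinner_commute complex_cnj_add)

lemma cinner_scaleC_left: "cinner (a *\<^sub>C x) y = cnj a * cinner x (y :: 'a :: complex_inner_space)"
  by (metis cinner_scaleC_right cinner_commute complex_cnj_mult)

lemma cinner_scaleR_right: "cinner x (r *\<^sub>R y) = r *\<^sub>R cinner x (y :: 'a :: complex_inner_space)"
  using cinner_scaleC_right[of x "complex_of_real r" y] by (metis scaleR_conv_of_real scaleR_scaleC)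

lemma cinner_scaleR_left: "cinner (r *\<^sub>R x) y = r *\<^sub>R cinner x (y :: 'a :: complex_inner_space)"
  using cinner_scaleC_left[of "complex_of_real r" x y]
  by (metis complex_cnj_complex_of_real scaleR_conv_of_real scaleR_scaleC)

lemma norm_scaleC: "norm (a *\<^sub>C x) = cmod a * norm (x :: 'a :: complex_inner_space)"
proof -
  have "complex_of_real ((norm (a *\<^sub>C x))\<^sup>2) = cnj a * a * complex_of_real ((norm x)\<^sup>2)"
    by (metis cinner_scaleC_left cinner_scaleC_right cinner_self mult.assoc)
  also have "\<dots> = complex_of_real ((cmod a * norm x)\<^sup>2)"
    by (simp add: complex_norm_square power_mult_distrib mult.commute del: of_real_power)
  finally have "(norm (a *\<^sub>C x))\<^sup>2 = (cmod a * norm x)\<^sup>2"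
    using of_real_eq_iff by blast
  then show ?thesis
    by (simp add: power2_eq_iff_nonneg)
qed

text \<open>Rotating \<open>y\<close> by a unimodular scalar makes the Hermitian product real and
  nonnegative; it then equals the real \<open>inner\<close>, and the real inequality
  applies.\<close>

lemma cinner_Cauchy_Schwarz: "cmod (cinner x y) \<le> norm x * norm (y :: 'a :: complex_inner_space)"
proof (cases "cinner x y = 0")
  case False
  define u where "u = cnj (sgn (cinner x y))"
  have u: "cmod u = 1"
    using False by (simp add: u_def norm_sgn)
  have "cinner x (u *\<^sub>C y) = complex_of_real (cmod (cinner x y))"
    using False
    by (simp add: cinner_scaleC_right u_def sgn_eq complex_norm_square[symmetric] power2_eq_square
        field_simps)
  then have "cmod (cinner x y) = inner x (u *\<^sub>C y)"
    by (simp add: inner_eq_Re_cinner)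
  also have "\<dots> \<le> norm x * norm (u *\<^sub>C y)"
    by (rule norm_cauchy_schwarz)
  finally show ?thesis
    by (simp add: norm_scaleC u)
qed simp

lemma bounded_linear_cinner_right: "bounded_linear (cinner (x :: 'a :: complex_inner_space))"
  using cinner_Cauchy_Schwarz[of x]
  by (intro bounded_linear_intro[where K = "norm x"])
    (auto simp: cinner_add_right cinner_scaleR_right mult.commute)

lemma bounded_linear_cinner_left: "bounded_linear (\<lambda>x. cinner x (y :: 'a :: complex_inner_space))"
  using cinner_Cauchy_Schwarz[of _ y]
  by (intro bounded_linear_intro[where K = "norm y"])
    (auto simp: cinner_add_left cinner_scaleR_left)

lemma cinner_sum_right: "cinner x (\<Sum>i\<in>I. f i) = (\<Sum>i\<in>I. cinner (x :: 'a :: complex_inner_space) (f i))"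
  by (rule linear_sum[OF bounded_linear.linear[OF bounded_linear_cinner_right]])

lemma cinner_sum_left: "cinner (\<Sum>i\<in>I. f i) y = (\<Sum>i\<in>I. cinner (f i) (y :: 'a :: complex_inner_space))"
  by (rule linear_sum[OF bounded_linear.linear[OF bounded_linear_cinner_left]])

lemma cinner_zero_left [simp]: "cinner 0 (y :: 'a :: complex_inner_space) = 0"
  by (rule linear_0[OF bounded_linear.linear[OF bounded_linear_cinner_left]])

lemma cinner_zero_right [simp]: "cinner (x :: 'a :: complex_inner_space) 0 = 0"
  by (rule linear_0[OF bounded_linear.linear[OF bounded_linear_cinner_right]])

lemma cinner_diff_right: "cinner x (y - z) = cinner x y - cinner (x :: 'a :: complex_inner_space) z"
  by (rule linear_diff[OF bounded_linear.linear[OF bounded_linear_cinner_right]])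

lemma cinner_eq_0_commute: "cinner x y = 0 \<longleftrightarrow> cinner y (x :: 'a :: complex_inner_space) = 0"
  by (metis cinner_commute complex_cnj_zero)

lemma cmod_cinner_commute: "cmod (cinner x y) = cmod (cinner y (x :: 'a :: complex_inner_space))"
  by (metis cinner_commute complex_mod_cnj)

lemma norm_add_square:
  "(norm (x + y))\<^sup>2 = (norm x)\<^sup>2 + (norm y)\<^sup>2 + 2 * Re (cinner x (y :: 'a :: complex_inner_space))"
  by (simp add: power2_norm_eq_inner inner_add_left inner_add_right inner_commute
      flip: inner_eq_Re_cinner)

lemma norm_add_orthogonal:
  "cinner x y = 0 \<Longrightarrow> (norm (x + y))\<^sup>2 = (norm x)\<^sup>2 + (norm (y :: 'a :: complex_inner_space))\<^sup>2"
  by (simp add: norm_add_square)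

lemma norm_sum_orthogonal:
  fixes x :: "'i \<Rightarrow> 'a :: complex_inner_space"
  assumes "finite F" and "\<And>i j. i \<in> F \<Longrightarrow> j \<in> F \<Longrightarrow> i \<noteq> j \<Longrightarrow> cinner (x i) (x j) = 0"
  shows "(norm (\<Sum>i\<in>F. x i))\<^sup>2 = (\<Sum>i\<in>F. (norm (x i))\<^sup>2)"
  using assms
proof (induction F rule: finite_induct)
  case (insert i F)
  have "cinner (x i) (\<Sum>j\<in>F. x j) = 0"
    using insert.prems insert.hyps by (auto simp: cinner_sum_right intro!: sum.neutral)
  then show ?case
    using insert by (simp add: norm_add_orthogonal)
qed simp

section \<open>Unconditional sums in Banach and Hilbert spaces\<close>

text \<open>Two finite sums over sets containing \<open>F0\<close> both differ from the sum over
  \<open>F0\<close> by a small tail, so the net of finite sums is Cauchy and completeness provides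
  the limit. It serves orthogonal series as well as the scalar series of the extension.\<close>

lemma summable_on_Cauchy_criterion:
  fixes f :: "'i \<Rightarrow> 'a :: banach"
  assumes "\<And>e. e > 0 \<Longrightarrow>
    \<exists>F0. finite F0 \<and> F0 \<subseteq> I \<and> (\<forall>F. finite F \<and> F \<subseteq> I - F0 \<longrightarrow> norm (sum f F) < e)"
  shows "f summable_on I"
proof -
  have "\<exists>P. eventually P (finite_subsets_at_top I) \<and>
          (\<forall>F F'. P F \<and> P F' \<longrightarrow> dist (sum f F) (sum f F') < e)" if "e > 0" for e
  proof -
    have "e / 2 > 0"
      using that by simp
    from assms[OF this] obtain F0 where F0: "finite F0" "F0 \<subseteq> I"
      and *: "\<forall>F. finite F \<and> F \<subseteq> I - F0 \<longrightarrow> norm (sum f F) < e / 2"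
      by (elim exE conjE)
    define P where "P F \<longleftrightarrow> finite F \<and> F0 \<subseteq> F \<and> F \<subseteq> I" for F
    have ev: "eventually P (finite_subsets_at_top I)"
      unfolding eventually_finite_subsets_at_top P_def using F0 by blast
    have close: "dist (sum f F) (sum f F0) < e / 2" if "P F" for F
    proof -
      have "sum f F - sum f F0 = sum f (F - F0)"
        using that F0 by (subst sum_diff) (auto simp: P_def)
      then show ?thesis
        using that *[rule_format, of "F - F0"] by (auto simp: P_def dist_norm)
    qed
    have "dist (sum f F) (sum f F') < e" if "P F" "P F'" for F F'
      using dist_triangle2[of "sum f F" "sum f F'" "sum f F0"] close[OF that(1)] close[OF that(2)]
      by simp
    with ev show ?thesis by blast
  qed
  then have "cauchy_filter (filtermap (sum f) (finite_subsets_at_top I))"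
    by (simp add: cauchy_filter_metric_filtermap)
  moreover have "complete (UNIV :: 'a set)"
    by (meson Cauchy_convergent UNIV_I complete_def convergent_def)
  ultimately obtain L where "(sum f \<longlongrightarrow> L) (finite_subsets_at_top I)"
    using complete_uniform[where S = UNIV] by (force simp add: filterlim_def)
  then show ?thesis
    using summable_on_def has_sum_def by blast
qed

lemma summable_on_nonneg_tail:
  fixes g :: "'i \<Rightarrow> real"
  assumes "g summable_on I" and "\<And>i. i \<in> I \<Longrightarrow> 0 \<le> g i" and "e > 0"
  shows "\<exists>F0. finite F0 \<and> F0 \<subseteq> I \<and> (\<forall>F. finite F \<and> F \<subseteq> I - F0 \<longrightarrow> sum g F < e)"
proof -
  have "\<exists>F0. finite F0 \<and> F0 \<subseteq> I \<and> dist (sum g F0) (infsum g I) \<le> e / 2"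
    by (rule has_sum_finite_approximation[OF has_sum_infsum[OF assms(1)]]) (use assms(3) in simp)
  then obtain F0 where F0: "finite F0" "F0 \<subseteq> I" and d: "dist (sum g F0) (infsum g I) \<le> e / 2"
    by blast
  have "sum g F < e" if F: "finite F" "F \<subseteq> I - F0" for F
  proof -
    have "sum g F0 + sum g F = sum g (F0 \<union> F)"
      using F F0 by (subst sum.union_disjoint) auto
    also have "\<dots> \<le> infsum g I"
      using F F0 assms by (intro finite_sum_le_infsum) auto
    finally show ?thesis
      using d assms(3) unfolding dist_real_def by linarith
  qed
  with F0 show ?thesis by blast
qed

text \<open>Pythagoras turns the norm of a finite tail into a tail of the square sum. The norms
  themselves need not be summable.\<close>

lemma orthogonal_summable_on:
  fixes x :: "'i \<Rightarrow> 'a :: complex_hilbert_space"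
  assumes orth: "\<And>i j. i \<in> I \<Longrightarrow> j \<in> I \<Longrightarrow> i \<noteq> j \<Longrightarrow> cinner (x i) (x j) = 0"
    and "(\<lambda>i. (norm (x i))\<^sup>2) summable_on I"
  shows "x summable_on I"
proof (rule summable_on_Cauchy_criterion)
  fix e :: real assume "e > 0"
  then obtain F0 where F0: "finite F0" "F0 \<subseteq> I"
    and *: "\<And>F. finite F \<Longrightarrow> F \<subseteq> I - F0 \<Longrightarrow> (\<Sum>i\<in>F. (norm (x i))\<^sup>2) < e\<^sup>2"
    using summable_on_nonneg_tail[OF assms(2), of "e\<^sup>2"] by auto
  have "norm (sum x F) < e" if F: "finite F" "F \<subseteq> I - F0" for F
  proof -
    have "(norm (sum x F))\<^sup>2 < e\<^sup>2"
      using *[OF F] F by (subst norm_sum_orthogonal) (auto intro: orth)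
    then show ?thesis
      using \<open>e > 0\<close> by (simp add: power2_less_imp_less)
  qed
  with F0 show "\<exists>F0. finite F0 \<and> F0 \<subseteq> I \<and> (\<forall>F. finite F \<and> F \<subseteq> I - F0 \<longrightarrow> norm (sum x F) < e)"
    by blast
qed

section \<open>Orthonormal sets, projections and expansions\<close>

text \<open>This is \<open>orthonormal_basis\<close> without density. As there, a set of vectors is
  used instead of an indexed family, so distinctness of vectors replaces distinctness of
  indices.\<close>

definition orthonormal_set :: "'a :: complex_inner_space set \<Rightarrow> bool"
  where "orthonormal_set E \<longleftrightarrow>
    (\<forall>x\<in>E. norm x = 1) \<and> (\<forall>x\<in>E. \<forall>y\<in>E. x \<noteq> y \<longrightarrow> cinner x y = 0)"

lemma orthonormal_set_subset: "orthonormal_set E \<Longrightarrow> F \<subseteq> E \<Longrightarrow> orthonormal_set F"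
  by (auto simp: orthonormal_set_def)

lemma orthonormal_set_cinner:
  "orthonormal_set E \<Longrightarrow> x \<in> E \<Longrightarrow> y \<in> E \<Longrightarrow> cinner x y = (if x = y then 1 else 0)"
  by (auto simp: orthonormal_set_def cinner_self)

lemma orthonormal_set_cinner_eq_0:
  "orthonormal_set E \<Longrightarrow> x \<in> E \<Longrightarrow> y \<in> E \<Longrightarrow> x \<noteq> y \<Longrightarrow> cinner x y = 0"
  by (simp add: orthonormal_set_def)

lemma norm_orthonormal_sum:
  assumes "orthonormal_set F" and "finite F"
  shows "(norm (\<Sum>e\<in>F. c e *\<^sub>C e))\<^sup>2 = (\<Sum>e\<in>F. (cmod (c e))\<^sup>2)"
proof -
  have "(norm (\<Sum>e\<in>F. c e *\<^sub>C e))\<^sup>2 = (\<Sum>e\<in>F. (norm (c e *\<^sub>C e))\<^sup>2)"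
    using orthonormal_set_cinner_eq_0[OF assms(1)]
    by (intro norm_sum_orthogonal[OF assms(2)]) (simp add: cinner_scaleC_left cinner_scaleC_right)
  also have "\<dots> = (\<Sum>e\<in>F. (cmod (c e))\<^sup>2)"
    using assms(1) by (intro sum.cong refl) (simp add: norm_scaleC orthonormal_set_def)
  finally show ?thesis .
qed

lemma cinner_orthonormal_sum:
  assumes "orthonormal_set F" and "finite F" and "e \<in> F"
  shows "cinner e (\<Sum>f\<in>F. c f *\<^sub>C f) = c e"
proof -
  have "cinner e (\<Sum>f\<in>F. c f *\<^sub>C f) = (\<Sum>f\<in>F. if f = e then c e else 0)"
    unfolding cinner_sum_right
    using assms(3) by (intro sum.cong refl)
      (simp add: cinner_scaleC_right orthonormal_set_cinner[OF assms(1)])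
  then show ?thesis using assms by simp
qed

text \<open>For finite orthonormal \<open>F\<close> this is the orthogonal projection onto the span.
  For infinite \<open>F\<close> the sum has the default value 0, so only finite sets are
  meant.\<close>

definition orthonormal_projection :: "'a :: complex_inner_space set \<Rightarrow> 'a \<Rightarrow> 'a"
  where "orthonormal_projection F x = (\<Sum>e\<in>F. cinner e x *\<^sub>C e)"

lemma cinner_minus_projection:
  assumes "orthonormal_set F" and "finite F" and "e \<in> F"
  shows "cinner e (x - orthonormal_projection F x) = 0"
  unfolding orthonormal_projection_def
  using cinner_orthonormal_sum[OF assms] by (simp add: cinner_diff_right)

lemma norm_projection:
  assumes "orthonormal_set F" and "finite F"
  shows "(norm (orthonormal_projection F x))\<^sup>2 = (\<Sum>e\<in>F. (cmod (cinner e x))\<^sup>2)"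
  unfolding orthonormal_projection_def by (rule norm_orthonormal_sum[OF assms])

text \<open>The residual is orthogonal to \<open>F\<close>, while the projection minus the
  combination lies in the span of \<open>F\<close>. The identity contains best approximation (drop
  the last sum) and, with \<open>c = 0\<close>, Bessel's inequality.\<close>

lemma norm_minus_orthonormal_sum:
  assumes "orthonormal_set F" and "finite F"
  shows "(norm (x - (\<Sum>e\<in>F. c e *\<^sub>C e)))\<^sup>2 =
    (norm (x - orthonormal_projection F x))\<^sup>2 + (\<Sum>e\<in>F. (cmod (cinner e x - c e))\<^sup>2)"
proof -
  let ?p = "orthonormal_projection F x" and ?d = "\<Sum>e\<in>F. (cinner e x - c e) *\<^sub>C e"
  have "cinner ?d (x - ?p) = 0"
    unfolding cinner_sum_left using cinner_minus_projection[OF assms]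
    by (auto simp: cinner_scaleC_left intro!: sum.neutral)
  then have "cinner (x - ?p) ?d = 0"
    by (simp add: cinner_eq_0_commute)
  moreover have "?d = ?p - (\<Sum>e\<in>F. c e *\<^sub>C e)"
    by (simp add: orthonormal_projection_def complex_vector.scale_left_diff_distrib sum_subtractf)
  ultimately show ?thesis
    using norm_add_orthogonal[of "x - ?p" ?d]
      norm_orthonormal_sum[OF assms, of "\<lambda>e. cinner e x - c e"]
    by simp
qed

lemma norm_projection_Pythagoras:
  assumes "orthonormal_set F" and "finite F"
  shows "(norm x)\<^sup>2 = (norm (x - orthonormal_projection F x))\<^sup>2 + (\<Sum>e\<in>F. (cmod (cinner e x))\<^sup>2)"
  using norm_minus_orthonormal_sum[OF assms, of x "\<lambda>_. 0"] by simp

lemma Bessel_inequality: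
  assumes "orthonormal_set F" and "finite F"
  shows "(\<Sum>e\<in>F. (cmod (cinner e x))\<^sup>2) \<le> (norm x)\<^sup>2"
  using norm_projection_Pythagoras[OF assms, of x] by simp

lemma orthonormal_expansion_summable:
  fixes x :: "'a :: complex_hilbert_space"
  assumes E: "orthonormal_set E"
  shows "(\<lambda>e. cinner e x *\<^sub>C e) summable_on E"
proof (rule orthogonal_summable_on)
  show "cinner (cinner e x *\<^sub>C e) (cinner f x *\<^sub>C f) = 0" if "e \<in> E" "f \<in> E" "e \<noteq> f" for e f
    using orthonormal_set_cinner_eq_0[OF E that] by (simp add: cinner_scaleC_left cinner_scaleC_right)
  have "(\<lambda>e. (cmod (cinner e x))\<^sup>2) summable_on E"
  proof (rule nonneg_bdd_above_summable_on)
    show "bdd_above (sum (\<lambda>e. (cmod (cinner e x))\<^sup>2) ` {F. F \<subseteq> E \<and> finite F})"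
      by (rule bdd_aboveI[of _ "(norm x)\<^sup>2"])
        (auto intro!: Bessel_inequality orthonormal_set_subset[OF E])
  qed simp
  then show "(\<lambda>e. (norm (cinner e x *\<^sub>C e))\<^sup>2) summable_on E"
    by (rule summable_on_cong[THEN iffD1, rotated])
      (use E in \<open>auto simp: norm_scaleC orthonormal_set_def\<close>)
qed

lemma has_sum_in_closure_subspace:
  fixes f :: "'i \<Rightarrow> 'a :: complex_inner_space"
  assumes "(f has_sum s) I" and "complex_vector.subspace M" and "\<And>i. i \<in> I \<Longrightarrow> f i \<in> M"
  shows "s \<in> closure M"
proof (rule Lim_in_closed_set[OF closed_closure])
  show "(sum f \<longlongrightarrow> s) (finite_subsets_at_top I)"
    using assms(1) by (simp add: has_sum_def)
  show "\<forall>\<^sub>F F in finite_subsets_at_top I. sum f F \<in> closure M"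
    using assms(2,3)
    by (intro eventually_finite_subsets_at_top_weakI subsetD[OF closure_subset]
        complex_vector.subspace_sum) auto
qed simp

text \<open>Zorn's lemma gives a maximal set. Were the residual \<open>x - s\<close> nonzero, its
  normalization would lie in \<open>M\<close>, be orthogonal to \<open>E\<close> and contradict
  maximality. The relative form allows a basis of the kernel of \<open>T\<close> to be extended to
  one of the whole space.\<close>

lemma maximal_orthonormal_set:
  fixes M :: "'a :: complex_hilbert_space set"
  assumes M: "closed M" "complex_vector.subspace M" and E0: "orthonormal_set E0" "E0 \<subseteq> M"
  obtains E where "E0 \<subseteq> E" "E \<subseteq> M" "orthonormal_set E"
    "\<And>x. x \<in> M \<Longrightarrow> ((\<lambda>e. cinner e x *\<^sub>C e) has_sum x) E"
proof -
  let ?A = "{E. E0 \<subseteq> E \<and> E \<subseteq> M \<and> orthonormal_set E}"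
  have "\<exists>E\<in>?A. \<forall>X\<in>?A. E \<subseteq> X \<longrightarrow> X = E"
  proof (rule subset_Zorn_nonempty)
    show "?A \<noteq> {}"
      using E0 by blast
    fix C assume C: "C \<noteq> {}" "subset.chain ?A C"
    have sub: "C \<subseteq> ?A" and chain: "\<And>X Y. X \<in> C \<Longrightarrow> Y \<in> C \<Longrightarrow> X \<subseteq> Y \<or> Y \<subseteq> X"
      using C(2) by (auto simp: subset_chain_def)
    have "orthonormal_set (\<Union>C)"
      unfolding orthonormal_set_def
    proof (intro conjI ballI impI)
      fix x y assume "x \<in> \<Union>C" "y \<in> \<Union>C" and ne: "x \<noteq> y"
      then obtain X Y where "X \<in> C" "Y \<in> C" "x \<in> X" "y \<in> Y" by blast
      then obtain Z where "Z \<in> C" "x \<in> Z" "y \<in> Z"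
        using chain[of X Y] by blast
      with sub ne show "cinner x y = 0"
        by (auto simp: orthonormal_set_def)
    qed (use sub in \<open>auto simp: orthonormal_set_def\<close>)
    with sub C(1) show "\<Union>C \<in> ?A" by blast
  qed
  then obtain E where "E \<in> ?A" and "\<forall>X\<in>?A. E \<subseteq> X \<longrightarrow> X = E"
    by (elim bexE)
  then have E: "E0 \<subseteq> E" "E \<subseteq> M" "orthonormal_set E"
    and max: "\<And>X. E0 \<subseteq> X \<Longrightarrow> X \<subseteq> M \<Longrightarrow> orthonormal_set X \<Longrightarrow> E \<subseteq> X \<Longrightarrow> X = E"
    by simp_all
  have "((\<lambda>e. cinner e x *\<^sub>C e) has_sum x) E" if x: "x \<in> M" for x
  proof -
    obtain s where s: "((\<lambda>e. cinner e x *\<^sub>C e) has_sum s) E"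
      using orthonormal_expansion_summable[OF E(3)] summable_on_def by blast
    have "s \<in> closure M"
      by (rule has_sum_in_closure_subspace[OF s M(2)]) (use E(2) M(2) in \<open>auto intro: complex_vector.subspace_scale\<close>)
    then have sM: "s \<in> M" using closure_closed[OF M(1)] by simp
    have orth: "cinner f (x - s) = 0" if f: "f \<in> E" for f
    proof -
      have "((\<lambda>e. cinner f (cinner e x *\<^sub>C e)) has_sum cinner f s) E"
        by (rule has_sum_bounded_linear[OF bounded_linear_cinner_right s])
      moreover have "((\<lambda>e. cinner f (cinner e x *\<^sub>C e)) has_sum cinner f x) E"
        by (rule has_sum_finite_neutralI[of "{f}"])
          (use f orthonormal_set_cinner[OF E(3) f] in \<open>auto simp: cinner_scaleC_right\<close>)
      ultimately have "cinner f s = cinner f x"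
        by (rule has_sum_unique)
      then show ?thesis
        by (simp add: cinner_diff_right)
    qed
    have "x - s = 0"
    proof (rule ccontr)
      assume ne: "x - s \<noteq> 0"
      define u where "u = complex_of_real (1 / norm (x - s)) *\<^sub>C (x - s)"
      have nu: "norm u = 1"
        using ne by (simp add: u_def norm_scaleC norm_divide)
      have ou: "cinner f u = 0" if "f \<in> E" for f
        using orth[OF that] by (simp add: u_def cinner_scaleC_right)
      have "orthonormal_set (insert u E)"
        using E(3) nu ou cinner_eq_0_commute by (fastforce simp: orthonormal_set_def)
      moreover have "u \<in> M"
        unfolding u_def using x sM M(2)
        by (intro complex_vector.subspace_scale complex_vector.subspace_diff)
      ultimately have "insert u E = E"
        using E by (intro max) auto
      then have "u \<in> E" by blast
      with ou have "cinner u u = 0" by blast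
      with nu show False by (simp add: cinner_self)
    qed
    with s show ?thesis by simp
  qed
  with E show thesis by (rule that)
qed

lemma orthonormal_basis_of_expansion:
  fixes E :: "'a :: complex_inner_space set"
  assumes "orthonormal_set E" and "\<And>x. ((\<lambda>e. cinner e x *\<^sub>C e) has_sum x) E"
  shows "orthonormal_basis E"
proof -
  have "x \<in> closure (complex_vector.span E)" for x
    by (rule has_sum_in_closure_subspace[OF assms(2) complex_vector.subspace_span])
      (simp add: complex_vector.span_scale complex_vector.span_base)
  with assms(1) show ?thesis
    by (auto simp: orthonormal_basis_def orthonormal_set_def)
qed

text \<open>Density supplies one finite combination near \<open>x\<close>. For every finite
  \<open>F\<close> containing its support the projection is at least as close, which upgrades
  approximation by some combination to convergence of the net.\<close>

lemma orthonormal_basis_expansion: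
  fixes E :: "'a :: complex_inner_space set"
  assumes "orthonormal_basis E"
  shows "((\<lambda>e. cinner e x *\<^sub>C e) has_sum x) E"
  unfolding has_sum_def tendsto_iff eventually_finite_subsets_at_top
proof (intro allI impI)
  fix r :: real assume r: "r > 0"
  have E: "orthonormal_set E" and "x \<in> closure (complex_vector.span E)"
    using assms by (auto simp: orthonormal_basis_def orthonormal_set_def)
  then obtain z where z: "z \<in> complex_vector.span E" "dist z x < r"
    using r closure_approachable by blast
  then obtain F0 c where F0: "finite F0" "F0 \<subseteq> E" "z = (\<Sum>e\<in>F0. c e *\<^sub>C e)"
    by (auto simp: complex_vector.span_explicit)
  have "dist (\<Sum>e\<in>F. cinner e x *\<^sub>C e) x < r" if F: "finite F" "F0 \<subseteq> F" "F \<subseteq> E" for F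
  proof -
    define d where "d e = (if e \<in> F0 then c e else 0)" for e
    have zd: "z = (\<Sum>e\<in>F. d e *\<^sub>C e)"
      unfolding F0(3) by (rule sum.mono_neutral_cong_left) (use F in \<open>auto simp: d_def\<close>)
    have "(norm (x - orthonormal_projection F x))\<^sup>2 \<le> (norm (x - z))\<^sup>2"
      unfolding zd norm_minus_orthonormal_sum[OF orthonormal_set_subset[OF E F(3)] F(1)]
      by (simp add: sum_nonneg)
    then have "norm (x - orthonormal_projection F x) \<le> norm (x - z)"
      by (rule power2_le_imp_le) simp
    with z(2) show ?thesis
      by (simp add: orthonormal_projection_def dist_norm norm_minus_commute)
  qed
  with F0 show "\<exists>X. finite X \<and> X \<subseteq> E \<and>
      (\<forall>Y. finite Y \<and> X \<subseteq> Y \<and> Y \<subseteq> E \<longrightarrow> dist (\<Sum>e\<in>Y. cinner e x *\<^sub>C e) x < r)"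
    by blast
qed

text \<open>The vectors may be dependent: a zero residual adds nothing to \<open>G\<close>. The last
  conclusion says that \<open>V\<close> lies in the span of \<open>G\<close>, in the form in which
  coordinates and norms are computed later.\<close>

lemma Gram_Schmidt:
  fixes V :: "'a :: complex_inner_space set"
  assumes "finite V"
  obtains G where "finite G" "orthonormal_set G" "G \<subseteq> complex_vector.span V"
    "\<And>v. v \<in> V \<Longrightarrow> orthonormal_projection G v = v"
  using assms
proof (induction V arbitrary: thesis rule: finite_induct)
  case empty
  show ?case by (rule empty[of "{}"]) (auto simp: orthonormal_set_def)
next
  case (insert v V)
  obtain G where G: "finite G" "orthonormal_set G" "G \<subseteq> complex_vector.span V"
    "\<And>v. v \<in> V \<Longrightarrow> orthonormal_projection G v = v"
    using insert.IH by blast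
  define r where "r = v - orthonormal_projection G v"
  have Gspan: "G \<subseteq> complex_vector.span (insert v V)"
    using G(3) complex_vector.span_mono[of V "insert v V"] by blast
  show ?case
  proof (cases "r = 0")
    case True
    then show ?thesis
      using G Gspan by (intro insert.prems[of G]) (auto simp: r_def)
  next
    case False
    define u where "u = complex_of_real (1 / norm r) *\<^sub>C r"
    have nu: "norm u = 1"
      using False by (simp add: u_def norm_scaleC norm_divide)
    have or: "cinner g r = 0" if "g \<in> G" for g
      unfolding r_def by (rule cinner_minus_projection[OF G(2,1) that])
    have ou: "cinner g u = 0" "cinner u g = 0" if "g \<in> G" for g
      using or[OF that] cinner_eq_0_commute[of g u] by (simp_all add: u_def cinner_scaleC_right)
    have uG: "u \<notin> G"
      using ou(1)[of u] nu by (auto simp: cinner_self)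
    have ortho: "orthonormal_set (insert u G)"
      using G(2) nu ou by (auto simp: orthonormal_set_def)
    have "r \<in> complex_vector.span (insert v V)"
      unfolding r_def orthonormal_projection_def using Gspan
      by (intro complex_vector.span_diff complex_vector.span_sum complex_vector.span_scale)
        (auto intro: complex_vector.span_base)
    then have uspan: "u \<in> complex_vector.span (insert v V)"
      unfolding u_def by (rule complex_vector.span_scale)
    have proj: "orthonormal_projection (insert u G) w = cinner u w *\<^sub>C u + orthonormal_projection G w" for w
      using G(1) uG by (simp add: orthonormal_projection_def)
    have "cinner u v = complex_of_real (norm r)"
    proof -
      have "cinner r (orthonormal_projection G v) = 0"
        unfolding orthonormal_projection_def cinner_sum_right using or
        by (auto simp: cinner_scaleC_right cinner_eq_0_commute intro!: sum.neutral)
      then have "cinner r v = complex_of_real ((norm r)\<^sup>2)"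
        using cinner_diff_right[of r v "orthonormal_projection G v"] cinner_self[of r]
        by (simp add: r_def)
      then show ?thesis
        using False by (simp add: u_def cinner_scaleC_left power2_eq_square)
    qed
    then have "orthonormal_projection (insert u G) v = v"
      unfolding proj using False
      by (simp add: u_def scaleC_scaleC scaleC_one r_def)
    moreover have "orthonormal_projection (insert u G) w = w" if "w \<in> V" for w
    proof -
      have "cinner u w = cinner u (orthonormal_projection G w)"
        using G(4)[OF that] by simp
      also have "\<dots> = 0"
        unfolding orthonormal_projection_def cinner_sum_right using ou
        by (auto simp: cinner_scaleC_right intro!: sum.neutral)
      finally show ?thesis
        using G(4)[OF that] by (simp add: proj)
    qed
    ultimately show ?thesis
      using G(1) ortho uspan Gspan by (intro insert.prems[of "insert u G"]) auto
  qed
qed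

section \<open>Random signs\<close>

text \<open>\<open>A\<close> is the set of indices with sign plus, so averaging over
  \<open>Pow F\<close> is the expectation over independent uniform signs.\<close>

definition signed_sum :: "'i set \<Rightarrow> ('i \<Rightarrow> 'a :: real_vector) \<Rightarrow> 'i set \<Rightarrow> 'a"
  where "signed_sum F x A = (\<Sum>k\<in>F. if k \<in> A then x k else - x k)"

lemma sum_Pow_insert:
  fixes f :: "'i set \<Rightarrow> 'b :: comm_monoid_add"
  assumes "finite F" and "a \<notin> F"
  shows "(\<Sum>A\<in>Pow (insert a F). f A) = (\<Sum>A\<in>Pow F. f A + f (insert a A))"
proof -
  have "(\<Sum>A\<in>Pow (insert a F). f A) = (\<Sum>A\<in>Pow F. f A) + (\<Sum>A\<in>insert a ` Pow F. f A)"
    unfolding Pow_insert by (rule sum.union_disjoint) (use assms in auto)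
  also have "(\<Sum>A\<in>insert a ` Pow F. f A) = (\<Sum>A\<in>Pow F. f (insert a A))"
    by (subst sum.reindex) (use assms in \<open>auto simp: inj_on_def\<close>)
  finally show ?thesis by (simp add: sum.distrib)
qed

lemma signed_sum_insert:
  assumes "finite F" and "a \<notin> F" and "A \<subseteq> F"
  shows "signed_sum (insert a F) x A = signed_sum F x A - x a"
    and "signed_sum (insert a F) x (insert a A) = signed_sum F x A + x a"
proof -
  have "a \<notin> A" using assms by auto
  then show "signed_sum (insert a F) x A = signed_sum F x A - x a"
    using assms by (simp add: signed_sum_def)
  have "(\<Sum>k\<in>F. if k \<in> insert a A then x k else - x k) = signed_sum F x A"
    unfolding signed_sum_def using assms by (intro sum.cong) auto
  then show "signed_sum (insert a F) x (insert a A) = signed_sum F x A + x a"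
    using assms by (simp add: signed_sum_def)
qed

text \<open>The parallelogram law: the cross terms cancel between the two signs of the new
  summand.\<close>

lemma signed_sum_second_moment:
  fixes x :: "'i \<Rightarrow> 'a :: real_inner"
  assumes "finite F"
  shows "(\<Sum>A\<in>Pow F. (norm (signed_sum F x A))\<^sup>2) = 2 ^ card F * (\<Sum>k\<in>F. (norm (x k))\<^sup>2)"
  using assms
proof (induction F rule: finite_induct)
  case empty
  show ?case by (simp add: signed_sum_def)
next
  case (insert a F)
  have "(\<Sum>A\<in>Pow (insert a F). (norm (signed_sum (insert a F) x A))\<^sup>2) =
      (\<Sum>A\<in>Pow F. (norm (signed_sum F x A - x a))\<^sup>2 + (norm (signed_sum F x A + x a))\<^sup>2)"
    using insert.hyps signed_sum_insert[OF insert.hyps(1,2), of _ x]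
    by (subst sum_Pow_insert) (auto intro!: sum.cong)
  also have "\<dots> = (\<Sum>A\<in>Pow F. 2 * (norm (signed_sum F x A))\<^sup>2 + 2 * (norm (x a))\<^sup>2)"
    by (intro sum.cong refl)
      (simp add: power2_norm_eq_inner inner_add_left inner_add_right inner_diff_left inner_diff_right
        inner_commute)
  also have "\<dots> = 2 ^ card (insert a F) * (\<Sum>k\<in>insert a F. (norm (x k))\<^sup>2)"
    using insert by (simp add: sum.distrib card_Pow algebra_simps flip: sum_distrib_left)
  finally show ?case .
qed

text \<open>With p the sum of the squared norms, the left side is 2 p^2 plus 8 times the squared
  inner product. Cauchy-Schwarz raises the mixed coefficient from 4 to 4 + 8 = 12.\<close>

lemma norm_power4_sum_diff_le:
  fixes s a :: "'a :: real_inner"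
  shows "norm (s - a) ^ 4 + norm (s + a) ^ 4 \<le> 2 * norm s ^ 4 + 12 * (norm s)\<^sup>2 * (norm a)\<^sup>2 + 2 * norm a ^ 4"
proof -
  let ?p = "(norm s)\<^sup>2 + (norm a)\<^sup>2"
  have 1: "(norm (s - a))\<^sup>2 = ?p - 2 * inner s a" "(norm (s + a))\<^sup>2 = ?p + 2 * inner s a"
    by (simp_all add: power2_norm_eq_inner inner_add_left inner_add_right inner_diff_left
        inner_diff_right inner_commute)
  have p4: "norm v ^ 4 = ((norm v)\<^sup>2)\<^sup>2" for v :: 'a
    by (simp flip: power_mult)
  have "(inner s a)\<^sup>2 \<le> (norm s)\<^sup>2 * (norm a)\<^sup>2"
    using Cauchy_Schwarz_ineq[of s a] by (simp add: power2_norm_eq_inner)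
  then show ?thesis
    unfolding p4 1 by (simp add: power2_eq_square algebra_simps)
qed

text \<open>The constant 3 is the fourth moment of a standard real Gaussian; with it the induction
  closes exactly.\<close>

lemma signed_sum_fourth_moment:
  fixes x :: "'i \<Rightarrow> 'a :: real_inner"
  assumes "finite F"
  shows "(\<Sum>A\<in>Pow F. norm (signed_sum F x A) ^ 4) \<le> 2 ^ card F * (3 * (\<Sum>k\<in>F. (norm (x k))\<^sup>2)\<^sup>2)"
  using assms
proof (induction F rule: finite_induct)
  case empty
  show ?case by (simp add: signed_sum_def)
next
  case (insert a F)
  let ?N = "2 ^ card F :: real" and ?s = "\<Sum>k\<in>F. (norm (x k))\<^sup>2"
  have "(\<Sum>A\<in>Pow (insert a F). norm (signed_sum (insert a F) x A) ^ 4) =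
      (\<Sum>A\<in>Pow F. norm (signed_sum F x A - x a) ^ 4 + norm (signed_sum F x A + x a) ^ 4)"
    using insert.hyps signed_sum_insert[OF insert.hyps(1,2), of _ x]
    by (subst sum_Pow_insert) (auto intro!: sum.cong)
  also have "\<dots> \<le> (\<Sum>A\<in>Pow F. 2 * norm (signed_sum F x A) ^ 4 +
      12 * (norm (signed_sum F x A))\<^sup>2 * (norm (x a))\<^sup>2 + 2 * norm (x a) ^ 4)"
    by (intro sum_mono norm_power4_sum_diff_le)
  also have "\<dots> = 2 * (\<Sum>A\<in>Pow F. norm (signed_sum F x A) ^ 4) +
      12 * (\<Sum>A\<in>Pow F. (norm (signed_sum F x A))\<^sup>2) * (norm (x a))\<^sup>2 + ?N * (2 * norm (x a) ^ 4)"
    using insert.hyps by (simp add: sum.distrib card_Pow sum_distrib_left sum_distrib_right)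
  also have "\<dots> = 2 * (\<Sum>A\<in>Pow F. norm (signed_sum F x A) ^ 4) +
      12 * (?N * ?s) * (norm (x a))\<^sup>2 + ?N * (2 * norm (x a) ^ 4)"
    by (simp add: signed_sum_second_moment[OF insert.hyps(1)])
  \<comment> \<open>The last coefficient is raised from 2 to 6 so that the expression becomes 6
    times the square of the enlarged sum.\<close>
  also have "\<dots> \<le> 2 * (?N * (3 * ?s\<^sup>2)) + 12 * (?N * ?s) * (norm (x a))\<^sup>2 + ?N * (6 * norm (x a) ^ 4)"
    using insert.IH by (intro add_mono mult_left_mono) (auto intro!: mult_nonneg_nonneg sum_nonneg)
  also have "\<dots> = 2 ^ card (insert a F) * (3 * (\<Sum>k\<in>insert a F. (norm (x k))\<^sup>2)\<^sup>2)"
    using insert.hyps by (simp add: power2_eq_square power4_eq_xxxx algebra_simps)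
  finally show ?case .
qed

text \<open>
  The polynomial bound \<open>t \<ge> t\<^sup>2 - 4 t\<^sup>4 / 27\<close> (with equality at \<open>t = 3/2\<close>) reduces the first
  moment to the second and fourth ones.
\<close>

lemma Khintchine:
  fixes x :: "'i \<Rightarrow> 'a :: real_inner"
  assumes "finite F"
  shows "2 ^ card F * (5 / 9 * sqrt (\<Sum>k\<in>F. (norm (x k))\<^sup>2)) \<le> (\<Sum>A\<in>Pow F. norm (signed_sum F x A))"
proof (cases "(\<Sum>k\<in>F. (norm (x k))\<^sup>2) = 0")
  case False
  let ?N = "2 ^ card F :: real" and ?S = "\<lambda>A. norm (signed_sum F x A)"
  define s where "s = sqrt (\<Sum>k\<in>F. (norm (x k))\<^sup>2)"
  have s2: "s\<^sup>2 = (\<Sum>k\<in>F. (norm (x k))\<^sup>2)" and "s > 0"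
    using False by (simp_all add: s_def sum_nonneg less_le)
  have poly: "t\<^sup>2 - 4 / 27 * t ^ 4 \<le> t" if "t \<ge> 0" for t :: real
  proof -
    have "0 \<le> t * ((t - 3 / 2)\<^sup>2 * (t + 3) * (4 / 27))"
      using that by simp
    also have "\<dots> = t - t\<^sup>2 + 4 / 27 * t ^ 4"
      by (simp add: power2_eq_square power4_eq_xxxx field_simps)
    finally show ?thesis by simp
  qed
  \<comment> \<open>The polynomial bound is rescaled by \<open>s\<close>, the root mean square of
    the signed sums.\<close>
  have pt: "(?S A)\<^sup>2 / s - 4 / 27 / s ^ 3 * ?S A ^ 4 \<le> ?S A" for A
  proof -
    have "s * ((?S A / s)\<^sup>2 - 4 / 27 * (?S A / s) ^ 4) \<le> s * (?S A / s)"
      using poly[of "?S A / s"] \<open>s > 0\<close> by (intro mult_left_mono) auto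
    moreover have "s * ((?S A / s)\<^sup>2 - 4 / 27 * (?S A / s) ^ 4) = (?S A)\<^sup>2 / s - 4 / 27 / s ^ 3 * ?S A ^ 4"
      using \<open>s > 0\<close> by (simp add: power2_eq_square power4_eq_xxxx power3_eq_cube field_simps)
    ultimately show ?thesis
      using \<open>s > 0\<close> by simp
  qed
  \<comment> \<open>5/9 is 1 - 3 * 4/27: the second moment contributes 1 and the fourth at most
    3.\<close>
  have "?N * (5 / 9 * s) = ?N * s\<^sup>2 / s - 4 / 27 / s ^ 3 * (?N * (3 * (s\<^sup>2)\<^sup>2))"
    using \<open>s > 0\<close> by (simp add: power2_eq_square power3_eq_cube field_simps)
  also have "\<dots> \<le> (\<Sum>A\<in>Pow F. (?S A)\<^sup>2) / s - 4 / 27 / s ^ 3 * (\<Sum>A\<in>Pow F. ?S A ^ 4)"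
    using signed_sum_second_moment[OF assms, of x] signed_sum_fourth_moment[OF assms, of x] \<open>s > 0\<close>
    unfolding s2[symmetric] by (intro diff_mono mult_left_mono) auto
  also have "\<dots> = (\<Sum>A\<in>Pow F. (?S A)\<^sup>2 / s - 4 / 27 / s ^ 3 * ?S A ^ 4)"
    by (simp add: sum_subtractf sum_divide_distrib sum_distrib_left)
  also have "\<dots> \<le> (\<Sum>A\<in>Pow F. ?S A)"
    by (intro sum_mono pt)
  finally show ?thesis by (simp add: s_def)
qed (simp add: sum_nonneg)

text \<open>The easy half of Khintchine's inequality: Cauchy-Schwarz for the average over the
  signs.\<close>

lemma sum_norm_signed_sum_le:
  fixes x :: "'i \<Rightarrow> 'a :: real_inner"
  assumes "finite F"
  shows "(\<Sum>A\<in>Pow F. norm (signed_sum F x A)) \<le> 2 ^ card F * sqrt (\<Sum>k\<in>F. (norm (x k))\<^sup>2)"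
proof -
  have "(\<Sum>A\<in>Pow F. norm (signed_sum F x A))\<^sup>2 \<le> (\<Sum>A\<in>Pow F. (norm (signed_sum F x A))\<^sup>2) * card (Pow F)"
    by (rule sum_squared_le_sum_of_squares)
  also have "\<dots> = (2 ^ card F * sqrt (\<Sum>k\<in>F. (norm (x k))\<^sup>2))\<^sup>2"
    unfolding signed_sum_second_moment[OF assms] using assms
    by (simp add: card_Pow power_mult_distrib sum_nonneg) (simp add: power2_eq_square)
  finally show ?thesis
    by (rule power2_le_imp_le) (simp add: sum_nonneg)
qed

section \<open>Absolutely summing operators\<close>

text \<open>Choosing signs according to the real parts turns the sum of their absolute values into
  the functional evaluated at a single signed sum; the imaginary parts are treated likewise. This
  accounts for the factor 2.\<close>

lemma sum_cmod_cinner_le: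
  fixes y :: "'j \<Rightarrow> 'a :: complex_inner_space"
  assumes "finite J" and C: "\<And>A. A \<subseteq> J \<Longrightarrow> norm (signed_sum J y A) \<le> C"
  shows "(\<Sum>j\<in>J. cmod (cinner w (y j))) \<le> 2 * C * norm w"
proof -
  have part: "(\<Sum>j\<in>J. \<bar>f (cinner w (y j))\<bar>) \<le> C * norm w"
    if f: "bounded_linear f" "\<And>z. \<bar>f z\<bar> \<le> cmod z" for f :: "complex \<Rightarrow> real"
  proof -
    define A where "A = {j \<in> J. f (cinner w (y j)) \<ge> 0}"
    have lin: "linear (\<lambda>v. f (cinner w v))"
      by (intro bounded_linear.linear bounded_linear_compose[OF f(1)] bounded_linear_cinner_right)
    have "(\<Sum>j\<in>J. \<bar>f (cinner w (y j))\<bar>) = f (cinner w (signed_sum J y A))"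
      unfolding signed_sum_def linear_sum[OF lin]
      by (intro sum.cong refl) (auto simp: A_def linear_neg[OF lin])
    also have "\<dots> \<le> cmod (cinner w (signed_sum J y A))"
      using f(2) abs_le_D1 by blast
    also have "\<dots> \<le> norm w * C"
      using C[of A] by (intro order_trans[OF cinner_Cauchy_Schwarz] mult_left_mono) (auto simp: A_def)
    finally show ?thesis by (simp add: mult.commute)
  qed
  have "(\<Sum>j\<in>J. cmod (cinner w (y j))) \<le>
      (\<Sum>j\<in>J. \<bar>Re (cinner w (y j))\<bar> + \<bar>Im (cinner w (y j))\<bar>)"
    by (intro sum_mono cmod_le)
  also have "\<dots> \<le> C * norm w + C * norm w"
    unfolding sum.distrib
    by (intro add_mono part bounded_linear_Re bounded_linear_Im abs_Re_le_cmod abs_Im_le_cmod)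
  finally show ?thesis by simp
qed

text \<open>
  Hilbert-Schmidt operators are absolutely summing: expand the norm of a value in coordinates with
  respect to an orthonormal set \<open>G\<close>, and replace the square sum by a random signed sum.
\<close>

lemma Hilbert_Schmidt_summing:
  fixes y :: "'j \<Rightarrow> 'h :: complex_inner_space" and t :: "'h \<Rightarrow> 'k :: complex_inner_space"
  assumes J: "finite J" and F: "finite F" "orthonormal_set F"
    and C: "\<And>A. A \<subseteq> J \<Longrightarrow> norm (signed_sum J y A) \<le> C"
  shows "(\<Sum>j\<in>J. norm (\<Sum>e\<in>F. cinner e (y j) *\<^sub>C t e)) \<le> 18 / 5 * C * sqrt (\<Sum>e\<in>F. (norm (t e))\<^sup>2)"
proof -
  obtain G where G: "finite G" "orthonormal_set G" and Gt: "\<And>e. e \<in> F \<Longrightarrow> orthonormal_projection G (t e) = t e"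
    using Gram_Schmidt[of "t ` F"] F(1) by (metis finite_imageI image_eqI)
  \<comment> \<open>\<open>w\<close> is the adjoint of the finite-rank map \<open>R\<close>. A map
    and its adjoint have the same square sum over orthonormal coordinates, which is
    \<open>w2\<close> below.\<close>
  define w where "w g = (\<Sum>e\<in>F. cinner (t e) g *\<^sub>C e)" for g
  define R where "R v = (\<Sum>e\<in>F. cinner e v *\<^sub>C t e)" for v
  let ?N = "2 ^ card G :: real"
  have "C \<ge> 0"
    using C[of "{}"] norm_ge_zero order_trans by blast
  have wR: "cinner (w g) v = cinner g (R v)" for g v
    unfolding w_def R_def cinner_sum_left cinner_sum_right
    by (intro sum.cong refl)
      (simp add: cinner_scaleC_left cinner_scaleC_right cinner_commute[of g "t _"] mult.commute)
  have w2: "(\<Sum>g\<in>G. (norm (w g))\<^sup>2) = (\<Sum>e\<in>F. (norm (t e))\<^sup>2)"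
  proof -
    have "(\<Sum>g\<in>G. (norm (w g))\<^sup>2) = (\<Sum>g\<in>G. \<Sum>e\<in>F. (cmod (cinner g (t e)))\<^sup>2)"
      unfolding w_def using F by (simp add: norm_orthonormal_sum cmod_cinner_commute[of "t _"])
    also have "\<dots> = (\<Sum>e\<in>F. \<Sum>g\<in>G. (cmod (cinner g (t e)))\<^sup>2)"
      by (rule sum.swap)
    also have "\<dots> = (\<Sum>e\<in>F. (norm (t e))\<^sup>2)"
      using norm_projection[OF G(2,1)] Gt by (intro sum.cong refl) metis
    finally show ?thesis .
  qed
  have projR: "orthonormal_projection G (R v) = R v" for v
  proof -
    have "orthonormal_projection G (R v) = (\<Sum>g\<in>G. \<Sum>e\<in>F. cinner e v *\<^sub>C cinner g (t e) *\<^sub>C g)"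
      by (simp add: orthonormal_projection_def R_def cinner_sum_right cinner_scaleC_right
          complex_vector.scale_sum_left)
    also have "\<dots> = (\<Sum>e\<in>F. cinner e v *\<^sub>C orthonormal_projection G (t e))"
      unfolding orthonormal_projection_def complex_vector.scale_sum_right by (rule sum.swap)
    also have "\<dots> = R v"
      unfolding R_def using Gt by (intro sum.cong) auto
    finally show ?thesis .
  qed
  have normR: "?N * (5 / 9 * norm (R v)) \<le> (\<Sum>A\<in>Pow G. cmod (cinner (signed_sum G w A) v))" for v
  proof -
    have "(norm (R v))\<^sup>2 = (\<Sum>g\<in>G. (cmod (cinner (w g) v))\<^sup>2)"
      using norm_projection[OF G(2,1), of "R v"] by (simp add: projR wR)
    then have "norm (R v) = sqrt (\<Sum>g\<in>G. (cmod (cinner (w g) v))\<^sup>2)"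
      by (metis norm_ge_zero real_sqrt_unique)
    moreover have "signed_sum G (\<lambda>g. cinner (w g) v) A = cinner (signed_sum G w A) v" for A
      unfolding signed_sum_def cinner_sum_left
      by (intro sum.cong refl)
        (simp add: linear_neg[OF bounded_linear.linear[OF bounded_linear_cinner_left]])
    ultimately show ?thesis
      using Khintchine[OF G(1), of "\<lambda>g. cinner (w g) v"] by simp
  qed
  have "?N * (5 / 9 * (\<Sum>j\<in>J. norm (R (y j)))) = (\<Sum>j\<in>J. ?N * (5 / 9 * norm (R (y j))))"
    by (simp add: sum_distrib_left)
  \<comment> \<open>The norm of each \<open>R (y j)\<close> is now an average of scalar functionals.
    After exchanging the sums, all \<open>y j\<close> face the same vector for a given choice of
    signs, and the hypothesis on signed sums applies.\<close>
  also have "\<dots> \<le> (\<Sum>j\<in>J. \<Sum>A\<in>Pow G. cmod (cinner (signed_sum G w A) (y j)))"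
    by (intro sum_mono normR)
  also have "\<dots> = (\<Sum>A\<in>Pow G. \<Sum>j\<in>J. cmod (cinner (signed_sum G w A) (y j)))"
    by (rule sum.swap)
  also have "\<dots> \<le> (\<Sum>A\<in>Pow G. 2 * C * norm (signed_sum G w A))"
    by (intro sum_mono sum_cmod_cinner_le[OF J C])
  also have "\<dots> = 2 * C * (\<Sum>A\<in>Pow G. norm (signed_sum G w A))"
    by (simp add: sum_distrib_left)
  also have "\<dots> \<le> 2 * C * (?N * sqrt (\<Sum>e\<in>F. (norm (t e))\<^sup>2))"
    using sum_norm_signed_sum_le[OF G(1), of w] \<open>C \<ge> 0\<close> unfolding w2 by (intro mult_left_mono) auto
  finally have "?N * (5 / 9 * (\<Sum>j\<in>J. norm (R (y j)))) \<le> ?N * (2 * C * sqrt (\<Sum>e\<in>F. (norm (t e))\<^sup>2))"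
    by (simp add: mult_ac)
  \<comment> \<open>The final constant 18/5 is the 2 of \<open>sum_cmod_cinner_le\<close> divided by
    Khintchine's 5/9.\<close>
  then have "5 / 9 * (\<Sum>j\<in>J. norm (R (y j))) \<le> 2 * C * sqrt (\<Sum>e\<in>F. (norm (t e))\<^sup>2)"
    by (simp only: mult_le_cancel_left_pos zero_less_power zero_less_numeral)
  then show ?thesis
    by (simp add: R_def)
qed

section \<open>Flat orthonormal systems\<close>

text \<open>These are the inner products of the rows of the Fourier matrix. The quotient of two
  distinct m-th roots of unity is an m-th root of unity other than 1, so the geometric sum
  vanishes.\<close>

lemma sum_roots_of_unity_orthogonal:
  fixes m :: nat
  defines "z \<equiv> \<lambda>i. cis (2 * pi * real i / real m)"
  assumes "i < m" and "l < m"
  shows "(\<Sum>k<m. cnj (z i ^ k) * z l ^ k) = (if i = l then of_nat m else 0)"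
proof -
  have m: "m > 0" using assms by simp
  have bij: "bij_betw z {..<m} {w. w ^ m = 1}"
    unfolding z_def using Complex.bij_betw_roots_unity[OF m] by simp
  have one: "z j ^ m = 1" if "j < m" for j
    using bij_betwE[OF bij] that by auto
  have cz: "cnj (z j) * z j = 1" for j
    by (simp add: z_def cis_cnj cis_mult)
  define q where "q = cnj (z i) * z l"
  have q: "(\<Sum>k<m. cnj (z i ^ k) * z l ^ k) = (\<Sum>k<m. q ^ k)"
    by (simp add: q_def power_mult_distrib)
  show ?thesis
  proof (cases "i = l")
    case True
    then show ?thesis unfolding q q_def using cz by simp
  next
    case False
    have "q \<noteq> 1"
    proof
      assume "q = 1"
      then have "z i = z l"
        using cz[of i] unfolding q_def by (metis mult.assoc mult.commute mult.right_neutral)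
      then show False
        using False bij assms(2,3) by (auto simp: bij_betw_def inj_on_def)
    qed
    moreover have "q ^ m = 1"
      using one[OF assms(2)] one[OF assms(3)]
      by (simp add: q_def power_mult_distrib flip: complex_cnj_power)
    ultimately show ?thesis
      using False unfolding q by (simp add: geometric_sum)
  qed
qed

text \<open>
  The witness is the discrete Fourier transform of an orthonormal set with randomly chosen signs:
  all its coefficients against a fixed vector have about the same size.
\<close>

lemma flat_orthonormal_family:
  fixes v :: "'j \<Rightarrow> 'k :: complex_inner_space"
  assumes J: "finite J" and b: "\<And>j. j \<in> J \<Longrightarrow> b j \<ge> 0"
  obtains f :: "nat \<Rightarrow> 'k" and m where
    "\<And>i l. i < m \<Longrightarrow> l < m \<Longrightarrow> cinner (f i) (f l) = (if i = l then 1 else 0)"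
    "\<And>i. f i \<in> complex_vector.span (v ` J)"
    "5 / 9 * (\<Sum>j\<in>J. b j * norm (v j)) \<le> (\<Sum>i<m. \<Sum>j\<in>J. b j / sqrt m * cmod (cinner (f i) (v j)))"
proof -
  obtain G where G: "finite G" "orthonormal_set G" "G \<subseteq> complex_vector.span (v ` J)"
    and Gv: "\<And>j. j \<in> J \<Longrightarrow> orthonormal_projection G (v j) = v j"
    using Gram_Schmidt[of "v ` J"] J by (metis finite_imageI image_eqI)
  define m where "m = card G"
  obtain g where g: "bij_betw g {..<m} G"
    using ex_bij_betw_nat_finite[OF G(1)] by (auto simp: m_def atLeast0LessThan)
  define z where "z i = cis (2 * pi * real i / real m)" for i
  have cz: "cmod (z i) = 1" for i by (simp add: z_def)
  \<comment> \<open>Row \<open>i\<close> of the Fourier matrix, divided by \<open>sqrt m\<close> and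
    applied to the basis \<open>g\<close> with signs given by \<open>A\<close>. The signs are the
    same for all rows, so orthonormality holds for every \<open>A\<close>.\<close>
  define f where "f A i = complex_of_real (1 / sqrt m) *\<^sub>C signed_sum {..<m} (\<lambda>k. z i ^ k *\<^sub>C g k) A"
    for A i
  have gg: "cinner (g k) (g l) = (if k = l then 1 else 0)" if "k < m" "l < m" for k l
    using orthonormal_set_cinner[OF G(2), of "g k" "g l"] g that
    by (auto simp: bij_betw_def inj_on_def)
  have gG: "g k \<in> G" if "k < m" for k
    using g that by (auto simp: bij_betw_def)
  have ortho: "cinner (f A i) (f A l) = (if i = l then 1 else 0)" if il: "i < m" "l < m" for A i l
  proof -
    let ?s = "\<lambda>k. if k \<in> A then 1 else - 1 :: complex"
    have ss: "signed_sum {..<m} (\<lambda>k. z i ^ k *\<^sub>C g k) A = (\<Sum>k<m. (?s k * z i ^ k) *\<^sub>C g k)" for i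
      unfolding signed_sum_def by (intro sum.cong) (auto simp: complex_vector.scale_minus_left)
    have "cinner (\<Sum>k<m. (?s k * z i ^ k) *\<^sub>C g k) (\<Sum>k<m. (?s k * z l ^ k) *\<^sub>C g k) =
        (\<Sum>k<m. \<Sum>k'<m. if k' = k then cnj (z i ^ k) * z l ^ k else 0)"
      unfolding cinner_sum_left cinner_sum_right
      by (intro sum.cong refl) (auto simp: cinner_scaleC_left cinner_scaleC_right gg)
    also have "\<dots> = (\<Sum>k<m. cnj (z i ^ k) * z l ^ k)"
      by simp
    also have "\<dots> = (if i = l then of_nat m else 0)"
      unfolding z_def by (rule sum_roots_of_unity_orthogonal[OF il])
    finally show ?thesis
      using il by (simp add: f_def ss cinner_scaleC_left cinner_scaleC_right flip: of_real_mult)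
  qed
  have span: "f A i \<in> complex_vector.span (v ` J)" for A i
    unfolding f_def signed_sum_def using gG G(3)
    by (intro complex_vector.span_scale complex_vector.span_sum)
      (auto intro: complex_vector.span_neg complex_vector.span_scale)
  \<comment> \<open>The powers of \<open>z i\<close> have modulus one, so the coordinates of
    \<open>v j\<close> keep their square sum and Khintchine gives the same lower bound for every
    \<open>i\<close>.\<close>
  have coeff: "(\<Sum>A\<in>Pow {..<m}. cmod (cinner (f A i) (v j))) \<ge> 2 ^ m * (5 / 9 * (norm (v j) / sqrt m))"
    if j: "j \<in> J" for i j
  proof -
    let ?x = "\<lambda>k. cnj (z i ^ k) * cinner (g k) (v j)"
    have eq: "cinner (f A i) (v j) = complex_of_real (1 / sqrt m) * signed_sum {..<m} ?x A" for A
      unfolding f_def signed_sum_def cinner_scaleC_left cinner_sum_left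
      by (intro arg_cong2[where f = times] sum.cong)
        (auto simp: cinner_scaleC_left linear_neg[OF bounded_linear.linear[OF bounded_linear_cinner_left]])
    have "(norm (v j))\<^sup>2 = (\<Sum>e\<in>G. (cmod (cinner e (v j)))\<^sup>2)"
      using norm_projection[OF G(2,1), of "v j"] Gv[OF j] by simp
    also have "\<dots> = (\<Sum>k<m. (cmod (?x k))\<^sup>2)"
      using sum.reindex_bij_betw[OF g, of "\<lambda>e. (cmod (cinner e (v j)))\<^sup>2"]
      by (simp add: norm_mult norm_power cz)
    finally have "norm (v j) = sqrt (\<Sum>k<m. (cmod (?x k))\<^sup>2)"
      by (metis norm_ge_zero real_sqrt_unique)
    then have "2 ^ m * (5 / 9 * norm (v j)) \<le> (\<Sum>A\<in>Pow {..<m}. cmod (signed_sum {..<m} ?x A))"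
      using Khintchine[of "{..<m}" ?x] by simp
    then have "1 / sqrt m * (2 ^ m * (5 / 9 * norm (v j))) \<le>
        1 / sqrt m * (\<Sum>A\<in>Pow {..<m}. cmod (signed_sum {..<m} ?x A))"
      by (intro mult_left_mono) auto
    also have "\<dots> = (\<Sum>A\<in>Pow {..<m}. cmod (cinner (f A i) (v j)))"
      by (simp add: eq norm_mult norm_divide sum_distrib_left)
    finally show ?thesis by simp
  qed
  define Q where "Q A = (\<Sum>i<m. \<Sum>j\<in>J. b j / sqrt m * cmod (cinner (f A i) (v j)))" for A
  let ?B = "5 / 9 * (\<Sum>j\<in>J. b j * norm (v j))"
  have "\<exists>A. ?B \<le> Q A"
  proof (cases "m = 0")
    \<comment> \<open>An empty Gram-Schmidt set forces every \<open>v j\<close> to vanish, and both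
      sides are zero.\<close>
    case True
    then have "v j = 0" if "j \<in> J" for j
      using Gv[OF that] G(1) by (simp add: m_def orthonormal_projection_def)
    then show ?thesis by (simp add: Q_def True)
  next
    case False
    \<comment> \<open>Summing over the \<open>m\<close> rows cancels the two factors
      \<open>1 / sqrt m\<close>. The weighted total is averaged as a whole, so one choice of signs
      works for all rows and all \<open>j\<close> together.\<close>
    have "2 ^ m * ?B = (\<Sum>i<m. \<Sum>j\<in>J. b j / sqrt m * (2 ^ m * (5 / 9 * (norm (v j) / sqrt m))))"
      using False by (simp add: sum_distrib_left field_simps)
    also have "\<dots> \<le> (\<Sum>i<m. \<Sum>j\<in>J. b j / sqrt m * (\<Sum>A\<in>Pow {..<m}. cmod (cinner (f A i) (v j))))"
      using b coeff by (intro sum_mono mult_left_mono) auto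
    also have "\<dots> = (\<Sum>i<m. \<Sum>A\<in>Pow {..<m}. \<Sum>j\<in>J. b j / sqrt m * cmod (cinner (f A i) (v j)))"
      unfolding sum_distrib_left by (intro sum.cong refl sum.swap)
    also have "\<dots> = (\<Sum>A\<in>Pow {..<m}. Q A)"
      unfolding Q_def by (rule sum.swap)
    finally have *: "2 ^ m * ?B \<le> (\<Sum>A\<in>Pow {..<m}. Q A)" .
    show ?thesis
    proof (rule ccontr)
      assume "\<not> ?thesis"
      then have "(\<Sum>A\<in>Pow {..<m}. Q A) < (\<Sum>A\<in>Pow {..<m}. ?B)"
        by (intro sum_strict_mono) (auto simp: not_le)
      with * show False by (simp add: card_Pow)
    qed
  qed
  then obtain A where "?B \<le> Q A" ..
  then show thesis
    using ortho span by (intro that[of m "f A"]) (auto simp: Q_def)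
qed

section \<open>Vector measures\<close>

lemma semi_measure_algebra: "semi_measure \<Omega> M \<phi> \<Longrightarrow> algebra \<Omega> M"
  by (simp add: semi_measure_def)

lemma vector_measure_sigma_algebra: "vector_measure \<Omega> M \<phi> \<Longrightarrow> sigma_algebra \<Omega> M"
  by (simp add: vector_measure_def)

lemma vector_measure_semi_measure: "vector_measure \<Omega> M \<phi> \<Longrightarrow> semi_measure \<Omega> M \<phi>"
  by (simp add: vector_measure_def)

lemma semi_measure_empty:
  assumes "semi_measure \<Omega> M \<phi>"
  shows "\<phi> {} = 0"
proof -
  interpret algebra \<Omega> M using assms by (rule semi_measure_algebra)
  have "\<phi> ({} \<union> {}) = \<phi> {} + \<phi> {}"
    using assms by (intro additiveD[of M]) (auto simp: semi_measure_def)
  then show ?thesis by simp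
qed

lemma semi_measure_UN:
  assumes \<phi>: "semi_measure \<Omega> M \<phi>" and "finite J" and "A ` J \<subseteq> M" and "disjoint_family_on A J"
  shows "\<phi> (\<Union>j\<in>J. A j) = (\<Sum>j\<in>J. \<phi> (A j))"
  using assms(2-4)
proof (induction J rule: finite_induct)
  case empty
  show ?case using semi_measure_empty[OF \<phi>] by simp
next
  case (insert i J)
  interpret algebra \<Omega> M using \<phi> by (rule semi_measure_algebra)
  have "A i \<inter> (\<Union>j\<in>J. A j) = {}"
    using insert.prems insert.hyps by (auto simp: disjoint_family_on_def)
  moreover have "(\<Union>j\<in>J. A j) \<in> M"
    using insert by (intro finite_UN) auto
  ultimately have "\<phi> (A i \<union> (\<Union>j\<in>J. A j)) = \<phi> (A i) + \<phi> (\<Union>j\<in>J. A j)"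
    using insert.prems \<phi> by (intro additiveD[of M]) (auto simp: semi_measure_def)
  also have "\<phi> (\<Union>j\<in>J. A j) = (\<Sum>j\<in>J. \<phi> (A j))"
    using insert.prems by (intro insert.IH) (auto simp: disjoint_family_on_def)
  finally show ?case using insert.hyps by simp
qed

lemma semi_measure_Un:
  assumes "semi_measure \<Omega> M \<phi>" and "A \<in> M" "B \<in> M" "A \<inter> B = {}"
  shows "\<phi> (A \<union> B) = \<phi> A + \<phi> B"
  using assms by (intro additiveD[of M]) (auto simp: semi_measure_def)

lemma semi_measure_Diff:
  assumes "semi_measure \<Omega> M \<phi>" and "A \<in> M" "B \<in> M" "A \<subseteq> B"
  shows "\<phi> (B - A) = \<phi> B - \<phi> A"
proof -
  interpret algebra \<Omega> M using assms(1) by (rule semi_measure_algebra)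
  have "\<phi> (A \<union> (B - A)) = \<phi> A + \<phi> (B - A)"
    using assms by (intro semi_measure_Un[OF assms(1)]) auto
  moreover have "A \<union> (B - A) = B" using assms by auto
  ultimately show ?thesis by simp
qed

lemma vector_measure_sums:
  assumes "vector_measure \<Omega> M \<phi>" and "range A \<subseteq> M" and "disjoint_family A"
  shows "(\<lambda>i. \<phi> (A i)) sums \<phi> (\<Union>i. A i)"
  using assms by (simp add: vector_measure_def)

text \<open>Finite additivity comes from countable additivity by padding a pair with empty sets,
  whose value 0 makes the series a sum of two terms.\<close>

lemma vector_measureI:
  assumes M: "sigma_algebra \<Omega> M" and empty: "\<phi> {} = 0"
    and sums: "\<And>A :: nat \<Rightarrow> 's set. range A \<subseteq> M \<Longrightarrow> disjoint_family A \<Longrightarrow>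
      (\<lambda>i. \<phi> (A i)) sums \<phi> (\<Union>i. A i)"
  shows "vector_measure \<Omega> M \<phi>"
proof -
  interpret sigma_algebra \<Omega> M by fact
  have "\<phi> (A \<union> B) = \<phi> A + \<phi> B" if "A \<in> M" "B \<in> M" "A \<inter> B = {}" for A B
  proof -
    have "(\<lambda>i. \<phi> (binaryset A B i)) sums \<phi> (\<Union>i. binaryset A B i)"
      using that by (intro sums) (auto simp: range_binaryset_eq disjoint_family_on_def binaryset_def)
    moreover have "(\<lambda>i. \<phi> (binaryset A B i)) sums (\<Sum>i<2. \<phi> (binaryset A B i))"
      by (rule sums_finite) (auto simp: binaryset_def empty)
    ultimately have "\<phi> (\<Union>i. binaryset A B i) = (\<Sum>i<2. \<phi> (binaryset A B i))"
      by (rule sums_unique2)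
    then show ?thesis
      by (simp add: UN_binaryset_eq numeral_2_eq_2 binaryset_def)
  qed
  then have "additive M \<phi>"
    by (simp add: additive_def)
  moreover have "algebra \<Omega> M" ..
  ultimately show ?thesis
    using M sums by (simp add: vector_measure_def semi_measure_def)
qed

lemma vector_measure_bounded_linear:
  assumes "bounded_linear f" and \<phi>: "vector_measure \<Omega> M \<phi>"
  shows "vector_measure \<Omega> M (\<lambda>A. f (\<phi> A))"
proof (rule vector_measureI)
  show "f (\<phi> {}) = 0"
    using semi_measure_empty[OF vector_measure_semi_measure[OF \<phi>]] assms(1)
    by (simp add: linear_0 bounded_linear.linear)
  show "(\<lambda>i. f (\<phi> (A i))) sums f (\<phi> (\<Union>i. A i))" if "range A \<subseteq> M" "disjoint_family A" for A
    by (rule bounded_linear.sums[OF assms(1) vector_measure_sums[OF \<phi> that]])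
qed (use \<phi> in \<open>auto simp: vector_measure_def\<close>)

lemma vector_measure_sum:
  assumes "sigma_algebra \<Omega> M" and "\<And>i. i \<in> I \<Longrightarrow> vector_measure \<Omega> M (\<phi> i)"
  shows "vector_measure \<Omega> M (\<lambda>A. \<Sum>i\<in>I. \<phi> i A)"
proof (rule vector_measureI)
  show "(\<Sum>i\<in>I. \<phi> i {}) = 0"
    using semi_measure_empty[OF vector_measure_semi_measure[OF assms(2)]] by simp
  show "(\<lambda>n. \<Sum>i\<in>I. \<phi> i (A n)) sums (\<Sum>i\<in>I. \<phi> i (\<Union>n. A n))"
    if "range A \<subseteq> M" "disjoint_family A" for A
    using that by (intro sums_sum vector_measure_sums[OF assms(2)])
qed (fact assms(1))

text \<open>
  If the measure were unbounded below a set, then it would be unbounded below one of two pieces of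
  that set, the other piece having measure at least one; iterating this yields disjoint sets that
  contradict countable additivity.
\<close>

lemma vector_measure_bounded:
  assumes \<phi>: "vector_measure \<Omega> M \<phi>"
  obtains K where "K \<ge> 0" "\<And>A. A \<in> M \<Longrightarrow> norm (\<phi> A) \<le> K"
proof (rule ccontr)
  assume neg: "\<not> thesis"
  interpret sigma_algebra \<Omega> M using \<phi> by (rule vector_measure_sigma_algebra)
  have sm: "semi_measure \<Omega> M \<phi>" using \<phi> by (rule vector_measure_semi_measure)
  define bad where "bad E \<longleftrightarrow> E \<in> M \<and> (\<forall>K. \<exists>B\<in>M. B \<subseteq> E \<and> norm (\<phi> B) > K)" for E
  have "bad \<Omega>"
  proof (rule ccontr)
    assume "\<not> bad \<Omega>"
    then obtain K where "\<And>B. B \<in> M \<Longrightarrow> norm (\<phi> B) \<le> K"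
      using sets_into_space by (force simp: bad_def not_less)
    with neg show False
      using that[of "max 0 K"] by (meson max.cobounded1 max.coboundedI2)
  qed
  have step: "\<exists>E'. bad E' \<and> E' \<subseteq> E \<and> norm (\<phi> (E - E')) \<ge> 1" if E: "bad E" for E
  proof -
    have EM: "E \<in> M" using E by (simp add: bad_def)
    \<comment> \<open>The margin \<open>norm (\<phi> E) + 1\<close> makes both \<open>B\<close> and
      \<open>E - B\<close> have value of norm at least one, so either of them may be the bad piece
      that is kept.\<close>
    obtain B where B: "B \<in> M" "B \<subseteq> E" "norm (\<phi> B) > norm (\<phi> E) + 1"
      using E unfolding bad_def by blast
    have "\<phi> (E - B) = \<phi> E - \<phi> B"
      by (rule semi_measure_Diff[OF sm]) (use B EM in auto)
    then have big: "norm (\<phi> (E - B)) \<ge> 1"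
      using B(3) norm_triangle_ineq2[of "\<phi> B" "\<phi> E"] norm_minus_commute[of "\<phi> B" "\<phi> E"] by simp
    have "bad B \<or> bad (E - B)"
    proof (rule ccontr)
      assume "\<not> ?thesis"
      then have "\<not> bad B" "\<not> bad (E - B)" by simp_all
      moreover have "E - B \<in> M" using B EM by auto
      ultimately have "\<exists>K. \<forall>C\<in>M. C \<subseteq> B \<longrightarrow> norm (\<phi> C) \<le> K"
        and "\<exists>K. \<forall>C\<in>M. C \<subseteq> E - B \<longrightarrow> norm (\<phi> C) \<le> K"
        using B(1) unfolding bad_def by (meson not_less)+
      then obtain K1 K2 where K1: "\<And>C. C \<in> M \<Longrightarrow> C \<subseteq> B \<Longrightarrow> norm (\<phi> C) \<le> K1"
        and K2: "\<And>C. C \<in> M \<Longrightarrow> C \<subseteq> E - B \<Longrightarrow> norm (\<phi> C) \<le> K2"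
        by metis
      obtain C where C: "C \<in> M" "C \<subseteq> E" "norm (\<phi> C) > K1 + K2"
        using E unfolding bad_def by blast
      have "\<phi> ((C \<inter> B) \<union> (C - B)) = \<phi> (C \<inter> B) + \<phi> (C - B)"
        using C B by (intro semi_measure_Un[OF sm]) auto
      moreover have "(C \<inter> B) \<union> (C - B) = C" by auto
      moreover have "norm (\<phi> (C \<inter> B)) \<le> K1"
        using C B by (intro K1) auto
      moreover have "norm (\<phi> (C - B)) \<le> K2"
        using C B by (intro K2) auto
      ultimately show False
        using C(3) norm_triangle_ineq[of "\<phi> (C \<inter> B)" "\<phi> (C - B)"] by simp
    qed
    then show ?thesis
    proof
      assume "bad B"
      then show ?thesis using B big by blast
    next
      assume "bad (E - B)"
      moreover have "E - (E - B) = B" using B(2) by auto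
      moreover have "norm (\<phi> B) \<ge> 1" using B(3) norm_ge_zero[of "\<phi> E"] by linarith
      ultimately show ?thesis by (intro exI[of _ "E - B"]) auto
    qed
  qed
  have "\<exists>E. \<forall>n. bad (E n) \<and> E (Suc n) \<subseteq> E n \<and> norm (\<phi> (E n - E (Suc n))) \<ge> 1"
    using dependent_nat_choice[of "\<lambda>_. bad" "\<lambda>_ E E'. E' \<subseteq> E \<and> norm (\<phi> (E - E')) \<ge> 1"]
      \<open>bad \<Omega>\<close> step by blast
  then obtain E where E: "\<And>n. bad (E n)" "\<And>n. E (Suc n) \<subseteq> E n" "\<And>n. norm (\<phi> (E n - E (Suc n))) \<ge> 1"
    by blast
  have mono: "E n \<subseteq> E m" if "m \<le> n" for m n
    using that by (rule lift_Suc_antimono_le[of E, OF E(2)])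
  have "disjoint_family (\<lambda>n. E n - E (Suc n))"
    unfolding disjoint_family_on_def
  proof (intro ballI impI)
    fix m n :: nat assume "m \<noteq> n"
    then consider "Suc m \<le> n" | "Suc n \<le> m" by linarith
    then show "(E m - E (Suc m)) \<inter> (E n - E (Suc n)) = {}"
      by cases (use mono in fast)+
  qed
  then have "(\<lambda>n. \<phi> (E n - E (Suc n))) sums \<phi> (\<Union>n. E n - E (Suc n))"
    using E(1) by (intro vector_measure_sums[OF \<phi>]) (auto simp: bad_def)
  then have "(\<lambda>n. \<phi> (E n - E (Suc n))) \<longlonglongrightarrow> 0"
    using sums_summable summable_LIMSEQ_zero by blast
  then have "(\<lambda>n. norm (\<phi> (E n - E (Suc n)))) \<longlonglongrightarrow> 0"
    by (rule tendsto_norm_zero)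
  moreover have "\<forall>n. norm (\<phi> (E n - E (Suc n))) \<ge> 1" using E(3) by blast
  ultimately show False
    using LIMSEQ_le_const[of _ 0 1] by fastforce
qed

text \<open>The indices of either sign contribute the value of \<open>\<phi>\<close> on one union,
  hence the factor 2. This bounded-signs property of measures is the input of the summing
  estimate.\<close>

lemma semi_measure_norm_signed_sum:
  assumes \<phi>: "semi_measure \<Omega> M \<phi>" and K: "\<And>A. A \<in> M \<Longrightarrow> norm (\<phi> A) \<le> K"
    and J: "finite J" "B ` J \<subseteq> M" "disjoint_family_on B J"
  shows "norm (signed_sum J (\<lambda>j. \<phi> (B j)) A) \<le> 2 * K"
proof -
  interpret algebra \<Omega> M using \<phi> by (rule semi_measure_algebra)
  have sub: "(\<Sum>j\<in>L. \<phi> (B j)) = \<phi> (\<Union>j\<in>L. B j)" "(\<Union>j\<in>L. B j) \<in> M" if "L \<subseteq> J" for L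
  proof -
    show "(\<Sum>j\<in>L. \<phi> (B j)) = \<phi> (\<Union>j\<in>L. B j)"
      using that J finite_subset[OF that] disjoint_family_on_mono[OF that]
      by (intro semi_measure_UN[OF \<phi>, symmetric]) auto
    show "(\<Union>j\<in>L. B j) \<in> M"
      using that J finite_subset[OF that] by (intro finite_UN) auto
  qed
  have "signed_sum J (\<lambda>j. \<phi> (B j)) A = (\<Sum>j\<in>J \<inter> A. \<phi> (B j)) - (\<Sum>j\<in>J - A. \<phi> (B j))"
    unfolding signed_sum_def using J(1)
    by (simp add: sum.If_cases sum_negf Collect_mem_eq Diff_eq)
  also have "norm \<dots> \<le> norm (\<Sum>j\<in>J \<inter> A. \<phi> (B j)) + norm (\<Sum>j\<in>J - A. \<phi> (B j))"
    by (rule norm_triangle_ineq4)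
  also have "\<dots> \<le> K + K"
    using sub[of "J \<inter> A"] sub[of "J - A"] by (intro add_mono) (auto intro: K)
  finally show ?thesis by simp
qed

text \<open>The factor 4 is 2 for the two signs times 2 for real and imaginary parts.\<close>

lemma complex_semi_measure_sum_cmod:
  fixes \<phi> :: "'s set \<Rightarrow> complex"
  assumes "semi_measure \<Omega> M \<phi>" and "\<And>A. A \<in> M \<Longrightarrow> cmod (\<phi> A) \<le> K"
    and "finite J" "B ` J \<subseteq> M" "disjoint_family_on B J"
  shows "(\<Sum>j\<in>J. cmod (\<phi> (B j))) \<le> 4 * K"
  using sum_cmod_cinner_le[OF assms(3) semi_measure_norm_signed_sum[OF assms], of 1]
  by (simp add: cinner_complex_def)

text \<open>An extension that is a measure on a \<sigma>-algebra is bounded there, and a bounded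
  complex semi-measure has finite variation.\<close>

lemma extension_bounded:
  assumes \<psi>: "vector_measure \<Omega> N \<psi>" and "M \<subseteq> N" and \<phi>: "semi_measure \<Omega> M \<phi>"
    and ext: "\<And>X. X \<in> M \<Longrightarrow> \<psi> X = \<phi> X"
  shows "bounded_semi_measure \<Omega> M \<phi>"
proof -
  obtain K where K: "K \<ge> 0" "\<And>A. A \<in> N \<Longrightarrow> norm (\<psi> A) \<le> K"
    using vector_measure_bounded[OF \<psi>] by blast
  have "total_variation \<Omega> M \<phi> \<le> ennreal (4 * K)"
    unfolding total_variation_def
  proof (rule SUP_least)
    fix P assume "P \<in> {P. finite P \<and> P \<subseteq> M \<and> partition_on \<Omega> P}"
    then have P: "finite P" "P \<subseteq> M" "partition_on \<Omega> P" by auto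
    have "(\<Sum>A\<in>P. cmod (\<phi> A)) \<le> 4 * K"
    proof (rule complex_semi_measure_sum_cmod[OF \<phi> _ P(1), where B = "\<lambda>A. A"])
      show "cmod (\<phi> A) \<le> K" if "A \<in> M" for A
        using K(2)[of A] ext[OF that] assms(2) that by auto
      show "disjoint_family_on (\<lambda>A. A) P"
        using partition_onD2[OF P(3)] by (auto simp: disjoint_def disjoint_family_on_def)
    qed (use P in auto)
    then show "ennreal (\<Sum>A\<in>P. cmod (\<phi> A)) \<le> ennreal (4 * K)"
      by (rule ennreal_leI)
  qed
  also have "\<dots> < \<infinity>" by simp
  finally show ?thesis
    using \<phi> by (simp add: bounded_semi_measure_def)
qed

lemma bounded_semi_measure_disjoint_sum:
  assumes "bounded_semi_measure \<Omega> M \<phi>"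
  obtains K where "\<And>D. finite D \<Longrightarrow> D \<subseteq> M \<Longrightarrow> disjoint D \<Longrightarrow> (\<Sum>A\<in>D. cmod (\<phi> A)) \<le> K"
proof -
  have \<phi>: "semi_measure \<Omega> M \<phi>" and fin: "total_variation \<Omega> M \<phi> < \<infinity>"
    using assms by (auto simp: bounded_semi_measure_def)
  interpret algebra \<Omega> M using \<phi> by (rule semi_measure_algebra)
  obtain K where K: "total_variation \<Omega> M \<phi> = ennreal K" "K \<ge> 0"
    using fin by (cases "total_variation \<Omega> M \<phi>") auto
  have "(\<Sum>A\<in>D. cmod (\<phi> A)) \<le> K" if D: "finite D" "D \<subseteq> M" "disjoint D" for D
  proof -
    \<comment> \<open>The complement of the union completes the family to a partition. The empty set
      is removed because \<open>partition_on\<close> forbids it, and its value is 0.\<close>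
    define P where "P = insert (\<Omega> - \<Union>D) D - {{}}"
    have U: "\<Union>D \<in> M" using D by auto
    have "finite P" "P \<subseteq> M" using D U by (auto simp: P_def)
    moreover have "partition_on \<Omega> P"
    proof (rule partition_onI)
      show "\<Union>P = \<Omega>"
        using sets_into_space[OF U] unfolding P_def by blast
      show "disjnt p q" if "p \<in> P" "q \<in> P" "p \<noteq> q" for p q
        using that D(3) unfolding P_def disjnt_def disjoint_def by blast
    qed (simp add: P_def)
    ultimately have "ennreal (\<Sum>A\<in>P. cmod (\<phi> A)) \<le> ennreal K"
      unfolding K(1)[symmetric] total_variation_def by (intro SUP_upper) auto
    then have "(\<Sum>A\<in>P. cmod (\<phi> A)) \<le> K" using K(2) by simp
    moreover have "(\<Sum>A\<in>D. cmod (\<phi> A)) = (\<Sum>A\<in>D - {{}}. cmod (\<phi> A))"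
      using D(1) semi_measure_empty[OF \<phi>] by (intro sum.mono_neutral_right) auto
    moreover have "\<dots> \<le> (\<Sum>A\<in>P. cmod (\<phi> A))"
      using \<open>finite P\<close> by (intro sum_mono2) (auto simp: P_def)
    ultimately show ?thesis by simp
  qed
  then show thesis by (rule that)
qed

section \<open>The product semi-measure\<close>

definition slice :: "('s \<times> 't) set \<Rightarrow> 't \<Rightarrow> 's set"
  where "slice X t = {s. (s, t) \<in> X}"

text \<open>
  The product algebra consists of the sets with only finitely many different slices, each of which
  occurs over a measurable set. This representation replaces finite disjoint unions of rectangles.
\<close>

definition simple_slices ::
    "'s set \<Rightarrow> 's set set \<Rightarrow> 't set \<Rightarrow> 't set set \<Rightarrow> ('s \<times> 't) set \<Rightarrow> bool"
  where "simple_slices S \<A> S' \<B> X \<longleftrightarrow>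
    X \<subseteq> S \<times> S' \<and> (\<forall>t\<in>S'. slice X t \<in> \<A>) \<and> simple_function (sigma S' \<B>) (slice X)"

lemma space_sets_sigma:
  assumes "sigma_algebra S' \<B>"
  shows "space (sigma S' \<B>) = S'" "sets (sigma S' \<B>) = \<B>"
proof -
  interpret sigma_algebra S' \<B> by fact
  show "space (sigma S' \<B>) = S'" "sets (sigma S' \<B>) = \<B>"
    using space_closed by (simp_all add: space_measure_of sets_measure_of_eq)
qed

lemma simple_function_level_set:
  assumes "sigma_algebra S' \<B>" and "simple_function (sigma S' \<B>) p"
  shows "finite (p ` S')" "{t\<in>S'. p t = c} \<in> \<B>"
proof -
  note sp = space_sets_sigma[OF assms(1)]
  show "finite (p ` S')"
    using simple_functionD(1)[OF assms(2)] by (simp add: sp)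
  have "p -` {c} \<inter> space (sigma S' \<B>) \<in> sets (sigma S' \<B>)"
    by (rule simple_functionD(2)[OF assms(2)])
  then have "p -` {c} \<inter> S' \<in> \<B>"
    unfolding sp .
  moreover have "p -` {c} \<inter> S' = {t\<in>S'. p t = c}" by auto
  ultimately show "{t\<in>S'. p t = c} \<in> \<B>" by simp
qed

lemma algebra_simple_slices:
  assumes A: "sigma_algebra S \<A>" and B: "sigma_algebra S' \<B>"
  shows "algebra (S \<times> S') {X. simple_slices S \<A> S' \<B> X}"
proof -
  interpret A: sigma_algebra S \<A> by fact
  interpret B: sigma_algebra S' \<B> by fact
  note sp = space_sets_sigma[OF B]
  show ?thesis
    unfolding algebra_iff_Un
  proof (intro conjI ballI)
    show "{} \<in> {X. simple_slices S \<A> S' \<B> X}"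
      by (simp add: simple_slices_def slice_def[abs_def])
    fix X assume "X \<in> {X. simple_slices S \<A> S' \<B> X}"
    then have X: "X \<subseteq> S \<times> S'" "\<And>t. t \<in> S' \<Longrightarrow> slice X t \<in> \<A>" "simple_function (sigma S' \<B>) (slice X)"
      by (auto simp: simple_slices_def)
    have sl: "slice (S \<times> S' - X) t = S - slice X t" if "t \<in> S'" for t
      using that by (auto simp: slice_def)
    have "simple_function (sigma S' \<B>) (\<lambda>t. S - slice X t)"
      by (rule simple_function_compose1[OF X(3)])
    then have "simple_function (sigma S' \<B>) (slice (S \<times> S' - X))"
      by (rule simple_function_cong[THEN iffD1, rotated]) (simp add: sp sl)
    then show "S \<times> S' - X \<in> {X. simple_slices S \<A> S' \<B> X}"
      using X(2) sl by (auto simp: simple_slices_def)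
    fix Y assume "Y \<in> {X. simple_slices S \<A> S' \<B> X}"
    then have Y: "Y \<subseteq> S \<times> S'" "\<And>t. t \<in> S' \<Longrightarrow> slice Y t \<in> \<A>" "simple_function (sigma S' \<B>) (slice Y)"
      by (auto simp: simple_slices_def)
    have sl': "slice (X \<union> Y) = (\<lambda>t. slice X t \<union> slice Y t)"
      by (auto simp: slice_def)
    show "X \<union> Y \<in> {X. simple_slices S \<A> S' \<B> X}"
      using X Y simple_function_compose2[OF X(3) Y(3), of "(\<union>)"] by (auto simp: simple_slices_def sl')
  qed (auto simp: simple_slices_def)
qed

text \<open>A rectangle has at most two different slices, one of them empty. Conversely a set with
  finitely many slices is the finite union of the rectangles formed by each slice and the set over
  which it occurs.\<close>

lemma product_algebra_eq:
  assumes A: "sigma_algebra S \<A>" and B: "sigma_algebra S' \<B>"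
  shows "product_algebra S \<A> S' \<B> = {X. simple_slices S \<A> S' \<B> X}"
proof (intro antisym)
  interpret A: sigma_algebra S \<A> by fact
  interpret B: sigma_algebra S' \<B> by fact
  note sp = space_sets_sigma[OF B]
  show "product_algebra S \<A> S' \<B> \<subseteq> {X. simple_slices S \<A> S' \<B> X}"
    unfolding product_algebra_def
  proof (rule hull_minimal)
    show "rectangles \<A> \<B> \<subseteq> {X. simple_slices S \<A> S' \<B> X}"
    proof
      fix X assume "X \<in> rectangles \<A> \<B>"
      then obtain A B where X: "X = A \<times> B" "A \<in> \<A>" "B \<in> \<B>"
        by (auto simp: rectangles_def)
      have sl: "slice X = (\<lambda>t. if t \<in> B then A else {})"
        by (auto simp: slice_def X fun_eq_iff)
      have "simple_function (sigma S' \<B>) (\<lambda>t. if t \<in> B then A else {})"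
        using X by (intro simple_function_If_set) (auto simp: sp)
      moreover have "X \<subseteq> S \<times> S'"
        using X A.sets_into_space B.sets_into_space by auto
      ultimately show "X \<in> {X. simple_slices S \<A> S' \<B> X}"
        using X(2) by (simp add: simple_slices_def sl)
    qed
  qed (rule algebra_simple_slices[OF A B])
  show "{X. simple_slices S \<A> S' \<B> X} \<subseteq> product_algebra S \<A> S' \<B>"
    unfolding product_algebra_def hull_def
  proof (intro subsetI InterI)
    fix X M assume X: "X \<in> {X. simple_slices S \<A> S' \<B> X}"
      and M: "M \<in> {t. algebra (S \<times> S') t \<and> rectangles \<A> \<B> \<subseteq> t}"
    interpret M: algebra "S \<times> S'" M using M by simp
    have sf: "simple_function (sigma S' \<B>) (slice X)" and XS: "X \<subseteq> S \<times> S'"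
      and XA: "\<And>t. t \<in> S' \<Longrightarrow> slice X t \<in> \<A>"
      using X by (auto simp: simple_slices_def)
    have "(\<Union>C\<in>slice X ` S'. C \<times> {t\<in>S'. slice X t = C}) \<in> M"
    proof (rule M.finite_UN)
      fix C assume "C \<in> slice X ` S'"
      then have "C \<times> {t\<in>S'. slice X t = C} \<in> rectangles \<A> \<B>"
        using XA simple_function_level_set(2)[OF B sf, of C] by (auto simp: rectangles_def)
      with M show "C \<times> {t\<in>S'. slice X t = C} \<in> M" by auto
    qed (rule simple_function_level_set(1)[OF B sf])
    also have "(\<Union>C\<in>slice X ` S'. C \<times> {t\<in>S'. slice X t = C}) = X"
      using XS by (auto simp: slice_def)
    finally show "X \<in> M" .
  qed
qed

lemma algebra_product_algebra:
  assumes "sigma_algebra S \<A>" and "sigma_algebra S' \<B>"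
  shows "algebra (S \<times> S') (product_algebra S \<A> S' \<B>)"
  using algebra_simple_slices[OF assms] by (simp add: product_algebra_eq[OF assms])

lemma rectangle_in_product_algebra:
  "A \<in> \<A> \<Longrightarrow> B \<in> \<B> \<Longrightarrow> A \<times> B \<in> product_algebra S \<A> S' \<B>"
  unfolding product_algebra_def by (intro hull_inc) (auto simp: rectangles_def)

lemma product_algebra_subset_sigma:
  assumes "sigma_algebra S \<A>" and "sigma_algebra S' \<B>"
  shows "product_algebra S \<A> S' \<B> \<subseteq> product_sigma_algebra S \<A> S' \<B>"
proof -
  interpret A: sigma_algebra S \<A> by fact
  interpret B: sigma_algebra S' \<B> by fact
  have "rectangles \<A> \<B> \<subseteq> Pow (S \<times> S')"
    using A.sets_into_space B.sets_into_space by (auto simp: rectangles_def)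
  then have "sigma_algebra (S \<times> S') (sigma_sets (S \<times> S') (rectangles \<A> \<B>))"
    by (rule sigma_algebra_sigma_sets)
  then show ?thesis
    unfolding product_algebra_def product_sigma_algebra_def
    by (intro hull_minimal) (auto intro: sigma_sets.Basic simp: sigma_algebra_def)
qed

text \<open>Splitting the level sets of \<open>f\<close> into those of a finer simple function
  \<open>p\<close> does not change the sum. This permits several sets to be compared over a common
  partition, as in the theory of the elementary integral.\<close>

lemma simple_slices_sum_compose:
  fixes \<phi> :: "'c \<Rightarrow> 't set \<Rightarrow> complex"
  assumes B: "sigma_algebra S' \<B>" and p: "simple_function (sigma S' \<B>) p"
    and f: "\<And>t. t \<in> S' \<Longrightarrow> f t = h (p t)" and \<phi>: "\<And>t. t \<in> S' \<Longrightarrow> semi_measure S' \<B> (\<phi> (f t))"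
  shows "(\<Sum>a\<in>f ` S'. \<phi> a {t\<in>S'. f t = a}) = (\<Sum>c\<in>p ` S'. \<phi> (h c) {t\<in>S'. p t = c})"
proof -
  have img: "f ` S' = h ` p ` S'" using f by (auto simp: image_image)
  have fin: "finite (p ` S')" by (rule simple_function_level_set(1)[OF B p])
  have "\<phi> a {t\<in>S'. f t = a} = (\<Sum>c\<in>{c \<in> p ` S'. h c = a}. \<phi> (h c) {t\<in>S'. p t = c})"
    if a: "a \<in> f ` S'" for a
  proof -
    have "{t\<in>S'. f t = a} = (\<Union>c\<in>{c \<in> p ` S'. h c = a}. {t\<in>S'. p t = c})"
      using f by auto
    then have "\<phi> a {t\<in>S'. f t = a} = \<phi> a (\<Union>c\<in>{c \<in> p ` S'. h c = a}. {t\<in>S'. p t = c})"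
      by simp
    also have "\<dots> = (\<Sum>c\<in>{c \<in> p ` S'. h c = a}. \<phi> a {t\<in>S'. p t = c})"
    proof (rule semi_measure_UN)
      show "semi_measure S' \<B> (\<phi> a)" using a \<phi> by auto
      show "(\<lambda>c. {t \<in> S'. p t = c}) ` {c \<in> p ` S'. h c = a} \<subseteq> \<B>"
        using simple_function_level_set(2)[OF B p] by auto
    qed (use fin in \<open>auto simp: disjoint_family_on_def\<close>)
    finally show ?thesis by simp
  qed
  then have "(\<Sum>a\<in>f ` S'. \<phi> a {t\<in>S'. f t = a}) =
      (\<Sum>a\<in>f ` S'. \<Sum>c\<in>{c \<in> p ` S'. h c = a}. \<phi> (h c) {t\<in>S'. p t = c})"
    by (rule sum.cong[OF refl])
  also have "\<dots> = (\<Sum>c\<in>p ` S'. \<phi> (h c) {t\<in>S'. p t = c})"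
    by (rule sum.group) (use fin img in auto)
  finally show ?thesis .
qed

text \<open>The decomposition into slices is disjoint, so values on rectangles determine the
  semi-measure. The second sides are pairwise disjoint although the first sides may overlap; the
  variation estimate relies on this.\<close>

lemma semi_measure_slice_formula:
  fixes \<mu> :: "('s \<times> 't) set \<Rightarrow> complex"
  assumes A: "sigma_algebra S \<A>" and B: "sigma_algebra S' \<B>"
    and \<mu>: "semi_measure (S \<times> S') (product_algebra S \<A> S' \<B>) \<mu>" and X: "X \<in> product_algebra S \<A> S' \<B>"
  shows "\<mu> X = (\<Sum>C\<in>slice X ` S'. \<mu> (C \<times> {t\<in>S'. slice X t = C}))"
proof -
  have sl: "simple_slices S \<A> S' \<B> X" using X by (simp add: product_algebra_eq[OF A B])
  then have sf: "simple_function (sigma S' \<B>) (slice X)" and XS: "X \<subseteq> S \<times> S'"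
    and XA: "\<And>t. t \<in> S' \<Longrightarrow> slice X t \<in> \<A>"
    by (auto simp: simple_slices_def)
  have "X = (\<Union>C\<in>slice X ` S'. C \<times> {t\<in>S'. slice X t = C})"
    using XS by (auto simp: slice_def)
  then have "\<mu> X = \<mu> (\<Union>C\<in>slice X ` S'. C \<times> {t\<in>S'. slice X t = C})" by simp
  also have "\<dots> = (\<Sum>C\<in>slice X ` S'. \<mu> (C \<times> {t\<in>S'. slice X t = C}))"
    using simple_function_level_set[OF B sf] XA
    by (intro semi_measure_UN[OF \<mu>])
      (auto simp: disjoint_family_on_def intro!: rectangle_in_product_algebra)
  finally show ?thesis .
qed

text \<open>The slice formula, forced on any solution, is taken as the definition. Separate
  additivity in each variable then suffices.\<close>

lemma bimeasure_product_exists: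
  fixes \<beta> :: "'s set \<Rightarrow> 't set \<Rightarrow> complex"
  assumes A: "sigma_algebra S \<A>" and B: "sigma_algebra S' \<B>"
    and \<beta>1: "\<And>A. A \<in> \<A> \<Longrightarrow> semi_measure S' \<B> (\<beta> A)"
    and \<beta>2: "\<And>B. B \<in> \<B> \<Longrightarrow> semi_measure S \<A> (\<lambda>A. \<beta> A B)"
  obtains \<mu> where "semi_measure (S \<times> S') (product_algebra S \<A> S' \<B>) \<mu>"
    "\<And>A B. A \<in> \<A> \<Longrightarrow> B \<in> \<B> \<Longrightarrow> \<mu> (A \<times> B) = \<beta> A B"
    "\<And>X. X \<notin> product_algebra S \<A> S' \<B> \<Longrightarrow> \<mu> X = 0"
proof -
  interpret A: sigma_algebra S \<A> by fact
  interpret B: sigma_algebra S' \<B> by fact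
  note sp = space_sets_sigma[OF B]
  let ?PA = "product_algebra S \<A> S' \<B>"
  \<comment> \<open>\<open>I X\<close> is the elementary integral over \<open>S'\<close> of
    \<open>\<beta>\<close> applied to the slice of \<open>X\<close> and the variable of
    integration.\<close>
  define I where "I X = (\<Sum>C\<in>slice X ` S'. \<beta> C {t\<in>S'. slice X t = C})" for X
  have slices: "simple_function (sigma S' \<B>) (slice X)" "\<And>t. t \<in> S' \<Longrightarrow> slice X t \<in> \<A>"
    if "X \<in> ?PA" for X
    using that by (auto simp: product_algebra_eq[OF A B] simple_slices_def)
  have rect: "I (A \<times> B) = \<beta> A B" if "A \<in> \<A>" "B \<in> \<B>" for A B
  proof -
    let ?h = "\<lambda>c. if c then A else {}"
    have BS: "{t \<in> S'. t \<in> B} = B" "{t \<in> S'. t \<notin> B} = S' - B"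
      using B.sets_into_space[OF that(2)] by auto
    have p: "simple_function (sigma S' \<B>) (\<lambda>t. t \<in> B)"
      using simple_function_If_set[of "sigma S' \<B>" "\<lambda>_. True" "\<lambda>_. False" B] that(2)
      by (simp add: sp if_bool_eq_disj)
    have "I (A \<times> B) = (\<Sum>c\<in>(\<lambda>t. t \<in> B) ` S'. \<beta> (?h c) {t\<in>S'. (t \<in> B) = c})"
      unfolding I_def
    proof (rule simple_slices_sum_compose[OF B p])
      show sl: "slice (A \<times> B) t = ?h (t \<in> B)" for t
        by (auto simp: slice_def)
      show "semi_measure S' \<B> (\<beta> (slice (A \<times> B) t))" for t
        unfolding sl using that by (intro \<beta>1) simp
    qed
    \<comment> \<open>A truth value that does not occur has an empty level set. Summing over both
      values avoids cases where \<open>B\<close> or its complement is empty.\<close>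
    also have "\<dots> = (\<Sum>c\<in>UNIV. \<beta> (?h c) {t\<in>S'. (t \<in> B) = c})"
    proof (rule sum.mono_neutral_left)
      show "\<forall>c\<in>UNIV - (\<lambda>t. t \<in> B) ` S'. \<beta> (?h c) {t \<in> S'. (t \<in> B) = c} = 0"
      proof
        fix c assume "c \<in> UNIV - (\<lambda>t. t \<in> B) ` S'"
        then have "{t \<in> S'. (t \<in> B) = c} = {}" by auto
        moreover have "?h c \<in> \<A>" using that by simp
        ultimately show "\<beta> (?h c) {t \<in> S'. (t \<in> B) = c} = 0"
          using semi_measure_empty[OF \<beta>1[of "?h c"]] by (simp only:)
      qed
    qed auto
    also have "\<dots> = \<beta> A B + \<beta> {} (S' - B)"
      by (simp add: UNIV_bool BS)
    also have "\<beta> {} (S' - B) = 0"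
      using semi_measure_empty[OF \<beta>2, of "S' - B"] that(2) by auto
    finally show ?thesis by simp
  qed
  have add: "I (X \<union> Y) = I X + I Y" if X: "X \<in> ?PA" and Y: "Y \<in> ?PA" and "X \<inter> Y = {}" for X Y
  proof -
    \<comment> \<open>The level sets of the pair form the common refinement of the partitions
      belonging to \<open>X\<close>, \<open>Y\<close> and their union.\<close>
    define p where "p t = (slice X t, slice Y t)" for t
    have p: "simple_function (sigma S' \<B>) p"
      unfolding p_def using slices(1)[OF X] slices(1)[OF Y] by (rule simple_function_Pair)
    have *: "(\<Sum>C\<in>f ` S'. \<beta> C {t\<in>S'. f t = C}) = (\<Sum>c\<in>p ` S'. \<beta> (h c) {t\<in>S'. p t = c})"
      if "\<And>t. t \<in> S' \<Longrightarrow> f t = h (p t)" "\<And>t. t \<in> S' \<Longrightarrow> f t \<in> \<A>" for f h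
      using that by (intro simple_slices_sum_compose[OF B p]) (auto intro: \<beta>1)
    have sl: "slice (X \<union> Y) t = slice X t \<union> slice Y t" for t
      by (auto simp: slice_def)
    have "I (X \<union> Y) = (\<Sum>c\<in>p ` S'. \<beta> (fst c \<union> snd c) {t\<in>S'. p t = c})"
      unfolding I_def by (rule *) (use slices(2) X Y in \<open>auto simp: p_def sl\<close>)
    also have "\<dots> = (\<Sum>c\<in>p ` S'. \<beta> (fst c) {t\<in>S'. p t = c} + \<beta> (snd c) {t\<in>S'. p t = c})"
    proof (rule sum.cong[OF refl])
      fix c assume "c \<in> p ` S'"
      then obtain t where t: "t \<in> S'" "c = p t" by auto
      have "slice X t \<inter> slice Y t = {}"
        using \<open>X \<inter> Y = {}\<close> by (auto simp: slice_def)
      then show "\<beta> (fst c \<union> snd c) {t\<in>S'. p t = c} = \<beta> (fst c) {t\<in>S'. p t = c} + \<beta> (snd c) {t\<in>S'. p t = c}"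
        using slices(2)[OF X t(1)] slices(2)[OF Y t(1)] t(2)
        by (intro semi_measure_Un[OF \<beta>2] simple_function_level_set(2)[OF B p]) (auto simp: p_def)
    qed
    also have "\<dots> = (\<Sum>c\<in>p ` S'. \<beta> (fst c) {t\<in>S'. p t = c}) + (\<Sum>c\<in>p ` S'. \<beta> (snd c) {t\<in>S'. p t = c})"
      by (rule sum.distrib)
    also have "(\<Sum>c\<in>p ` S'. \<beta> (fst c) {t\<in>S'. p t = c}) = I X"
      unfolding I_def by (rule *[symmetric]) (use slices(2) X in \<open>auto simp: p_def\<close>)
    also have "(\<Sum>c\<in>p ` S'. \<beta> (snd c) {t\<in>S'. p t = c}) = I Y"
      unfolding I_def by (rule *[symmetric]) (use slices(2) Y in \<open>auto simp: p_def\<close>)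
    finally show ?thesis .
  qed
  interpret PA: algebra "S \<times> S'" ?PA by (rule algebra_product_algebra[OF A B])
  define \<mu> where "\<mu> X = (if X \<in> ?PA then I X else 0)" for X
  have "additive ?PA \<mu>"
    unfolding additive_def \<mu>_def using add by auto
  then have "semi_measure (S \<times> S') ?PA \<mu>"
    using algebra_product_algebra[OF A B] by (simp add: semi_measure_def)
  then show thesis
    by (rule that) (auto simp: \<mu>_def rect rectangle_in_product_algebra)
qed

context
  fixes S :: "'s set" and \<A> and S' :: "'t set" and \<B>
    and \<xi> :: "'s set \<Rightarrow> 'k :: complex_hilbert_space" and \<eta> :: "'t set \<Rightarrow> 'h :: complex_hilbert_space"
    and T :: "'h \<Rightarrow> 'k"
  assumes A: "sigma_algebra S \<A>" and B: "sigma_algebra S' \<B>"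
    and \<xi>: "semi_measure S \<A> \<xi>" and \<eta>: "semi_measure S' \<B> \<eta>" and T: "bounded_clinear T"
begin

lemma product_semi_measure_unique:
  assumes \<mu>: "semi_measure (S \<times> S') (product_algebra S \<A> S' \<B>) \<mu>"
    "\<And>A B. A \<in> \<A> \<Longrightarrow> B \<in> \<B> \<Longrightarrow> \<mu> (A \<times> B) = cinner (\<xi> A) (T (\<eta> B))"
    and X: "X \<in> product_algebra S \<A> S' \<B>"
  shows "\<mu> X = (\<Sum>C\<in>slice X ` S'. cinner (\<xi> C) (T (\<eta> {t\<in>S'. slice X t = C})))"
  unfolding semi_measure_slice_formula[OF A B \<mu>(1) X]
proof (rule sum.cong[OF refl])
  fix C assume "C \<in> slice X ` S'"
  moreover have "simple_slices S \<A> S' \<B> X" using X by (simp add: product_algebra_eq[OF A B])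
  ultimately show "\<mu> (C \<times> {t\<in>S'. slice X t = C}) = cinner (\<xi> C) (T (\<eta> {t\<in>S'. slice X t = C}))"
    by (intro \<mu>(2) simple_function_level_set(2)[OF B]) (auto simp: simple_slices_def)
qed

text \<open>Existence by \<open>bimeasure_product_exists\<close> and uniqueness by the slice formula
  make the definite description denote; the value 0 off the product algebra settles the remaining
  arguments. Later proofs use only these two facts.\<close>

lemma product_semi_measure_spec:
  shows "semi_measure (S \<times> S') (product_algebra S \<A> S' \<B>) (product_semi_measure S \<A> S' \<B> \<xi> T \<eta>)" (is ?A)
    and "A \<in> \<A> \<Longrightarrow> B \<in> \<B> \<Longrightarrow>
      product_semi_measure S \<A> S' \<B> \<xi> T \<eta> (A \<times> B) = cinner (\<xi> A) (T (\<eta> B))" (is "PROP ?B")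
proof -
  let ?P = "\<lambda>\<mu>. semi_measure (S \<times> S') (product_algebra S \<A> S' \<B>) \<mu> \<and>
       (\<forall>A\<in>\<A>. \<forall>B\<in>\<B>. \<mu> (A \<times> B) = cinner (\<xi> A) (T (\<eta> B))) \<and>
       (\<forall>X. X \<notin> product_algebra S \<A> S' \<B> \<longrightarrow> \<mu> X = 0)"
  have lin: "bounded_linear T" using T by (simp add: bounded_clinear_def)
  have comp: "semi_measure \<Omega> M (\<lambda>A. f (\<phi> A))" if "linear f" "semi_measure \<Omega> M \<phi>"
    for f :: "'v :: banach \<Rightarrow> complex" and \<Omega> :: "'z set" and M \<phi>
    using that by (simp add: semi_measure_def additive_def linear_add)
  obtain \<mu> where \<mu>: "?P \<mu>"
  proof (rule bimeasure_product_exists[OF A B, of "\<lambda>A B. cinner (\<xi> A) (T (\<eta> B))"])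
    show "semi_measure S' \<B> (\<lambda>B. cinner (\<xi> A) (T (\<eta> B)))" for A
      by (intro comp[OF _ \<eta>] bounded_linear.linear
          bounded_linear_compose[OF bounded_linear_cinner_right lin])
    show "semi_measure S \<A> (\<lambda>A. cinner (\<xi> A) (T (\<eta> B)))" for B
      by (intro comp[OF _ \<xi>] bounded_linear.linear bounded_linear_cinner_left)
  qed (use that in blast)
  have "\<nu> = \<mu>" if "?P \<nu>" for \<nu>
  proof
    fix X show "\<nu> X = \<mu> X"
      using \<mu> that product_semi_measure_unique[of \<nu> X] product_semi_measure_unique[of \<mu> X]
      by (cases "X \<in> product_algebra S \<A> S' \<B>") auto
  qed
  then have "?P (product_semi_measure S \<A> S' \<B> \<xi> T \<eta>)"
    unfolding product_semi_measure_def by (rule theI[of ?P, OF \<mu>])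
  then show ?A and "PROP ?B" by auto
qed

lemma product_semi_measure_eqI:
  assumes "semi_measure (S \<times> S') (product_algebra S \<A> S' \<B>) \<mu>"
    "\<And>A B. A \<in> \<A> \<Longrightarrow> B \<in> \<B> \<Longrightarrow> \<mu> (A \<times> B) = cinner (\<xi> A) (T (\<eta> B))"
    and "X \<in> product_algebra S \<A> S' \<B>"
  shows "\<mu> X = product_semi_measure S \<A> S' \<B> \<xi> T \<eta> X"
  using product_semi_measure_unique[OF assms] product_semi_measure_unique[OF product_semi_measure_spec assms(3)]
  by simp

end

section \<open>Complex measures\<close>

lemma vector_measure_measure:
  assumes "finite_measure N"
  shows "vector_measure (space N) (sets N) (measure N)"
  by (intro vector_measureI sets.sigma_algebra_axioms finite_measure.finite_measure_UNION[OF assms]) auto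

lemma nonneg_vector_measure_represented:
  fixes \<phi> :: "'s set \<Rightarrow> real"
  assumes \<phi>: "vector_measure \<Omega> M \<phi>" and nonneg: "\<And>A. A \<in> M \<Longrightarrow> 0 \<le> \<phi> A"
  obtains N where "finite_measure N" "space N = \<Omega>" "sets N = M" "\<And>A. A \<in> M \<Longrightarrow> measure N A = \<phi> A"
proof -
  interpret sigma_algebra \<Omega> M using \<phi> by (rule vector_measure_sigma_algebra)
  define N where "N = measure_of \<Omega> M (\<lambda>A. ennreal (\<phi> A))"
  have sp: "space N = \<Omega>" "sets N = M"
    using space_closed by (simp_all add: N_def space_measure_of sets_measure_of_eq)
  have em: "emeasure N A = ennreal (\<phi> A)" if "A \<in> M" for A
    unfolding N_def
  proof (rule emeasure_measure_of_sigma[OF sigma_algebra_axioms _ _ that])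
    show "positive M (\<lambda>A. ennreal (\<phi> A))"
      using semi_measure_empty[OF vector_measure_semi_measure[OF \<phi>]] by (simp add: positive_def)
    show "countably_additive M (\<lambda>A. ennreal (\<phi> A))"
      unfolding countably_additive_def
      using nonneg by (auto intro!: suminf_ennreal_eq vector_measure_sums[OF \<phi>])
  qed
  have "finite_measure N"
    by (rule finite_measureI) (simp add: sp em)
  from this sp show thesis
    by (rule that) (simp add: measure_def em nonneg)
qed

text \<open>\<open>p\<close> is the upper variation, finite because \<open>\<phi>\<close> is
  bounded. Nearly optimal subsets of the disjoint pieces combine to give one inequality for
  \<open>p\<close>; cutting an arbitrary subset of the union along the pieces gives the
  other.\<close>

lemma Jordan_decomposition:
  fixes \<phi> :: "'s set \<Rightarrow> real"
  assumes \<phi>: "vector_measure \<Omega> M \<phi>"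
  obtains p q where "vector_measure \<Omega> M p" "vector_measure \<Omega> M q"
    "\<And>A. A \<in> M \<Longrightarrow> 0 \<le> p A" "\<And>A. A \<in> M \<Longrightarrow> 0 \<le> q A" "\<And>A. A \<in> M \<Longrightarrow> \<phi> A = p A - q A"
proof -
  interpret sigma_algebra \<Omega> M using \<phi> by (rule vector_measure_sigma_algebra)
  have sm: "semi_measure \<Omega> M \<phi>" using \<phi> by (rule vector_measure_semi_measure)
  obtain K where K: "\<And>A. A \<in> M \<Longrightarrow> norm (\<phi> A) \<le> K"
    using vector_measure_bounded[OF \<phi>] by blast
  define p where "p A = (SUP B\<in>{B \<in> M. B \<subseteq> A}. \<phi> B)" for A
  have bdd: "bdd_above (\<phi> ` {B \<in> M. B \<subseteq> A})" for A
    using K by (intro bdd_aboveI[of _ K]) (auto simp: abs_le_iff)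
  have upper: "\<phi> B \<le> p A" if "B \<in> M" "B \<subseteq> A" for A B
    unfolding p_def using that by (intro cSUP_upper bdd) auto
  have least: "p A \<le> c" if "\<And>B. B \<in> M \<Longrightarrow> B \<subseteq> A \<Longrightarrow> \<phi> B \<le> c" for A c
    unfolding p_def by (rule cSUP_least) (use that in auto)
  have approx: "\<exists>B\<in>M. B \<subseteq> A \<and> p A - e < \<phi> B" if "e > 0" for A e
  proof -
    have "p A - e < (SUP B\<in>{B \<in> M. B \<subseteq> A}. \<phi> B)" using that by (simp add: p_def)
    then show ?thesis
      by (subst (asm) less_cSUP_iff[OF _ bdd]) auto
  qed
  have nonneg: "0 \<le> p A" for A
    using upper[of "{}" A] semi_measure_empty[OF sm] by simp
  have pv: "vector_measure \<Omega> M p"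
  proof (rule vector_measureI[OF sigma_algebra_axioms])
    have "p {} \<le> 0" by (rule least) (simp add: semi_measure_empty[OF sm])
    with nonneg[of "{}"] show "p {} = 0" by simp
    fix A :: "nat \<Rightarrow> 's set" assume A: "range A \<subseteq> M" "disjoint_family A"
    have AM: "A i \<in> M" for i using A by auto
    have partial: "(\<Sum>i<n. p (A i)) \<le> p (\<Union>i. A i)" for n
    proof (rule field_le_epsilon)
      fix e :: real assume "e > 0"
      \<comment> \<open>The \<open>n\<close> errors add up to at most \<open>e\<close>, and the
        \<open>+ 1\<close> covers \<open>n = 0\<close>.\<close>
      then have e': "e / (real n + 1) > 0" by simp
      have "\<forall>i. \<exists>B. B \<in> M \<and> B \<subseteq> A i \<and> p (A i) - e / (real n + 1) < \<phi> B"
        using approx[OF e'] by blast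
      then obtain B where B: "\<And>i. B i \<in> M" "\<And>i. B i \<subseteq> A i"
        "\<And>i. p (A i) - e / (real n + 1) < \<phi> (B i)"
        by metis
      have "(\<Sum>i<n. p (A i) - e / (real n + 1)) \<le> (\<Sum>i<n. \<phi> (B i))"
        using B(3) by (intro sum_mono) (simp add: less_imp_le)
      also have "\<dots> = \<phi> (\<Union>i<n. B i)"
      proof (rule semi_measure_UN[OF sm, symmetric])
        show "disjoint_family_on B {..<n}"
          using A(2) B(2) unfolding disjoint_family_on_def by blast
      qed (use B in auto)
      also have "\<dots> \<le> p (\<Union>i. A i)"
        using B by (intro upper) auto
      finally have "(\<Sum>i<n. p (A i)) \<le> p (\<Union>i. A i) + real n * (e / (real n + 1))"
        by (simp add: sum_subtractf)
      also have "real n * (e / (real n + 1)) \<le> e"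
        using \<open>e > 0\<close> by (simp add: field_simps)
      finally show "(\<Sum>i<n. p (A i)) \<le> p (\<Union>i. A i) + e" by simp
    qed
    have summ: "summable (\<lambda>i. p (A i))"
      by (rule summableI_nonneg_bounded[OF nonneg partial])
    have "p (\<Union>i. A i) \<le> (\<Sum>i. p (A i))"
    proof (rule least)
      fix B assume B: "B \<in> M" "B \<subseteq> (\<Union>i. A i)"
      have "(\<lambda>i. \<phi> (B \<inter> A i)) sums \<phi> (\<Union>i. B \<inter> A i)"
        using A B by (intro vector_measure_sums[OF \<phi>]) (auto simp: disjoint_family_on_def)
      moreover have "(\<Union>i. B \<inter> A i) = B" using B by auto
      ultimately have s: "(\<lambda>i. \<phi> (B \<inter> A i)) sums \<phi> B" by simp
      have "\<phi> B = (\<Sum>i. \<phi> (B \<inter> A i))" using s by (rule sums_unique)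
      also have "\<dots> \<le> (\<Sum>i. p (A i))"
        using B AM by (intro suminf_le summ sums_summable[OF s] upper) auto
      finally show "\<phi> B \<le> (\<Sum>i. p (A i))" .
    qed
    moreover have "(\<Sum>i. p (A i)) \<le> p (\<Union>i. A i)"
      by (rule suminf_le_const[OF summ partial])
    ultimately have "(\<Sum>i. p (A i)) = p (\<Union>i. A i)" by simp
    then show "(\<lambda>i. p (A i)) sums p (\<Union>i. A i)"
      using summable_sums[OF summ] by simp
  qed
  have "vector_measure \<Omega> M (\<lambda>A. p A - \<phi> A)"
  proof (rule vector_measureI[OF sigma_algebra_axioms])
    show "p {} - \<phi> {} = 0"
      using semi_measure_empty[OF sm] semi_measure_empty[OF vector_measure_semi_measure[OF pv]] by simp
  qed (intro sums_diff vector_measure_sums[OF pv] vector_measure_sums[OF \<phi>])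
  with pv show thesis
    by (rule that) (use nonneg upper in auto)
qed

text \<open>Indexing the positive and negative parts of real and imaginary part by the powers of the
  imaginary unit makes the decomposition one sum, convenient for the bilinear expansion of
  products.\<close>

lemma complex_measure_decomposition:
  fixes \<mu> :: "'s set \<Rightarrow> complex"
  assumes \<mu>: "vector_measure \<Omega> M \<mu>"
  obtains P :: "nat \<Rightarrow> 's measure" where
    "\<And>k. finite_measure (P k)" "\<And>k. space (P k) = \<Omega>" "\<And>k. sets (P k) = M"
    "\<And>A. A \<in> M \<Longrightarrow> \<mu> A = (\<Sum>k<4. \<i> ^ k * complex_of_real (measure (P k) A))"
proof -
  have part: "\<exists>P Q. (finite_measure P \<and> space P = \<Omega> \<and> sets P = M) \<and>
      (finite_measure Q \<and> space Q = \<Omega> \<and> sets Q = M) \<and> (\<forall>A\<in>M. \<phi> A = measure P A - measure Q A)"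
    if \<phi>: "vector_measure \<Omega> M \<phi>" for \<phi> :: "'s set \<Rightarrow> real"
  proof -
    obtain p q where pq: "vector_measure \<Omega> M p" "vector_measure \<Omega> M q"
      "\<And>A. A \<in> M \<Longrightarrow> 0 \<le> p A" "\<And>A. A \<in> M \<Longrightarrow> 0 \<le> q A" "\<And>A. A \<in> M \<Longrightarrow> \<phi> A = p A - q A"
      using Jordan_decomposition[OF \<phi>] by blast
    obtain P where P: "finite_measure P" "space P = \<Omega>" "sets P = M" "\<And>A. A \<in> M \<Longrightarrow> measure P A = p A"
      using nonneg_vector_measure_represented[OF pq(1,3)] by blast
    obtain Q where Q: "finite_measure Q" "space Q = \<Omega>" "sets Q = M" "\<And>A. A \<in> M \<Longrightarrow> measure Q A = q A"
      using nonneg_vector_measure_represented[OF pq(2,4)] by blast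
    have "\<forall>A\<in>M. \<phi> A = measure P A - measure Q A"
      using pq(5) P(4) Q(4) by simp
    with P(1-3) Q(1-3) show ?thesis by blast
  qed
  obtain P0 P2 where P02: "finite_measure P0" "space P0 = \<Omega>" "sets P0 = M"
    "finite_measure P2" "space P2 = \<Omega>" "sets P2 = M" "\<forall>A\<in>M. Re (\<mu> A) = measure P0 A - measure P2 A"
    using part[OF vector_measure_bounded_linear[OF bounded_linear_Re \<mu>]] by blast
  obtain P1 P3 where P13: "finite_measure P1" "space P1 = \<Omega>" "sets P1 = M"
    "finite_measure P3" "space P3 = \<Omega>" "sets P3 = M" "\<forall>A\<in>M. Im (\<mu> A) = measure P1 A - measure P3 A"
    using part[OF vector_measure_bounded_linear[OF bounded_linear_Im \<mu>]] by blast
  define P where "P k = (if k = 0 then P0 else if k = 1 then P1 else if k = 2 then P2 else P3)" for k :: nat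
  show thesis
  proof (rule that[of P])
    show "\<mu> A = (\<Sum>k<4. \<i> ^ k * complex_of_real (measure (P k) A))" if "A \<in> M" for A
      using P02(7) P13(7) that
      by (simp add: P_def eval_nat_numeral complex_eq_iff)
  qed (use P02 P13 in \<open>auto simp: P_def\<close>)
qed

text \<open>Expanding both factors leaves sixteen products of finite positive measures, for which
  the product measure of the library is available.\<close>

lemma complex_measure_product:
  fixes \<mu> :: "'s set \<Rightarrow> complex" and \<nu> :: "'t set \<Rightarrow> complex"
  assumes \<mu>: "vector_measure S \<A> \<mu>" and \<nu>: "vector_measure S' \<B> \<nu>"
  obtains \<psi> where "vector_measure (S \<times> S') (product_sigma_algebra S \<A> S' \<B>) \<psi>"
    "\<And>A B. A \<in> \<A> \<Longrightarrow> B \<in> \<B> \<Longrightarrow> \<psi> (A \<times> B) = \<mu> A * \<nu> B"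
proof -
  obtain P where P: "\<And>k. finite_measure (P k)" "\<And>k. space (P k) = S" "\<And>k. sets (P k) = \<A>"
    "\<And>A. A \<in> \<A> \<Longrightarrow> \<mu> A = (\<Sum>k<4. \<i> ^ k * complex_of_real (measure (P k) A))"
    by (rule complex_measure_decomposition[OF \<mu>]) blast
  obtain Q where Q: "\<And>k. finite_measure (Q k)" "\<And>k. space (Q k) = S'" "\<And>k. sets (Q k) = \<B>"
    "\<And>B. B \<in> \<B> \<Longrightarrow> \<nu> B = (\<Sum>k<4. \<i> ^ k * complex_of_real (measure (Q k) B))"
    by (rule complex_measure_decomposition[OF \<nu>]) blast
  let ?\<Sigma> = "product_sigma_algebra S \<A> S' \<B>"
  have sp: "space (P k \<Otimes>\<^sub>M Q l) = S \<times> S'" "sets (P k \<Otimes>\<^sub>M Q l) = ?\<Sigma>" for k l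
    by (simp_all add: space_pair_measure sets_pair_measure P Q product_sigma_algebra_def rectangles_def)
  have fin: "finite_measure (P k \<Otimes>\<^sub>M Q l)" for k l
    by (intro finite_measure_pair_measure P Q)
  have vm: "vector_measure (S \<times> S') ?\<Sigma> (measure (P k \<Otimes>\<^sub>M Q l))" for k l
    using vector_measure_measure[OF fin, of k l] by (simp add: sp)
  define \<psi> where "\<psi> X = (\<Sum>k<4. \<Sum>l<4. \<i> ^ k * \<i> ^ l * complex_of_real (measure (P k \<Otimes>\<^sub>M Q l) X))" for X
  have "vector_measure (S \<times> S') ?\<Sigma> \<psi>"
    unfolding \<psi>_def
    by (intro vector_measure_sum vector_measure_sigma_algebra[OF vm[of 0 0]]
        vector_measure_bounded_linear[OF _ vm]
        bounded_linear_compose[OF bounded_linear_mult_right bounded_linear_of_real])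
  moreover have "\<psi> (A \<times> B) = \<mu> A * \<nu> B" if "A \<in> \<A>" "B \<in> \<B>" for A B
  proof -
    have "measure (P k \<Otimes>\<^sub>M Q l) (A \<times> B) = measure (P k) A * measure (Q l) B" for k l
    proof -
      interpret Q: finite_measure "Q l" by (rule Q(1))
      show ?thesis
        using Q.emeasure_pair_measure_Times[of A "P k" B] that P(3) Q(3)
        by (simp add: measure_def enn2real_mult)
    qed
    then show ?thesis
      using that by (simp add: \<psi>_def P(4) Q(4) sum_product mult_ac)
  qed
  ultimately show thesis by (rule that)
qed

section \<open>Passing from an algebra to the generated \<sigma>-algebra\<close>

text \<open>Complementation preserves the symmetric difference. A disjoint union is cut after
  \<open>n\<close> pieces with tail below \<open>e / 2\<close>, and these pieces are approximated
  with total error at most \<open>e / 2\<close>.\<close>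

lemma sigma_sets_approximation:
  assumes N: "finite_measure N" and M: "algebra (space N) M" and sets: "sets N = sigma_sets (space N) M"
    and "X \<in> sets N" and "e > 0"
  shows "\<exists>Y\<in>M. measure N ((X - Y) \<union> (Y - X)) < e"
proof -
  interpret finite_measure N by fact
  interpret M: algebra "space N" M by fact
  have MN: "Y \<in> sets N" if "Y \<in> M" for Y using that sets by auto
  have "Int_stable M" by (auto simp: Int_stable_def)
  moreover note M.space_closed
  moreover have "X \<in> sigma_sets (space N) M" using assms(4) sets by simp
  ultimately show ?thesis
    using \<open>e > 0\<close>
  proof (induction X arbitrary: e rule: sigma_sets_induct_disjoint)
    case (basic X)
    then show ?case by (intro bexI[of _ X]) auto
  next
    case empty
    then show ?case by (intro bexI[of _ "{}"]) auto
  next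
    case (compl X)
    then obtain Y where Y: "Y \<in> M" "measure N ((X - Y) \<union> (Y - X)) < e" by blast
    have "X \<subseteq> space N" using compl(1) sets sets.sets_into_space by blast
    then have "((space N - X) - (space N - Y)) \<union> ((space N - Y) - (space N - X)) = (X - Y) \<union> (Y - X)"
      using M.sets_into_space[OF Y(1)] by auto
    with Y show ?case by (intro bexI[of _ "space N - Y"]) auto
  next
    case (union A)
    have AN: "A i \<in> sets N" for i using union(2) sets by auto
    let ?X = "\<Union>i. A i"
    have XN: "?X \<in> sets N" using AN by auto
    have "(\<lambda>i. measure N (A i)) sums measure N ?X"
      using union(1) AN by (intro finite_measure_UNION) auto
    then have "(\<lambda>n. \<Sum>i<n. measure N (A i)) \<longlonglongrightarrow> measure N ?X"
      by (simp add: sums_def)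
    then obtain n where n: "norm ((\<Sum>i<n. measure N (A i)) - measure N ?X) < e / 2"
      using LIMSEQ_D[of _ _ "e / 2"] union(4) by (metis half_gt_zero order_refl)
    let ?Z = "\<Union>i<n. A i"
    have ZN: "?Z \<in> sets N" using AN by auto
    have "measure N ?Z = (\<Sum>i<n. measure N (A i))"
      using union(1) AN by (intro finite_measure_finite_Union) (auto simp: disjoint_family_on_def)
    moreover have "measure N (?X - ?Z) = measure N ?X - measure N ?Z"
      by (rule finite_measure_Diff) (use AN in auto)
    ultimately have tail: "measure N (?X - ?Z) < e / 2"
      using n unfolding real_norm_def by linarith
    have "\<forall>i. \<exists>Y. Y \<in> M \<and> measure N ((A i - Y) \<union> (Y - A i)) < e / (2 * (real n + 1))"
      using union(3)[of "e / (2 * (real n + 1))"] union(4) by (auto simp: Bex_def)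
    then obtain Y where Y: "\<And>i. Y i \<in> M"
      "\<And>i. measure N ((A i - Y i) \<union> (Y i - A i)) < e / (2 * (real n + 1))"
      by metis
    let ?Y = "\<Union>i<n. Y i" and ?D = "\<lambda>i. (A i - Y i) \<union> (Y i - A i)"
    have DN: "?D i \<in> sets N" for i using AN MN[OF Y(1)] by auto
    have "measure N ((?X - ?Y) \<union> (?Y - ?X)) \<le> measure N ((?X - ?Z) \<union> (\<Union>i<n. ?D i))"
      using XN ZN DN by (intro finite_measure_mono) (blast, auto)
    also have "\<dots> \<le> measure N (?X - ?Z) + measure N (\<Union>i<n. ?D i)"
      using XN ZN DN by (intro measure_Un_le) auto
    also have "measure N (\<Union>i<n. ?D i) \<le> (\<Sum>i<n. measure N (?D i))"
      using DN by (intro finite_measure_subadditive_finite) auto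
    also have "\<dots> \<le> (\<Sum>i<n. e / (2 * (real n + 1)))"
      using Y(2) by (intro sum_mono) (simp add: less_imp_le)
    also have "\<dots> \<le> e / 2"
      using union(4) by (simp add: field_simps)
    finally have "measure N ((?X - ?Y) \<union> (?Y - ?X)) < e"
      using tail by simp
    moreover have "?Y \<in> M" using Y(1) by auto
    ultimately show ?case by blast
  qed
qed

text \<open>The four components of \<open>\<psi>\<close> add up to a finite positive measure
  dominating it. Approximation with respect to that measure transfers the bound with the same
  constant.\<close>

lemma complex_measure_bound_from_algebra:
  fixes \<psi> :: "'s set \<Rightarrow> complex"
  assumes \<psi>: "vector_measure \<Omega> (sigma_sets \<Omega> M) \<psi>" and M: "algebra \<Omega> M"
    and bound: "\<And>Y. Y \<in> M \<Longrightarrow> cmod (\<psi> Y) \<le> C" and X: "X \<in> sigma_sets \<Omega> M"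
  shows "cmod (\<psi> X) \<le> C"
proof (rule field_le_epsilon)
  fix e :: real assume "e > 0"
  let ?\<Sigma> = "sigma_sets \<Omega> M"
  interpret \<Sigma>: sigma_algebra \<Omega> ?\<Sigma> using \<psi> by (rule vector_measure_sigma_algebra)
  obtain P where P: "\<And>k. finite_measure (P k)" "\<And>k. space (P k) = \<Omega>" "\<And>k. sets (P k) = ?\<Sigma>"
    "\<And>A. A \<in> ?\<Sigma> \<Longrightarrow> \<psi> A = (\<Sum>k<4. \<i> ^ k * complex_of_real (measure (P k) A))"
    by (rule complex_measure_decomposition[OF \<psi>]) blast
  define m where "m A = (\<Sum>k<4. measure (P k) A)" for A
  have dom: "cmod (\<psi> A) \<le> m A" if "A \<in> ?\<Sigma>" for A
    unfolding P(4)[OF that] m_def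
    by (rule sum_norm_le) (simp add: norm_mult norm_power)
  have "vector_measure \<Omega> ?\<Sigma> m"
    unfolding m_def
    using vector_measure_measure[OF P(1)] by (intro vector_measure_sum \<Sigma>.sigma_algebra_axioms) (simp add: P)
  then obtain N where N: "finite_measure N" "space N = \<Omega>" "sets N = ?\<Sigma>"
    "\<And>A. A \<in> ?\<Sigma> \<Longrightarrow> measure N A = m A"
    by (rule nonneg_vector_measure_represented) (auto simp: m_def intro: sum_nonneg)
  obtain Y where Y: "Y \<in> M" "measure N ((X - Y) \<union> (Y - X)) < e"
    using sigma_sets_approximation[OF N(1), of M X e] M N(2,3) X \<open>e > 0\<close> by auto
  have Y\<Sigma>: "Y \<in> ?\<Sigma>" using Y(1) by (rule sigma_sets.Basic)
  note sm = vector_measure_semi_measure[OF \<psi>]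
  interpret N: finite_measure N by (rule N(1))
  have "\<psi> ((X \<inter> Y) \<union> (X - Y)) = \<psi> (X \<inter> Y) + \<psi> (X - Y)" "\<psi> ((X \<inter> Y) \<union> (Y - X)) = \<psi> (X \<inter> Y) + \<psi> (Y - X)"
    using X Y\<Sigma> by (intro semi_measure_Un[OF sm]; auto)+
  moreover have "(X \<inter> Y) \<union> (X - Y) = X" "(X \<inter> Y) \<union> (Y - X) = Y" by auto
  ultimately have "\<psi> X = \<psi> Y + \<psi> (X - Y) - \<psi> (Y - X)" by simp
  then have "cmod (\<psi> X) \<le> cmod (\<psi> Y) + cmod (\<psi> (X - Y)) + cmod (\<psi> (Y - X))"
    by (metis add_right_mono norm_triangle_ineq norm_triangle_ineq4 order_trans)
  also have "\<dots> \<le> C + (m (X - Y) + m (Y - X))"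
    using bound[OF Y(1)] dom[OF \<Sigma>.Diff[OF X Y\<Sigma>]] dom[OF \<Sigma>.Diff[OF Y\<Sigma> X]] by linarith
  also have "m (X - Y) + m (Y - X) = measure N ((X - Y) \<union> (Y - X))"
    using N(3) N(4)[of "X - Y"] N(4)[of "Y - X"] \<Sigma>.Diff[OF X Y\<Sigma>] \<Sigma>.Diff[OF Y\<Sigma> X]
    by (subst N.finite_measure_Union) auto
  finally show "cmod (\<psi> X) \<le> C + e" using Y(2) by simp
qed

lemma product_sigma_algebra_eq:
  assumes "sigma_algebra S \<A>" and "sigma_algebra S' \<B>"
  shows "product_sigma_algebra S \<A> S' \<B> = sigma_sets (S \<times> S') (product_algebra S \<A> S' \<B>)"
  unfolding product_sigma_algebra_def
proof (rule sigma_sets_eqI)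
  show "a \<in> sigma_sets (S \<times> S') (product_algebra S \<A> S' \<B>)" if "a \<in> rectangles \<A> \<B>" for a
    using that by (intro sigma_sets.Basic) (auto simp: rectangles_def intro: rectangle_in_product_algebra)
  show "b \<in> sigma_sets (S \<times> S') (rectangles \<A> \<B>)" if "b \<in> product_algebra S \<A> S' \<B>" for b
    using product_algebra_subset_sigma[OF assms] that by (auto simp: product_sigma_algebra_def)
qed

section \<open>Hilbert-Schmidt operators\<close>

lemma semi_measure_restrict:
  "semi_measure \<Omega> N \<phi> \<Longrightarrow> M \<subseteq> N \<Longrightarrow> algebra \<Omega> M \<Longrightarrow> semi_measure \<Omega> M \<phi>"
  by (auto simp: semi_measure_def additive_def)

text \<open>Partial sums over a disjoint family are values on finite unions, so uniform closeness on
  \<open>N\<close> controls them independently of their length.\<close>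

lemma vector_measure_uniform_limit:
  fixes \<psi> :: "'s set \<Rightarrow> 'v :: banach"
  assumes N: "sigma_algebra \<Omega> N"
    and approx: "\<And>r. r > 0 \<Longrightarrow> \<exists>\<phi>. vector_measure \<Omega> N \<phi> \<and> (\<forall>X\<in>N. norm (\<psi> X - \<phi> X) \<le> r)"
  shows "vector_measure \<Omega> N \<psi>"
proof -
  interpret sigma_algebra \<Omega> N by fact
  have "additive N \<psi>"
    unfolding additive_def
  proof (intro ballI impI)
    fix A B assume AB: "A \<in> N" "B \<in> N" "A \<inter> B = {}"
    have "norm (\<psi> (A \<union> B) - (\<psi> A + \<psi> B)) \<le> 0"
    proof (rule field_le_epsilon)
      fix e :: real assume "e > 0"
      then have "e / 3 > 0" by simp
      from approx[OF this] obtain \<phi> where \<phi>1: "vector_measure \<Omega> N \<phi>"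
        and \<phi>2: "\<forall>X\<in>N. norm (\<psi> X - \<phi> X) \<le> e / 3"
        by (elim exE conjE)
      note \<phi> = \<phi>1 \<phi>2[rule_format]
      have "\<phi> (A \<union> B) = \<phi> A + \<phi> B"
        by (rule semi_measure_Un[OF vector_measure_semi_measure[OF \<phi>(1)] AB])
      then have "\<psi> (A \<union> B) - (\<psi> A + \<psi> B) =
          (\<psi> (A \<union> B) - \<phi> (A \<union> B)) - ((\<psi> A - \<phi> A) + (\<psi> B - \<phi> B))" by simp
      also have "norm \<dots> \<le> e / 3 + (e / 3 + e / 3)"
        using AB by (intro norm_triangle_le_diff norm_triangle_le add_mono \<phi>(2)) auto
      finally show "norm (\<psi> (A \<union> B) - (\<psi> A + \<psi> B)) \<le> 0 + e" by simp
    qed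
    then show "\<psi> (A \<union> B) = \<psi> A + \<psi> B" by simp
  qed
  moreover have "algebra \<Omega> N" ..
  ultimately have sm: "semi_measure \<Omega> N \<psi>"
    by (simp add: semi_measure_def)
  have "(\<lambda>i. \<psi> (A i)) sums \<psi> (\<Union>i. A i)" if A: "range A \<subseteq> N" "disjoint_family A" for A :: "nat \<Rightarrow> 's set"
    unfolding sums_def
  proof (rule LIMSEQ_I)
    fix r :: real assume "r > 0"
    then have "r / 3 > 0" by simp
    from approx[OF this] obtain \<phi> where \<phi>1: "vector_measure \<Omega> N \<phi>"
      and \<phi>2: "\<forall>X\<in>N. norm (\<psi> X - \<phi> X) \<le> r / 3"
      by (elim exE conjE)
    note \<phi> = \<phi>1 \<phi>2[rule_format]
    have AN: "(\<Union>i<n. A i) \<in> N" "(\<Union>i. A i) \<in> N" for n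
      using A by auto
    have fin: "(\<Sum>i<n. \<nu> (A i)) = \<nu> (\<Union>i<n. A i)" if "semi_measure \<Omega> N \<nu>" for \<nu> :: "'s set \<Rightarrow> 'v" and n
      using A by (intro semi_measure_UN[OF that, symmetric]) (auto simp: disjoint_family_on_def)
    have "(\<lambda>i. \<phi> (A i)) sums \<phi> (\<Union>i. A i)"
      by (rule vector_measure_sums[OF \<phi>(1) A])
    then obtain n0 where n0: "\<And>n. n \<ge> n0 \<Longrightarrow> norm ((\<Sum>i<n. \<phi> (A i)) - \<phi> (\<Union>i. A i)) < r / 3"
      unfolding sums_def using LIMSEQ_D[of _ _ "r / 3"] \<open>r / 3 > 0\<close> by metis
    have "norm ((\<Sum>i<n. \<psi> (A i)) - \<psi> (\<Union>i. A i)) < r" if "n \<ge> n0" for n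
    proof -
      let ?U = "\<Union>i<n. A i" and ?X = "\<Union>i. A i"
      have "(\<Sum>i<n. \<psi> (A i)) - \<psi> ?X = (\<psi> ?U - \<phi> ?U) + (\<phi> ?U - \<phi> ?X) + (\<phi> ?X - \<psi> ?X)"
        by (simp add: fin[OF sm])
      also have "norm \<dots> \<le> norm (\<psi> ?U - \<phi> ?U) + norm (\<phi> ?U - \<phi> ?X) + norm (\<phi> ?X - \<psi> ?X)"
        by (intro order_trans[OF norm_triangle_ineq] add_right_mono norm_triangle_ineq)
      also have "norm (\<phi> ?U - \<phi> ?X) < r / 3"
        using n0[OF that] fin[OF vector_measure_semi_measure[OF \<phi>(1)], of n] by simp
      also have "norm (\<psi> ?U - \<phi> ?U) \<le> r / 3"
        by (intro \<phi>(2) AN)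
      also have "norm (\<phi> ?X - \<psi> ?X) \<le> r / 3"
        using \<phi>(2)[OF AN(2)] by (simp add: norm_minus_commute)
      finally show ?thesis by simp
    qed
    then show "\<exists>n0. \<forall>n\<ge>n0. norm ((\<Sum>i<n. \<psi> (A i)) - \<psi> (\<Union>i. A i)) < r" by blast
  qed
  then show ?thesis
    using N sm by (simp add: vector_measure_def)
qed

text \<open>
  The extension is the sum over an orthonormal basis \<open>E\<close> of the products of the scalar measures
  \<open>(\<xi>|T e)\<close> and \<open>(e|\<eta>)\<close>. It converges uniformly on the product \<open>\<sigma>\<close>-algebra: on the product algebra
  this is the summing property of Hilbert-Schmidt operators, and the bound passes to the
  \<open>\<sigma>\<close>-algebra by approximation.
\<close>

theorem Hilbert_Schmidt_extends:
  fixes T :: "'h :: complex_hilbert_space \<Rightarrow> 'k :: complex_hilbert_space"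
    and \<xi> :: "'s set \<Rightarrow> 'k" and \<eta> :: "'t set \<Rightarrow> 'h"
  assumes HS: "hilbert_schmidt T" and \<xi>: "vector_measure S \<A> \<xi>" and \<eta>: "vector_measure S' \<B> \<eta>"
  shows "extends_to_measure (S \<times> S') (product_algebra S \<A> S' \<B>) (product_sigma_algebra S \<A> S' \<B>)
    (product_semi_measure S \<A> S' \<B> \<xi> T \<eta>)"
proof -
  note A = vector_measure_sigma_algebra[OF \<xi>] and B = vector_measure_sigma_algebra[OF \<eta>]
  note sm\<xi> = vector_measure_semi_measure[OF \<xi>] and sm\<eta> = vector_measure_semi_measure[OF \<eta>]
  let ?PA = "product_algebra S \<A> S' \<B>" and ?\<Sigma> = "product_sigma_algebra S \<A> S' \<B>"
  have T: "bounded_clinear T" using HS by (simp add: hilbert_schmidt_def)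
  then have blT: "bounded_linear T" and clT: "\<And>c x. T (c *\<^sub>C x) = c *\<^sub>C T x"
    by (auto simp: bounded_clinear_def)
  obtain E where E: "orthonormal_basis E" and summ: "(\<lambda>e. (norm (T e))\<^sup>2) summable_on E"
    using HS by (auto simp: hilbert_schmidt_def)
  have onE: "orthonormal_set E" using E by (auto simp: orthonormal_basis_def orthonormal_set_def)
  obtain K\<xi> where K\<xi>: "K\<xi> \<ge> 0" "\<And>A. A \<in> \<A> \<Longrightarrow> norm (\<xi> A) \<le> K\<xi>"
    using vector_measure_bounded[OF \<xi>] by blast
  obtain K\<eta> where K\<eta>: "K\<eta> \<ge> 0" "\<And>B. B \<in> \<B> \<Longrightarrow> norm (\<eta> B) \<le> K\<eta>"
    using vector_measure_bounded[OF \<eta>] by blast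
  have "\<exists>\<psi>. vector_measure (S \<times> S') ?\<Sigma> \<psi> \<and>
      (\<forall>A\<in>\<A>. \<forall>B\<in>\<B>. \<psi> (A \<times> B) = cinner (\<xi> A) (T e) * cinner e (\<eta> B))" for e
    using complex_measure_product[OF vector_measure_bounded_linear[OF bounded_linear_cinner_left \<xi>, of "T e"]
        vector_measure_bounded_linear[OF bounded_linear_cinner_right \<eta>, of e]]
    by metis
  then obtain \<psi> where vm\<psi>: "\<And>e. vector_measure (S \<times> S') ?\<Sigma> (\<psi> e)"
    and rect\<psi>: "\<And>e A B. A \<in> \<A> \<Longrightarrow> B \<in> \<B> \<Longrightarrow> \<psi> e (A \<times> B) = cinner (\<xi> A) (T e) * cinner e (\<eta> B)"
    by metis
  have sig: "sigma_algebra (S \<times> S') ?\<Sigma>" using vm\<psi> by (rule vector_measure_sigma_algebra)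
  have vmF: "vector_measure (S \<times> S') ?\<Sigma> (\<lambda>X. \<Sum>e\<in>F. \<psi> e X)" for F
    by (intro vector_measure_sum sig vm\<psi>)
  \<comment> \<open>The three factors are the norm bound of \<open>\<xi>\<close>, the summing
    constant, and the bound for signed sums of \<open>\<eta>\<close> over disjoint sets.\<close>
  define C where "C = K\<xi> * (18 / 5 * (2 * K\<eta>))"
  have C0: "C \<ge> 0" using K\<xi>(1) K\<eta>(1) by (simp add: C_def)
  have bound: "cmod (\<Sum>e\<in>F. \<psi> e X) \<le> C * sqrt (\<Sum>e\<in>F. (norm (T e))\<^sup>2)"
    if F: "finite F" "F \<subseteq> E" and X: "X \<in> ?\<Sigma>" for F X
  proof (rule complex_measure_bound_from_algebra[where \<psi> = "\<lambda>X. \<Sum>e\<in>F. \<psi> e X" and M = ?PA and \<Omega> = "S \<times> S'"])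
    show "vector_measure (S \<times> S') (sigma_sets (S \<times> S') ?PA) (\<lambda>X. \<Sum>e\<in>F. \<psi> e X)"
      using vmF by (simp add: product_sigma_algebra_eq[OF A B])
    show "X \<in> sigma_sets (S \<times> S') ?PA"
      using X by (simp add: product_sigma_algebra_eq[OF A B])
    show alg: "algebra (S \<times> S') ?PA" by (rule algebra_product_algebra[OF A B])
    fix Y assume Y: "Y \<in> ?PA"
    let ?J = "slice Y ` S'" and ?L = "\<lambda>C. {t \<in> S'. slice Y t = C}"
    have sl: "\<And>t. t \<in> S' \<Longrightarrow> slice Y t \<in> \<A>" "simple_function (sigma S' \<B>) (slice Y)"
      using Y by (auto simp: product_algebra_eq[OF A B] simple_slices_def)
    note lev = simple_function_level_set[OF B sl(2)]
    \<comment> \<open>The slices of \<open>Y\<close> may overlap, but \<open>\<xi>\<close> enters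
      only through its norm bound; \<open>\<eta>\<close> is evaluated on the disjoint level sets, as
      the summing estimate requires.\<close>
    have "(\<Sum>e\<in>F. \<psi> e Y) = (\<Sum>C\<in>?J. \<Sum>e\<in>F. \<psi> e (C \<times> ?L C))"
      by (rule semi_measure_slice_formula[OF A B semi_measure_restrict[OF
            vector_measure_semi_measure[OF vmF] product_algebra_subset_sigma[OF A B] alg] Y])
    also have "\<dots> = (\<Sum>C\<in>?J. cinner (\<xi> C) (\<Sum>e\<in>F. cinner e (\<eta> (?L C)) *\<^sub>C T e))"
      unfolding cinner_sum_right cinner_scaleC_right using lev(2) sl(1)
      by (intro sum.cong refl) (auto simp: rect\<psi> mult.commute)
    also have "cmod \<dots> \<le> (\<Sum>C\<in>?J. K\<xi> * norm (\<Sum>e\<in>F. cinner e (\<eta> (?L C)) *\<^sub>C T e))"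
      using sl(1) K\<xi>(2)
      by (intro sum_norm_le order_trans[OF cinner_Cauchy_Schwarz] mult_right_mono) auto
    also have "\<dots> = K\<xi> * (\<Sum>C\<in>?J. norm (\<Sum>e\<in>F. cinner e (\<eta> (?L C)) *\<^sub>C T e))"
      by (simp add: sum_distrib_left)
    also have "\<dots> \<le> K\<xi> * (18 / 5 * (2 * K\<eta>) * sqrt (\<Sum>e\<in>F. (norm (T e))\<^sup>2))"
    proof (intro mult_left_mono K\<xi>(1) Hilbert_Schmidt_summing lev(1) F(1) orthonormal_set_subset[OF onE F(2)])
      show "norm (signed_sum ?J (\<lambda>C. \<eta> (?L C)) Z) \<le> 2 * K\<eta>" for Z
        using lev by (intro semi_measure_norm_signed_sum[OF sm\<eta> K\<eta>(2)]) (auto simp: disjoint_family_on_def)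
    qed
    finally show "cmod (\<Sum>e\<in>F. \<psi> e Y) \<le> C * sqrt (\<Sum>e\<in>F. (norm (T e))\<^sup>2)"
      by (simp add: C_def mult_ac)
  qed
  have tail: "\<exists>F0. finite F0 \<and> F0 \<subseteq> E \<and>
      (\<forall>X\<in>?\<Sigma>. \<forall>F. finite F \<and> F \<subseteq> E - F0 \<longrightarrow> cmod (\<Sum>e\<in>F. \<psi> e X) < r)" if "r > 0" for r
  proof -
    \<comment> \<open>The \<open>+ 1\<close> covers \<open>C = 0\<close> and makes the final
      inequality strict.\<close>
    have pos: "(r / (C + 1))\<^sup>2 > 0" using that C0 by simp
    obtain F0 where F0: "finite F0" "F0 \<subseteq> E"
      and *: "\<And>F. finite F \<Longrightarrow> F \<subseteq> E - F0 \<Longrightarrow> (\<Sum>e\<in>F. (norm (T e))\<^sup>2) < (r / (C + 1))\<^sup>2"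
      using summable_on_nonneg_tail[OF summ _ pos] by auto
    have "cmod (\<Sum>e\<in>F. \<psi> e X) < r" if F: "finite F" "F \<subseteq> E - F0" and X: "X \<in> ?\<Sigma>" for F X
    proof -
      have "sqrt (\<Sum>e\<in>F. (norm (T e))\<^sup>2) \<le> r / (C + 1)"
        using *[OF F] \<open>r > 0\<close> C0 by (intro real_le_lsqrt) (auto simp: sum_nonneg)
      then have "cmod (\<Sum>e\<in>F. \<psi> e X) \<le> C * (r / (C + 1))"
        using F X C0 by (intro order_trans[OF bound] mult_left_mono) auto
      also have "\<dots> < r" using \<open>r > 0\<close> C0 by (simp add: field_simps)
      finally show ?thesis .
    qed
    with F0 show ?thesis by blast
  qed
  define \<Psi> where "\<Psi> X = (\<Sum>\<^sub>\<infinity>e\<in>E. \<psi> e X)" for X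
  have sum\<Psi>: "((\<lambda>e. \<psi> e X) has_sum \<Psi> X) E" if "X \<in> ?\<Sigma>" for X
    unfolding \<Psi>_def
  proof (rule has_sum_infsum[OF summable_on_Cauchy_criterion])
    fix r :: real assume "r > 0"
    from tail[OF this] obtain F0 where F0: "finite F0" "F0 \<subseteq> E"
      and *: "\<forall>X\<in>?\<Sigma>. \<forall>F. finite F \<and> F \<subseteq> E - F0 \<longrightarrow> cmod (\<Sum>e\<in>F. \<psi> e X) < r"
      by (elim exE conjE)
    show "\<exists>F0. finite F0 \<and> F0 \<subseteq> E \<and> (\<forall>F. finite F \<and> F \<subseteq> E - F0 \<longrightarrow> cmod (\<Sum>e\<in>F. \<psi> e X) < r)"
      using F0 bspec[OF * that] by (intro exI[of _ F0] conjI)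
  qed
  have "vector_measure (S \<times> S') ?\<Sigma> \<Psi>"
  proof (rule vector_measure_uniform_limit[OF sig])
    fix r :: real assume "r > 0"
    from tail[OF this] obtain F0 where F0: "finite F0" "F0 \<subseteq> E"
      and *: "\<forall>X\<in>?\<Sigma>. \<forall>F. finite F \<and> F \<subseteq> E - F0 \<longrightarrow> cmod (\<Sum>e\<in>F. \<psi> e X) < r"
      by (elim exE conjE)
    have "cmod (\<Psi> X - (\<Sum>e\<in>F0. \<psi> e X)) \<le> r" if X: "X \<in> ?\<Sigma>" for X
    proof (rule Lim_norm_ubound)
      show "((\<lambda>F. (\<Sum>e\<in>F. \<psi> e X) - (\<Sum>e\<in>F0. \<psi> e X)) \<longlongrightarrow> \<Psi> X - (\<Sum>e\<in>F0. \<psi> e X)) (finite_subsets_at_top E)"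
        using sum\<Psi>[OF X] unfolding has_sum_def by (intro tendsto_intros)
      show "\<forall>\<^sub>F F in finite_subsets_at_top E. cmod ((\<Sum>e\<in>F. \<psi> e X) - (\<Sum>e\<in>F0. \<psi> e X)) \<le> r"
        unfolding eventually_finite_subsets_at_top
      proof (intro exI[of _ F0] conjI allI impI F0)
        fix F assume F: "finite F \<and> F0 \<subseteq> F \<and> F \<subseteq> E"
        then have "(\<Sum>e\<in>F. \<psi> e X) - (\<Sum>e\<in>F0. \<psi> e X) = (\<Sum>e\<in>F - F0. \<psi> e X)"
          using F0 by (subst sum_diff) auto
        also have "cmod \<dots> < r"
          using *[rule_format, OF X, of "F - F0"] F by auto
        finally show "cmod ((\<Sum>e\<in>F. \<psi> e X) - (\<Sum>e\<in>F0. \<psi> e X)) \<le> r" by simp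
      qed
    qed simp
    then show "\<exists>\<phi>. vector_measure (S \<times> S') ?\<Sigma> \<phi> \<and> (\<forall>X\<in>?\<Sigma>. cmod (\<Psi> X - \<phi> X) \<le> r)"
      using vmF[of F0] by blast
  qed
  moreover have "\<Psi> X = product_semi_measure S \<A> S' \<B> \<xi> T \<eta> X" if "X \<in> ?PA" for X
  proof (rule product_semi_measure_eqI[OF A B sm\<xi> sm\<eta> T _ _ that])
    show "semi_measure (S \<times> S') ?PA \<Psi>"
      by (intro semi_measure_restrict[OF vector_measure_semi_measure[OF \<open>vector_measure _ _ \<Psi>\<close>]]
          product_algebra_subset_sigma algebra_product_algebra A B)
    fix A' B' assume AB: "A' \<in> \<A>" "B' \<in> \<B>"
    have "A' \<times> B' \<in> ?\<Sigma>"
      using AB product_algebra_subset_sigma[OF A B] rectangle_in_product_algebra by blast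
    then have "((\<lambda>e. \<psi> e (A' \<times> B')) has_sum \<Psi> (A' \<times> B')) E" by (rule sum\<Psi>)
    moreover have "((\<lambda>e. cinner (\<xi> A') (T (cinner e (\<eta> B') *\<^sub>C e))) has_sum cinner (\<xi> A') (T (\<eta> B'))) E"
      by (intro has_sum_bounded_linear[OF bounded_linear_compose[OF bounded_linear_cinner_right blT]]
          orthonormal_basis_expansion E)
    then have "((\<lambda>e. \<psi> e (A' \<times> B')) has_sum cinner (\<xi> A') (T (\<eta> B'))) E"
      by (simp add: rect\<psi>[OF AB] clT cinner_scaleC_right mult.commute)
    ultimately show "\<Psi> (A' \<times> B') = cinner (\<xi> A') (T (\<eta> B'))"
      by (rule has_sum_unique)
  qed
  ultimately show ?thesis
    unfolding extends_to_measure_def by blast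
qed

text \<open>This bridge is used twice: to deduce (ii) from (iii), and to refute (i) by an unbounded
  example.\<close>

lemma extends_to_measure_bounded:
  assumes T: "bounded_clinear T" and \<xi>: "vector_measure S \<A> \<xi>" and \<eta>: "vector_measure S' \<B> \<eta>"
    and ext: "extends_to_measure (S \<times> S') (product_algebra S \<A> S' \<B>)
      (product_sigma_algebra S \<A> S' \<B>) (product_semi_measure S \<A> S' \<B> \<xi> T \<eta>)"
  shows "bounded_semi_measure (S \<times> S') (product_algebra S \<A> S' \<B>)
    (product_semi_measure S \<A> S' \<B> \<xi> T \<eta>)"
proof -
  note A = vector_measure_sigma_algebra[OF \<xi>] and B = vector_measure_sigma_algebra[OF \<eta>]
  obtain \<psi> where "vector_measure (S \<times> S') (product_sigma_algebra S \<A> S' \<B>) \<psi>"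
    "\<And>X. X \<in> product_algebra S \<A> S' \<B> \<Longrightarrow> \<psi> X = product_semi_measure S \<A> S' \<B> \<xi> T \<eta> X"
    using ext by (auto simp: extends_to_measure_def)
  moreover note product_algebra_subset_sigma[OF A B]
    product_semi_measure_spec(1)[OF A B vector_measure_semi_measure[OF \<xi>] vector_measure_semi_measure[OF \<eta>] T]
  ultimately show ?thesis
    by (intro extension_bounded)
qed

section \<open>Operators that are not Hilbert-Schmidt\<close>

lemma subspace_orthogonal_complement: "complex_vector.subspace (orthogonal_complement M)"
  by (auto simp: complex_vector.subspace_def orthogonal_complement_def cinner_add_right cinner_scaleC_right)

lemma closed_orthogonal_complement: "closed (orthogonal_complement M)"
proof -
  have "orthogonal_complement M = (\<Inter>y\<in>M. {x. cinner y x = 0})"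
    by (auto simp: orthogonal_complement_def)
  moreover have "closed {x. cinner y x = 0}" for y :: 'a
    by (intro closed_Collect_eq linear_continuous_on bounded_linear_cinner_right continuous_on_const)
  ultimately show ?thesis by auto
qed

context
  fixes T :: "'h :: complex_hilbert_space \<Rightarrow> 'k :: complex_hilbert_space"
  assumes T: "bounded_clinear T"
begin

lemma bounded_clinear_linear: "bounded_linear T" "T (c *\<^sub>C x) = c *\<^sub>C T x"
  using T by (auto simp: bounded_clinear_def)

lemma clinear_sum: "T (\<Sum>e\<in>F. c e *\<^sub>C e) = (\<Sum>e\<in>F. c e *\<^sub>C T e)"
  unfolding linear_sum[OF bounded_linear.linear[OF bounded_clinear_linear(1)]]
  by (simp add: bounded_clinear_linear(2))

lemma subspace_kernel: "complex_vector.subspace {x. T x = 0}"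
  using bounded_linear.linear[OF bounded_clinear_linear(1)]
  by (simp add: complex_vector.subspace_def linear_0 linear_add bounded_clinear_linear(2))

lemma closed_kernel: "closed {x. T x = 0}"
  by (intro closed_Collect_eq linear_continuous_on bounded_clinear_linear(1) continuous_on_const)

lemma subspace_range: "complex_vector.subspace (range T)"
  unfolding complex_vector.subspace_def
proof (intro conjI ballI allI)
  note lin = bounded_linear.linear[OF bounded_clinear_linear(1)]
  show "0 \<in> range T" by (rule image_eqI[of _ _ 0]) (simp_all add: linear_0[OF lin])
  show "x + y \<in> range T" if "x \<in> range T" "y \<in> range T" for x y
  proof -
    from that obtain a b where "x = T a" "y = T b" by auto
    then show ?thesis by (intro image_eqI[of _ _ "a + b"]) (simp_all add: linear_add[OF lin])
  qed
  show "c *\<^sub>C x \<in> range T" if "x \<in> range T" for c x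
  proof -
    from that obtain a where "x = T a" by auto
    then show ?thesis by (intro image_eqI[of _ _ "c *\<^sub>C a"]) (simp_all add: bounded_clinear_linear(2))
  qed
qed

text \<open>Failure of \<open>hilbert_schmidt\<close> concerns every basis, so one adapted to the
  kernel may be used. \<open>T\<close> vanishes on its kernel part, and expansion of kernel vectors
  in that part shows the other basis vectors to be orthogonal to the kernel.\<close>

lemma not_Hilbert_Schmidt_orthonormal_set:
  assumes "\<not> hilbert_schmidt T"
  obtains E where "orthonormal_set E" "E \<subseteq> orthogonal_complement {x. T x = 0}"
    "\<not> (\<lambda>e. (norm (T e))\<^sup>2) summable_on E"
proof -
  let ?K = "{x. T x = 0}"
  obtain E0 where E0: "E0 \<subseteq> ?K" "orthonormal_set E0"
    and exp0: "\<And>x. x \<in> ?K \<Longrightarrow> ((\<lambda>e. cinner e x *\<^sub>C e) has_sum x) E0"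
    by (rule maximal_orthonormal_set[OF closed_kernel subspace_kernel, of "{}"])
      (auto simp: orthonormal_set_def)
  obtain E where E: "E0 \<subseteq> E" "orthonormal_set E" "\<And>x. ((\<lambda>e. cinner e x *\<^sub>C e) has_sum x) E"
    by (rule maximal_orthonormal_set[OF closed_UNIV complex_vector.subspace_UNIV E0(2)]) auto
  have "orthonormal_basis E" by (rule orthonormal_basis_of_expansion[OF E(2,3)])
  then have "\<not> (\<lambda>e. (norm (T e))\<^sup>2) summable_on E"
    using assms T by (auto simp: hilbert_schmidt_def)
  moreover have "(\<lambda>e. (norm (T e))\<^sup>2) summable_on E - E0 \<longleftrightarrow> (\<lambda>e. (norm (T e))\<^sup>2) summable_on E"
    by (rule summable_on_cong_neutral) (use E0(1) in auto)
  moreover have "e \<in> orthogonal_complement ?K" if e: "e \<in> E - E0" for e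
    unfolding orthogonal_complement_def
  proof (intro CollectI ballI)
    fix y assume y: "y \<in> ?K"
    have "((\<lambda>f. cinner e (cinner f y *\<^sub>C f)) has_sum cinner e y) E0"
      by (rule has_sum_bounded_linear[OF bounded_linear_cinner_right exp0[OF y]])
    moreover have "((\<lambda>f. cinner e (cinner f y *\<^sub>C f)) has_sum 0) E0"
    proof (rule has_sum_0)
      fix f assume "f \<in> E0"
      then have "cinner e f = 0"
        using e E(1) by (intro orthonormal_set_cinner_eq_0[OF E(2)]) auto
      then show "cinner e (cinner f y *\<^sub>C f) = 0" by (simp add: cinner_scaleC_right)
    qed
    ultimately have "cinner e y = 0" by (rule has_sum_unique)
    then show "cinner y e = 0" by (simp add: cinner_eq_0_commute)
  qed
  ultimately show thesis
    using orthonormal_set_subset[OF E(2)] by (intro that[of "E - E0"]) auto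
qed

text \<open>Bessel's inequality for the adjoint of \<open>T\<close> at \<open>f\<close>, without
  constructing the adjoint.\<close>

lemma sum_cinner_image_le:
  assumes F: "orthonormal_set F" "finite F" and B: "\<And>x. norm (T x) \<le> B * norm x" "B \<ge> 0"
  shows "(\<Sum>e\<in>F. (cmod (cinner f (T e)))\<^sup>2) \<le> (norm f * B)\<^sup>2"
proof -
  define s where "s = (\<Sum>e\<in>F. (cmod (cinner f (T e)))\<^sup>2)"
  \<comment> \<open>This would be the projection onto the span of \<open>F\<close> of the adjoint of
    \<open>T\<close> applied to \<open>f\<close>.\<close>
  define x where "x = (\<Sum>e\<in>F. cnj (cinner f (T e)) *\<^sub>C e)"
  have s0: "s \<ge> 0" by (simp add: s_def sum_nonneg)
  have "(norm x)\<^sup>2 = s"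
    unfolding x_def s_def by (simp add: norm_orthonormal_sum[OF F])
  then have nx: "norm x = sqrt s" by (metis norm_ge_zero real_sqrt_unique)
  have "cinner f (T x) = complex_of_real s"
    unfolding x_def clinear_sum cinner_sum_right s_def
    by (simp add: cinner_scaleC_right complex_norm_square mult.commute del: of_real_power)
  then have "s = cmod (cinner f (T x))" using s0 by simp
  also have "\<dots> \<le> norm f * (B * norm x)"
    by (intro order_trans[OF cinner_Cauchy_Schwarz] mult_left_mono B) auto
  finally have *: "sqrt s * sqrt s \<le> norm f * B * sqrt s"
    using s0 by (simp add: nx mult_ac)
  have "sqrt s \<le> norm f * B"
  proof (cases "s = 0")
    case False
    then have "sqrt s > 0" using s0 by simp
    with * show ?thesis by (rule mult_right_le_imp_le)
  qed (use B in simp)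
  then have "(sqrt s)\<^sup>2 \<le> (norm f * B)\<^sup>2" using s0 by (intro power_mono) auto
  then show ?thesis using s0 by (simp add: s_def)
qed

text \<open>
  Projecting away from the finite set \<open>V\<close> changes the square sum of the \<open>T e\<close> by a bounded amount only,
  so the block can be chosen orthogonal to \<open>V\<close>.
\<close>

lemma not_Hilbert_Schmidt_block:
  assumes E: "orthonormal_set E" "\<not> (\<lambda>e. (norm (T e))\<^sup>2) summable_on E"
    and "finite U" and V: "finite V" "orthonormal_set V" "V \<subseteq> range T" and "L > 0"
  obtains F b W where "F \<subseteq> E - U" "finite F" "\<And>e. e \<in> F \<Longrightarrow> b e \<ge> 0" "(\<Sum>e\<in>F. (b e)\<^sup>2) \<le> 1"
    "finite W" "W \<subseteq> range T" "orthonormal_set (V \<union> W)" "V \<inter> W = {}"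
    "L \<le> (\<Sum>f\<in>W. \<Sum>e\<in>F. b e / sqrt (card W) * cmod (cinner f (T e)))"
proof -
  obtain B where B: "\<And>x. norm (T x) \<le> B * norm x" "B \<ge> 0"
    using bounded_linear.nonneg_bounded[OF bounded_clinear_linear(1)] by (metis mult.commute)
  \<comment> \<open>The first term covers the loss caused by the projection, at most the square of
    \<open>B\<close> for each element of \<open>V\<close>. The second leaves enough for
    \<open>L\<close> after Khintchine's factor 5/9.\<close>
  define R where "R = real (card V) * B\<^sup>2 + (9 / 5 * L)\<^sup>2"
  have "\<exists>F. F \<subseteq> E - U \<and> finite F \<and> R < (\<Sum>e\<in>F. (norm (T e))\<^sup>2)"
  proof (rule ccontr)
    assume "\<not> ?thesis"
    then have "(\<lambda>e. (norm (T e))\<^sup>2) summable_on E - U"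
      by (intro nonneg_bdd_above_summable_on bdd_aboveI[of _ R]) (auto simp: not_less)
    moreover have "(\<lambda>e. (norm (T e))\<^sup>2) summable_on E \<inter> U"
      using \<open>finite U\<close> by (intro summable_on_finite) auto
    ultimately have "(\<lambda>e. (norm (T e))\<^sup>2) summable_on (E - U) \<union> (E \<inter> U)"
      by (rule summable_on_Un_disjoint) auto
    moreover have "(E - U) \<union> (E \<inter> U) = E" by auto
    ultimately show False using E(2) by simp
  qed
  then obtain F where F: "F \<subseteq> E - U" "finite F" "R < (\<Sum>e\<in>F. (norm (T e))\<^sup>2)" by blast
  have onF: "orthonormal_set F" using F(1) by (intro orthonormal_set_subset[OF E(1)]) auto
  define v where "v e = T e - orthonormal_projection V (T e)" for e
  have v_orth: "cinner g (v e) = 0" if "g \<in> V" for g e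
    unfolding v_def by (rule cinner_minus_projection[OF V(2,1) that])
  have "(\<Sum>e\<in>F. (norm (T e))\<^sup>2) = (\<Sum>e\<in>F. (norm (v e))\<^sup>2) + (\<Sum>e\<in>F. \<Sum>g\<in>V. (cmod (cinner g (T e)))\<^sup>2)"
    unfolding v_def sum.distrib[symmetric]
    by (intro sum.cong refl norm_projection_Pythagoras[OF V(2,1)])
  also have "(\<Sum>e\<in>F. \<Sum>g\<in>V. (cmod (cinner g (T e)))\<^sup>2) = (\<Sum>g\<in>V. \<Sum>e\<in>F. (cmod (cinner g (T e)))\<^sup>2)"
    by (rule sum.swap)
  also have "\<dots> \<le> (\<Sum>g\<in>V. B\<^sup>2)"
  proof (rule sum_mono)
    fix g assume "g \<in> V"
    then have "norm g = 1" using V(2) by (simp add: orthonormal_set_def)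
    then show "(\<Sum>e\<in>F. (cmod (cinner g (T e)))\<^sup>2) \<le> B\<^sup>2"
      using sum_cinner_image_le[OF onF F(2) B, of g] by simp
  qed
  finally have "(9 / 5 * L)\<^sup>2 < (\<Sum>e\<in>F. (norm (v e))\<^sup>2)"
    using F(3) by (simp add: R_def)
  define \<sigma> where "\<sigma> = sqrt (\<Sum>e\<in>F. (norm (v e))\<^sup>2)"
  have \<sigma>2: "\<sigma>\<^sup>2 = (\<Sum>e\<in>F. (norm (v e))\<^sup>2)" by (simp add: \<sigma>_def sum_nonneg)
  have \<sigma>L: "9 / 5 * L \<le> \<sigma>"
    unfolding \<sigma>_def by (rule real_le_rsqrt) (use \<open>(9 / 5 * L)\<^sup>2 < _\<close> in simp)
  with \<open>L > 0\<close> have \<sigma>0: "\<sigma> > 0" by simp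
  \<comment> \<open>The equality case of Cauchy-Schwarz: these weights have square sum one and give
    \<open>\<sigma>\<close> when summed against the norms of the \<open>v e\<close>.\<close>
  define b where "b e = norm (v e) / \<sigma>" for e
  have b0: "b e \<ge> 0" for e using \<sigma>0 by (simp add: b_def)
  have "(\<Sum>e\<in>F. (b e)\<^sup>2) = (\<Sum>e\<in>F. (norm (v e))\<^sup>2) / \<sigma>\<^sup>2"
    by (simp add: b_def power_divide sum_divide_distrib)
  then have b1: "(\<Sum>e\<in>F. (b e)\<^sup>2) = 1" using \<sigma>0 by (simp add: \<sigma>2[symmetric])
  obtain f m where f: "\<And>i l. i < m \<Longrightarrow> l < m \<Longrightarrow> cinner (f i) (f l) = (if i = l then 1 else 0)"
    "\<And>i. f i \<in> complex_vector.span (v ` F)"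
    "5 / 9 * (\<Sum>e\<in>F. b e * norm (v e)) \<le> (\<Sum>i<m. \<Sum>e\<in>F. b e / sqrt (real m) * cmod (cinner (f i) (v e)))"
    by (rule flat_orthonormal_family[where b = b and v = v, OF F(2) b0]) (rule that)
  define W where "W = f ` {..<m}"
  have inj: "inj_on f {..<m}"
  proof (rule inj_onI)
    fix i l assume il: "i \<in> {..<m}" "l \<in> {..<m}" "f i = f l"
    show "i = l" using f(1)[of i l] f(1)[of i i] il by (auto split: if_splits)
  qed
  have norm_f: "norm (f i) = 1" if "i < m" for i
    using f(1)[OF that that] norm_ge_zero[of "f i"]
    by (auto simp: cinner_self power2_eq_1_iff simp flip: of_real_power)
  have onW: "orthonormal_set W"
    using f(1) norm_f unfolding orthonormal_set_def W_def by auto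
  have cardW: "card W = m" using inj by (simp add: W_def card_image)
  have spanV: "cinner g w = 0" if g: "g \<in> V" and w: "w \<in> complex_vector.span (v ` F)" for g w
  proof -
    have "complex_vector.span (v ` F) \<subseteq> orthogonal_complement {g}"
      using v_orth[OF g]
      by (intro complex_vector.span_minimal subspace_orthogonal_complement) (auto simp: orthogonal_complement_def)
    with w show ?thesis by (auto simp: orthogonal_complement_def)
  qed
  have VW: "cinner g w = 0" if "g \<in> V" "w \<in> W" for g w
    using that f(2) by (auto simp: W_def intro: spanV)
  have disj: "V \<inter> W = {}"
  proof -
    have "w \<notin> W" if "w \<in> V" for w
    proof
      assume "w \<in> W"
      from VW[OF that this] have "w = 0" by (simp add: cinner_self)
      with that V(2) show False by (auto simp: orthonormal_set_def)
    qed
    then show ?thesis by auto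
  qed
  have "orthonormal_set (V \<union> W)"
    unfolding orthonormal_set_def
  proof (intro conjI ballI impI)
    fix x y assume "x \<in> V \<union> W" "y \<in> V \<union> W" "x \<noteq> y"
    then show "cinner x y = 0"
      using VW[of x y] VW[of y x] orthonormal_set_cinner_eq_0[OF V(2), of x y]
        orthonormal_set_cinner_eq_0[OF onW, of x y] cinner_eq_0_commute[of x y] by auto
  qed (use V(2) onW in \<open>auto simp: orthonormal_set_def\<close>)
  moreover have "W \<subseteq> range T"
  proof -
    have "v e \<in> range T" for e
      unfolding v_def orthonormal_projection_def using V(3)
      by (intro complex_vector.subspace_diff complex_vector.subspace_sum
          complex_vector.subspace_scale subspace_range) auto
    then have "complex_vector.span (v ` F) \<subseteq> range T"
      by (intro complex_vector.span_minimal subspace_range) auto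
    with f(2) show ?thesis by (auto simp: W_def)
  qed
  moreover have "L \<le> (\<Sum>w\<in>W. \<Sum>e\<in>F. b e / sqrt (card W) * cmod (cinner w (T e)))"
  proof -
    \<comment> \<open>The \<open>f i\<close> lie in the span of the \<open>v e\<close>, hence are
      orthogonal to \<open>V\<close> and do not see the part removed from
      \<open>T e\<close>.\<close>
    have eq: "cinner (f i) (v e) = cinner (f i) (T e)" for i e
    proof -
      have "cinner (f i) (orthonormal_projection V (T e)) = 0"
        unfolding orthonormal_projection_def cinner_sum_right
      proof (intro sum.neutral ballI)
        fix g assume "g \<in> V"
        then have "cinner (f i) g = 0" using spanV[OF _ f(2)] cinner_eq_0_commute by blast
        then show "cinner (f i) (cinner g (T e) *\<^sub>C g) = 0" by (simp add: cinner_scaleC_right)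
      qed
      then show ?thesis by (simp add: v_def cinner_diff_right)
    qed
    have "L \<le> 5 / 9 * \<sigma>" using \<sigma>L by simp
    also have "\<sigma> = (\<Sum>e\<in>F. b e * norm (v e))"
    proof -
      have "(\<Sum>e\<in>F. b e * norm (v e)) = \<sigma>\<^sup>2 / \<sigma>"
        unfolding \<sigma>2 by (simp add: b_def power2_eq_square sum_divide_distrib)
      then show ?thesis using \<sigma>0 by (simp add: power2_eq_square)
    qed
    also note f(3)
    also have "(\<Sum>i<m. \<Sum>e\<in>F. b e / sqrt (real m) * cmod (cinner (f i) (v e))) =
        (\<Sum>w\<in>W. \<Sum>e\<in>F. b e / sqrt (card W) * cmod (cinner w (T e)))"
      unfolding cardW unfolding W_def sum.reindex[OF inj] by (simp add: eq)
    finally show ?thesis .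
  qed
  ultimately show thesis
    using F(1,2) b0 b1 disj by (intro that[of F b W]) (auto simp: W_def)
qed

text \<open>Dependent choice with growing finite sets of forbidden vectors. The growth
  \<open>8 ^ n\<close> is chosen against the weights \<open>(1 / 2) ^ n\<close> later put on both
  sides, leaving \<open>2 ^ n\<close>.\<close>

lemma not_Hilbert_Schmidt_blocks:
  assumes "\<not> hilbert_schmidt T"
  obtains F b W where "\<And>n :: nat. finite (F n)" "disjoint_family F" "orthonormal_set (\<Union>n. F n)"
    "\<And>n. F n \<subseteq> orthogonal_complement {x. T x = 0}" "\<And>n. (\<Sum>e\<in>F n. (b n e)\<^sup>2) \<le> 1"
    "\<And>n. finite (W n)" "disjoint_family W" "orthonormal_set (\<Union>n. W n)" "\<And>n. W n \<subseteq> range T"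
    "\<And>n. 8 ^ n \<le> (\<Sum>f\<in>W n. \<Sum>e\<in>F n. b n e / sqrt (card (W n)) * cmod (cinner f (T e)))"
proof -
  obtain E where E: "orthonormal_set E" "E \<subseteq> orthogonal_complement {x. T x = 0}"
    "\<not> (\<lambda>e. (norm (T e))\<^sup>2) summable_on E"
    using not_Hilbert_Schmidt_orthonormal_set[OF assms] by blast
  \<comment> \<open>Besides its block, a state carries finite sets \<open>U\<close> and
    \<open>V\<close> that accumulate the vectors used in the domain and in the range, so that the
    next block can avoid them.\<close>
  define P where "P n s = (case s of (F, b, W, U, V) \<Rightarrow>
      finite U \<and> finite V \<and> orthonormal_set V \<and> V \<subseteq> range T \<and> F \<subseteq> E \<inter> U \<and> W \<subseteq> V \<and>
      (\<Sum>e\<in>F. (b e)\<^sup>2) \<le> 1 \<and>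
      8 ^ n \<le> (\<Sum>f\<in>W. \<Sum>e\<in>F. b e / sqrt (card W) * cmod (cinner f (T e))))"
    for n :: nat and s :: "'h set \<times> ('h \<Rightarrow> real) \<times> 'k set \<times> 'h set \<times> 'k set"
  define Q where "Q s s' = (case s of (F, b, W, U, V) \<Rightarrow> case s' of (F', b', W', U', V') \<Rightarrow>
      U \<subseteq> U' \<and> V \<subseteq> V' \<and> F' \<inter> U = {} \<and> W' \<inter> V = {})"
    for s s' :: "'h set \<times> ('h \<Rightarrow> real) \<times> 'k set \<times> 'h set \<times> 'k set"
  \<comment> \<open>\<open>Q\<close> looks only at the last two components of the earlier state, so
    its block is filled with dummies; this also covers the start of the recursion.\<close>
  have extend: "\<exists>s. P n s \<and> Q ({}, \<lambda>_. 0, {}, U, V) s"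
    if UV: "finite U" "finite V" "orthonormal_set V" "V \<subseteq> range T" for n U V
  proof -
    obtain F b W where *: "F \<subseteq> E - U" "finite F" "\<And>e. e \<in> F \<Longrightarrow> b e \<ge> 0" "(\<Sum>e\<in>F. (b e)\<^sup>2) \<le> 1"
      "finite W" "W \<subseteq> range T" "orthonormal_set (V \<union> W)" "V \<inter> W = {}"
      "8 ^ n \<le> (\<Sum>f\<in>W. \<Sum>e\<in>F. b e / sqrt (card W) * cmod (cinner f (T e)))"
      by (rule not_Hilbert_Schmidt_block[OF E(1,3) UV, of "8 ^ n"]) auto
    then have "P n (F, b, W, U \<union> F, V \<union> W)" "Q ({}, \<lambda>_. 0, {}, U, V) (F, b, W, U \<union> F, V \<union> W)"
      using UV by (auto simp: P_def Q_def)
    then show ?thesis by blast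
  qed
  have "\<exists>s. \<forall>n. P n (s n) \<and> Q (s n) (s (Suc n))"
  proof (rule dependent_nat_choice)
    show "\<exists>s. P 0 s" using extend[of "{}" "{}" 0] unfolding orthonormal_set_def by blast
    fix s n assume s: "P n s"
    obtain F b W U V where [simp]: "s = (F, b, W, U, V)" by (cases s)
    have "\<exists>s'. P (Suc n) s' \<and> Q ({}, \<lambda>_. 0, {}, U, V) s'"
      using s by (intro extend) (auto simp: P_def)
    then show "\<exists>s'. P (Suc n) s' \<and> Q s s'" by (simp add: Q_def)
  qed
  then obtain s where s: "\<And>n. P n (s n)" "\<And>n. Q (s n) (s (Suc n))" by blast
  define F b W U V where "F n = fst (s n)" and "b n = fst (snd (s n))" and "W n = fst (snd (snd (s n)))"
    and "U n = fst (snd (snd (snd (s n))))" and "V n = snd (snd (snd (snd (s n))))" for n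
  have sn: "s n = (F n, b n, W n, U n, V n)" for n
    by (simp add: F_def b_def W_def U_def V_def)
  have P: "finite (U n)" "finite (V n)" "orthonormal_set (V n)" "V n \<subseteq> range T" "F n \<subseteq> E \<inter> U n"
    "W n \<subseteq> V n" "(\<Sum>e\<in>F n. (b n e)\<^sup>2) \<le> 1"
    "8 ^ n \<le> (\<Sum>f\<in>W n. \<Sum>e\<in>F n. b n e / sqrt (card (W n)) * cmod (cinner f (T e)))" for n
    using s(1)[of n] unfolding P_def sn by auto
  have Q: "U n \<subseteq> U (Suc n)" "V n \<subseteq> V (Suc n)" "F (Suc n) \<inter> U n = {}" "W (Suc n) \<inter> V n = {}" for n
    using s(2)[of n] unfolding Q_def sn by auto
  have monoU: "U m \<subseteq> U n" if "m \<le> n" for m n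
    by (rule lift_Suc_mono_le[of U, OF Q(1) that])
  have monoV: "V m \<subseteq> V n" if "m \<le> n" for m n
    by (rule lift_Suc_mono_le[of V, OF Q(2) that])
  have disjoint: "disjoint_family D"
    if D: "\<And>n. D n \<subseteq> G n" "\<And>n. D (Suc n) \<inter> G n = {}" "\<And>m n. m \<le> n \<Longrightarrow> G m \<subseteq> G n"
    for D G :: "nat \<Rightarrow> 'z set"
  proof -
    have less: "D m \<inter> D n = {}" if mn: "m < n" for m n
    proof -
      obtain k where k: "n = Suc k" "m \<le> k" using mn by (cases n) auto
      show ?thesis using D(1)[of m] D(2)[of k] D(3)[OF k(2)] k(1) by blast
    qed
    then show ?thesis
      unfolding disjoint_family_on_def by (metis Int_commute linorder_neqE_nat)
  qed
  have "orthonormal_set (\<Union>n. W n)"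
    unfolding orthonormal_set_def
  proof (intro conjI ballI impI)
    fix x y assume "x \<in> (\<Union>n. W n)" "y \<in> (\<Union>n. W n)" "x \<noteq> y"
    then obtain m n where "x \<in> W m" "y \<in> W n" by auto
    then have "x \<in> V (max m n)" "y \<in> V (max m n)"
      using P(6) monoV[of m "max m n"] monoV[of n "max m n"] by auto
    with \<open>x \<noteq> y\<close> show "cinner x y = 0"
      by (intro orthonormal_set_cinner_eq_0[OF P(3)])
  next
    fix x assume "x \<in> (\<Union>n. W n)"
    then obtain n where "x \<in> V n" using P(6) by blast
    then show "norm x = 1" using P(3)[of n] by (simp add: orthonormal_set_def)
  qed
  moreover have "orthonormal_set (\<Union>n. F n)"
    using P(5) by (intro orthonormal_set_subset[OF E(1)]) auto
  moreover have "F n \<subseteq> orthogonal_complement {x. T x = 0}" for n using P(5) E(2) by blast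
  moreover have "finite (F n)" for n using P(5)[of n] P(1)[of n] by (meson finite_subset le_infE)
  moreover have "finite (W n)" for n using P(6)[of n] P(2)[of n] by (meson finite_subset)
  moreover have "W n \<subseteq> range T" for n using P(4)[of n] P(6)[of n] by (meson subset_trans)
  moreover have "disjoint_family F" using P(5) by (intro disjoint[of F U, OF _ Q(3) monoU]) auto
  moreover have "disjoint_family W" by (rule disjoint[of W V, OF P(6) Q(4) monoV])
  ultimately show thesis using P(7,8) by (intro that[of F b W])
qed

end

section \<open>Atomic orthogonal measures\<close>

text \<open>The measure of \<open>A\<close> is the sum of the vectors whose atoms lie in
  \<open>A\<close>. Square summability of orthogonal vectors makes every such subseries converge
  unconditionally, which also gives countable additivity by regrouping.\<close>

lemma atomic_orthogonal_measure:
  fixes x :: "'i \<Rightarrow> 'v :: complex_hilbert_space"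
  assumes \<iota>: "inj_on \<iota> I"
    and orth: "\<And>i j. i \<in> I \<Longrightarrow> j \<in> I \<Longrightarrow> i \<noteq> j \<Longrightarrow> cinner (x i) (x j) = 0"
    and summ: "(\<lambda>i. (norm (x i))\<^sup>2) summable_on I"
    and M: "complex_vector.subspace M" "x ` I \<subseteq> M"
  obtains \<xi> :: "'s set \<Rightarrow> 'v" where
    "vector_measure UNIV (Pow UNIV) \<xi>" "orthogonal_on (Pow UNIV) \<xi>" "\<And>A. \<xi> A \<in> closure M"
    "\<And>i. i \<in> I \<Longrightarrow> \<xi> {\<iota> i} = x i"
proof -
  define L where "L A = {i \<in> I. \<iota> i \<in> A}" for A
  define \<xi> where "\<xi> A = infsum x (L A)" for A
  have LI: "L A \<subseteq> I" for A by (auto simp: L_def)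
  have "x summable_on I" by (rule orthogonal_summable_on[OF orth summ])
  then have sx: "x summable_on J" if "J \<subseteq> I" for J
    using that by (rule summable_on_subset_banach)
  have hs: "(x has_sum \<xi> A) (L A)" for A
    unfolding \<xi>_def by (rule has_sum_infsum[OF sx[OF LI]])
  have "vector_measure UNIV (Pow UNIV) \<xi>"
  proof (rule vector_measureI[OF sigma_algebra_Pow])
    show "\<xi> {} = 0" by (simp add: \<xi>_def L_def)
    fix A :: "nat \<Rightarrow> 's set" assume A: "disjoint_family A"
    \<comment> \<open>Disjointness of the \<open>A n\<close> makes the second projection injective,
      so summing over the pairs is both the iterated sum and the sum over the union.\<close>
    let ?S = "Sigma UNIV (\<lambda>n. L (A n))"
    have inj: "inj_on snd ?S"
    proof (rule inj_onI)
      fix p q assume pq: "p \<in> ?S" "q \<in> ?S" "snd p = snd q"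
      then have "\<iota> (snd p) \<in> A (fst p) \<inter> A (fst q)" by (auto simp: L_def)
      then have "fst p = fst q" using A by (auto simp: disjoint_family_on_def)
      with pq(3) show "p = q" by (simp add: prod_eq_iff)
    qed
    have img: "snd ` ?S = L (\<Union>n. A n)" by (force simp: L_def)
    have xs: "(\<lambda>(n, i). x i) summable_on ?S"
      using sx[OF LI] summable_on_reindex[OF inj, of x] unfolding img
      by (simp add: o_def case_prod_unfold)
    have "(\<lambda>n. infsum (\<lambda>i. x i) (L (A n))) summable_on UNIV"
      using summable_on_Sigma_banach[OF xs] by simp
    then have "((\<lambda>n. \<xi> (A n)) has_sum infsum (\<lambda>n. \<xi> (A n)) UNIV) UNIV"
      unfolding \<xi>_def by (rule has_sum_infsum)
    moreover have "infsum (\<lambda>n. \<xi> (A n)) UNIV = \<xi> (\<Union>n. A n)"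
    proof -
      have "infsum (\<lambda>n. \<xi> (A n)) UNIV = infsum (\<lambda>(n, i). x i) ?S"
        unfolding \<xi>_def using infsum_Sigma_banach[OF xs] by simp
      also have "\<dots> = infsum x (snd ` ?S)"
        by (simp add: infsum_reindex[OF inj] o_def case_prod_unfold)
      finally show ?thesis unfolding \<xi>_def img .
    qed
    ultimately show "(\<lambda>n. \<xi> (A n)) sums \<xi> (\<Union>n. A n)"
      using has_sum_imp_sums by metis
  qed
  moreover have "orthogonal_on (Pow UNIV) \<xi>"
    unfolding orthogonal_on_def
  proof (intro ballI impI)
    fix A B :: "'s set" assume AB: "A \<inter> B = {}"
    have 0: "cinner (x i) (\<xi> B) = 0" if i: "i \<in> L A" for i
    proof -
      have "((\<lambda>j. cinner (x i) (x j)) has_sum cinner (x i) (\<xi> B)) (L B)"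
        by (rule has_sum_bounded_linear[OF bounded_linear_cinner_right hs])
      moreover have "((\<lambda>j. cinner (x i) (x j)) has_sum 0) (L B)"
        by (rule has_sum_0) (use i AB in \<open>auto simp: L_def intro!: orth\<close>)
      ultimately show ?thesis by (rule has_sum_unique)
    qed
    have "((\<lambda>i. cinner (x i) (\<xi> B)) has_sum cinner (\<xi> A) (\<xi> B)) (L A)"
      by (rule has_sum_bounded_linear[OF bounded_linear_cinner_left hs])
    moreover have "((\<lambda>i. cinner (x i) (\<xi> B)) has_sum 0) (L A)"
      by (rule has_sum_0) (rule 0)
    ultimately show "cinner (\<xi> A) (\<xi> B) = 0" by (rule has_sum_unique)
  qed
  moreover have "\<xi> A \<in> closure M" for A
    by (rule has_sum_in_closure_subspace[OF hs M(1)]) (use M(2) LI in blast)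
  moreover have "\<xi> {\<iota> i} = x i" if "i \<in> I" for i
  proof -
    have "L {\<iota> i} = {i}" using that \<iota> by (auto simp: L_def inj_on_def)
    then show ?thesis by (simp add: \<xi>_def)
  qed
  ultimately show thesis by (rule that)
qed

lemma geometric_weights_summable:
  fixes w :: "nat \<Rightarrow> 'a \<Rightarrow> real"
  assumes D: "\<And>n. finite (D n)" and w: "\<And>n. (\<Sum>d\<in>D n. (w n d)\<^sup>2) \<le> 1"
  shows "(\<lambda>(n, d). ((1 / 2) ^ n * w n d)\<^sup>2) summable_on Sigma UNIV D"
proof (rule nonneg_bdd_above_summable_on)
  let ?g = "\<lambda>(n, d). ((1 / 2) ^ n * w n d)\<^sup>2"
  show "bdd_above (sum ?g ` {F. F \<subseteq> Sigma UNIV D \<and> finite F})"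
  proof (rule bdd_aboveI)
    fix y assume "y \<in> sum ?g ` {F. F \<subseteq> Sigma UNIV D \<and> finite F}"
    then obtain F where F: "F \<subseteq> Sigma UNIV D" "finite F" "y = sum ?g F" by auto
    obtain N where N: "fst ` F \<subseteq> {..<N}"
      using finite_nat_bounded[of "fst ` F"] F(2) by auto
    have "F \<subseteq> Sigma {..<N} D" using F(1) N by force
    then have "y \<le> sum ?g (Sigma {..<N} D)"
      unfolding F(3) using D by (intro sum_mono2) auto
    also have "\<dots> = (\<Sum>n<N. \<Sum>d\<in>D n. ((1 / 2) ^ n * w n d)\<^sup>2)"
      using D by (subst sum.Sigma) auto
    also have "\<dots> = (\<Sum>n<N. (1 / 4) ^ n * (\<Sum>d\<in>D n. (w n d)\<^sup>2))"
    proof -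
      have "(1 / 4 :: real) ^ n = (1 / 2) ^ n * (1 / 2) ^ n" for n
        by (simp flip: power_mult_distrib)
      then show ?thesis by (simp add: power2_eq_square sum_distrib_left mult_ac)
    qed
    also have "\<dots> \<le> (\<Sum>n<N. (1 / 4) ^ n * 1)"
      by (intro sum_mono mult_left_mono w) auto
    \<comment> \<open>A crude bound: the full geometric series is 4/3.\<close>
    also have "\<dots> \<le> 2"
      unfolding mult_1_right sum_gp_strict by (simp add: field_simps)
    finally show "y \<le> 2" .
  qed
qed auto

text \<open>The blocks have countably many vectors in all, so their indices embed as atoms into any
  infinite type. One construction thus supplies both measures, on the natural numbers as well as on
  arbitrary infinite types.\<close>

lemma orthonormal_blocks_measure:
  fixes D :: "nat \<Rightarrow> 'v :: complex_hilbert_space set"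
  assumes "infinite (UNIV :: 's set)"
    and D: "\<And>n. finite (D n)" "disjoint_family D" "orthonormal_set (\<Union>n. D n)"
    and w: "\<And>n. (\<Sum>d\<in>D n. (w n d)\<^sup>2) \<le> 1"
    and M: "complex_vector.subspace M" "\<And>n. D n \<subseteq> M"
  obtains \<xi> :: "'s set \<Rightarrow> 'v" and \<iota> where
    "vector_measure UNIV (Pow UNIV) \<xi>" "orthogonal_on (Pow UNIV) \<xi>" "\<And>A. \<xi> A \<in> closure M"
    "inj_on \<iota> (Sigma UNIV D)"
    "\<And>n d. d \<in> D n \<Longrightarrow> \<xi> {\<iota> (n, d)} = ((1 / 2) ^ n * w n d) *\<^sub>R d"
proof -
  let ?I = "Sigma UNIV D"
  obtain g :: "nat \<Rightarrow> 's" where g: "inj g"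
    using infinite_countable_subset[OF assms(1)] by blast
  have "countable ?I"
    by (rule countable_SIGMA) (simp_all add: countable_finite D(1))
  then have "inj_on (to_nat_on ?I) ?I" by (rule inj_on_to_nat_on)
  then have inj: "inj_on (g \<circ> to_nat_on ?I) ?I"
    by (rule comp_inj_on) (use g in \<open>auto simp: inj_on_def\<close>)
  define x where "x p = ((1 / 2) ^ fst p * w (fst p) (snd p)) *\<^sub>R snd p" for p
  have orth: "cinner (x p) (x q) = 0" if pq: "p \<in> ?I" "q \<in> ?I" "p \<noteq> q" for p q
  proof -
    have "snd p \<noteq> snd q"
    proof
      assume eq: "snd p = snd q"
      then have "D (fst p) \<inter> D (fst q) = {}"
        using pq(3) D(2) by (simp add: disjoint_family_on_def prod_eq_iff)
      with eq pq(1,2) show False by auto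
    qed
    then have "cinner (snd p) (snd q) = 0"
      using pq by (intro orthonormal_set_cinner_eq_0[OF D(3)]) auto
    then show ?thesis by (simp add: x_def cinner_scaleR_left cinner_scaleR_right)
  qed
  have "(norm (x p))\<^sup>2 = (\<lambda>(n, d). ((1 / 2) ^ n * w n d)\<^sup>2) p" if "p \<in> ?I" for p
  proof -
    have "norm (snd p) = 1" using that D(3) by (auto simp: orthonormal_set_def)
    then show ?thesis by (simp add: x_def case_prod_beta power_mult_distrib)
  qed
  then have summ: "(\<lambda>p. (norm (x p))\<^sup>2) summable_on ?I"
    by (rule summable_on_cong[THEN iffD2, OF _ geometric_weights_summable[OF D(1) w]])
  have xM: "x ` ?I \<subseteq> M"
  proof (rule image_subsetI)
    fix p assume "p \<in> ?I"
    then have "snd p \<in> M" using M(2)[of "fst p"] by auto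
    then show "x p \<in> M"
      unfolding x_def scaleR_scaleC by (rule complex_vector.subspace_scale[OF M(1)])
  qed
  show thesis
  proof (rule atomic_orthogonal_measure[OF inj _ summ M(1) xM])
    fix \<xi> :: "'s set \<Rightarrow> 'v"
    assume \<xi>: "vector_measure UNIV (Pow UNIV) \<xi>" "orthogonal_on (Pow UNIV) \<xi>" "\<And>A. \<xi> A \<in> closure M"
      and val: "\<And>p. p \<in> ?I \<Longrightarrow> \<xi> {(g \<circ> to_nat_on ?I) p} = x p"
    show thesis
    proof (rule that[OF \<xi> inj])
      show "\<xi> {(g \<circ> to_nat_on ?I) (n, d)} = ((1 / 2) ^ n * w n d) *\<^sub>R d" if "d \<in> D n" for n d
        using val[of "(n, d)"] that by (simp add: x_def)
    qed
  qed (rule orth)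
qed

text \<open>The point types are kept general so that the same orthogonal pair refutes (ii) over the
  natural numbers and (i) over the given types.\<close>

lemma not_Hilbert_Schmidt_unbounded:
  fixes T :: "'h :: complex_hilbert_space \<Rightarrow> 'k :: complex_hilbert_space"
  assumes T: "bounded_clinear T" and "\<not> hilbert_schmidt T"
    and s: "infinite (UNIV :: 's set)" and t: "infinite (UNIV :: 't set)"
  obtains \<xi> :: "'s set \<Rightarrow> 'k" and \<eta> :: "'t set \<Rightarrow> 'h" where
    "vector_measure UNIV (Pow UNIV) \<xi>" "orthogonal_on (Pow UNIV) \<xi>" "\<And>A. \<xi> A \<in> closure (range T)"
    "vector_measure UNIV (Pow UNIV) \<eta>" "orthogonal_on (Pow UNIV) \<eta>"
    "\<And>B. \<eta> B \<in> orthogonal_complement {x. T x = 0}"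
    "\<not> bounded_semi_measure (UNIV \<times> UNIV) (product_algebra UNIV (Pow UNIV) UNIV (Pow UNIV))
      (product_semi_measure UNIV (Pow UNIV) UNIV (Pow UNIV) \<xi> T \<eta>)"
proof -
  obtain F b W where F: "\<And>n :: nat. finite (F n)" "disjoint_family F" "orthonormal_set (\<Union>n. F n)"
      "\<And>n. F n \<subseteq> orthogonal_complement {x. T x = 0}"
    and b: "\<And>n. (\<Sum>e\<in>F n. (b n e)\<^sup>2) \<le> 1"
    and W: "\<And>n. finite (W n)" "disjoint_family W" "orthonormal_set (\<Union>n. W n)" "\<And>n. W n \<subseteq> range T"
    and big: "\<And>n. 8 ^ n \<le> (\<Sum>f\<in>W n. \<Sum>e\<in>F n. b n e / sqrt (card (W n)) * cmod (cinner f (T e)))"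
    by (rule not_Hilbert_Schmidt_blocks[OF T assms(2)]) (rule that)
  \<comment> \<open>Equal weights of square sum one on each block, the factor against which the flat
    system was built.\<close>
  define a where "a n f = 1 / sqrt (card (W n))" for n and f :: 'k
  have a: "(\<Sum>f\<in>W n. (a n f)\<^sup>2) \<le> 1" for n
    by (simp add: a_def power_divide)
  obtain \<xi> :: "'s set \<Rightarrow> 'k" and \<iota> where \<xi>: "vector_measure UNIV (Pow UNIV) \<xi>"
      "orthogonal_on (Pow UNIV) \<xi>" "\<And>A. \<xi> A \<in> closure (range T)"
    and \<iota>: "inj_on \<iota> (Sigma UNIV W)" "\<And>n d. d \<in> W n \<Longrightarrow> \<xi> {\<iota> (n, d)} = ((1 / 2) ^ n * a n d) *\<^sub>R d"
    by (rule orthonormal_blocks_measure[where w = a, OF s W(1-3) a subspace_range[OF T] W(4)]) (rule that)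
  obtain \<eta> :: "'t set \<Rightarrow> 'h" and \<kappa> where \<eta>: "vector_measure UNIV (Pow UNIV) \<eta>"
      "orthogonal_on (Pow UNIV) \<eta>" "\<And>A. \<eta> A \<in> closure (orthogonal_complement {x. T x = 0})"
    and \<kappa>: "inj_on \<kappa> (Sigma UNIV F)" "\<And>n d. d \<in> F n \<Longrightarrow> \<eta> {\<kappa> (n, d)} = ((1 / 2) ^ n * b n d) *\<^sub>R d"
    by (rule orthonormal_blocks_measure[where w = b, OF t F(1-3) b subspace_orthogonal_complement F(4)]) (rule that)
  let ?\<mu> = "product_semi_measure UNIV (Pow UNIV) UNIV (Pow UNIV) \<xi> T \<eta>"
  let ?PA = "product_algebra UNIV (Pow UNIV) UNIV (Pow UNIV) :: ('s \<times> 't) set set"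
  have linT: "linear T" using T by (simp add: bounded_clinear_def bounded_linear.linear)
  have rect: "?\<mu> (A \<times> B) = cinner (\<xi> A) (T (\<eta> B))" for A B
    by (rule product_semi_measure_spec(2)[OF sigma_algebra_Pow sigma_algebra_Pow
          vector_measure_semi_measure[OF \<xi>(1)] vector_measure_semi_measure[OF \<eta>(1)] T]) auto
  have "\<not> bounded_semi_measure (UNIV \<times> UNIV) ?PA ?\<mu>"
  proof
    assume "bounded_semi_measure (UNIV \<times> UNIV) ?PA ?\<mu>"
    then obtain K where K: "\<And>D. finite D \<Longrightarrow> D \<subseteq> ?PA \<Longrightarrow> disjoint D \<Longrightarrow> (\<Sum>A\<in>D. cmod (?\<mu> A)) \<le> K"
      using bounded_semi_measure_disjoint_sum by blast
    have "2 ^ n \<le> K" for n :: nat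
    proof -
      define pt where "pt p = {(\<iota> (n, fst p), \<kappa> (n, snd p))}" for p
      let ?J = "W n \<times> F n"
      have injpt: "inj_on pt ?J"
        using \<iota>(1) \<kappa>(1) by (auto simp: inj_on_def pt_def)
      have ptrect: "pt p = {\<iota> (n, fst p)} \<times> {\<kappa> (n, snd p)}" for p by (simp add: pt_def)
      have val: "cmod (?\<mu> (pt (f, e))) = (1 / 4) ^ n * (\<bar>b n e\<bar> / sqrt (card (W n)) * cmod (cinner f (T e)))"
        if "f \<in> W n" "e \<in> F n" for f e
      proof -
        have "(1 / 4 :: real) ^ n = (1 / 2) ^ n * (1 / 2) ^ n"
          by (simp flip: power_mult_distrib)
        moreover have "?\<mu> (pt (f, e)) = cinner (\<xi> {\<iota> (n, f)}) (T (\<eta> {\<kappa> (n, e)}))"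
          unfolding ptrect fst_conv snd_conv by (rule rect)
        ultimately show ?thesis
          using that
          by (simp add: \<iota>(2) \<kappa>(2) linear_scale[OF linT] cinner_scaleR_left cinner_scaleR_right
              a_def abs_mult power_abs)
      qed
      \<comment> \<open>Each of the two measures carries \<open>(1 / 2) ^ n\<close>; together they
        reduce \<open>8 ^ n\<close> to \<open>2 ^ n\<close>, still unbounded.\<close>
      have "2 ^ n = (1 / 4) ^ n * (8 ^ n :: real)"
        by (simp flip: power_mult_distrib)
      also have "\<dots> \<le> (1 / 4) ^ n * (\<Sum>f\<in>W n. \<Sum>e\<in>F n. b n e / sqrt (card (W n)) * cmod (cinner f (T e)))"
        by (intro mult_left_mono big) auto
      \<comment> \<open>The blocks do not record the sign of \<open>b\<close>; absolute values only
        increase the sum.\<close>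
      also have "\<dots> \<le> (1 / 4) ^ n * (\<Sum>f\<in>W n. \<Sum>e\<in>F n. \<bar>b n e\<bar> / sqrt (card (W n)) * cmod (cinner f (T e)))"
        by (intro mult_left_mono sum_mono mult_right_mono divide_right_mono) auto
      also have "\<dots> = (\<Sum>f\<in>W n. \<Sum>e\<in>F n. cmod (?\<mu> (pt (f, e))))"
        unfolding sum_distrib_left by (intro sum.cong refl val[symmetric])
      also have "\<dots> = (\<Sum>p\<in>?J. cmod (?\<mu> (pt p)))"
        by (simp add: sum.cartesian_product case_prod_beta)
      also have "\<dots> = (\<Sum>X\<in>pt ` ?J. cmod (?\<mu> X))"
        by (simp add: sum.reindex[OF injpt])
      also have "\<dots> \<le> K"
      proof (rule K)
        show "finite (pt ` ?J)" using F(1) W(1) by auto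
        show "pt ` ?J \<subseteq> ?PA"
          unfolding ptrect by (intro image_subsetI rectangle_in_product_algebra) auto
        show "disjoint (pt ` ?J)" by (auto simp: disjoint_def pt_def)
      qed
      finally show ?thesis .
    qed
    moreover obtain n :: nat where "K < 2 ^ n"
      using real_arch_pow[of 2 K] by auto
    ultimately show False by (meson not_less)
  qed
  then show thesis
    using \<xi> \<eta> closure_closed[OF closed_orthogonal_complement[of "{x. T x = 0}"]]
    by (intro that[of \<xi> \<eta>]) simp_all
qed

theorem theorem2p14:
  fixes T :: "'h :: complex_hilbert_space \<Rightarrow> 'k :: complex_hilbert_space"
  assumes "bounded_clinear T"
    and "infinite (UNIV :: 's set)"
    and "infinite (UNIV :: 't set)"
  shows
    "((\<forall>(S :: 's set) \<A> (S' :: 't set) \<B> (\<xi> :: 's set \<Rightarrow> 'k) (\<eta> :: 't set \<Rightarrow> 'h).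
         vector_measure S \<A> \<xi> \<longrightarrow> vector_measure S' \<B> \<eta> \<longrightarrow>
         extends_to_measure (S \<times> S')
           (product_algebra S \<A> S' \<B>) (product_sigma_algebra S \<A> S' \<B>)
           (product_semi_measure S \<A> S' \<B> \<xi> T \<eta>))
       \<longleftrightarrow> hilbert_schmidt T)
     \<and>
     ((\<forall>(\<xi> :: nat set \<Rightarrow> 'k) (\<eta> :: nat set \<Rightarrow> 'h).
         vector_measure UNIV (Pow UNIV) \<xi> \<longrightarrow> orthogonal_on (Pow UNIV) \<xi> \<longrightarrow>
         (\<forall>A. \<xi> A \<in> closure (range T)) \<longrightarrow>
         vector_measure UNIV (Pow UNIV) \<eta> \<longrightarrow> orthogonal_on (Pow UNIV) \<eta> \<longrightarrow>
         (\<forall>B. \<eta> B \<in> orthogonal_complement {x. T x = 0}) \<longrightarrow>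
         bounded_semi_measure (UNIV \<times> UNIV)
           (product_algebra UNIV (Pow UNIV) UNIV (Pow UNIV))
           (product_semi_measure UNIV (Pow UNIV) UNIV (Pow UNIV) \<xi> T \<eta>))
       \<longleftrightarrow> hilbert_schmidt T)"
proof (intro conjI iffI allI impI)
  assume ext: "\<forall>(S :: 's set) \<A> (S' :: 't set) \<B> (\<xi> :: 's set \<Rightarrow> 'k) (\<eta> :: 't set \<Rightarrow> 'h).
    vector_measure S \<A> \<xi> \<longrightarrow> vector_measure S' \<B> \<eta> \<longrightarrow>
    extends_to_measure (S \<times> S') (product_algebra S \<A> S' \<B>) (product_sigma_algebra S \<A> S' \<B>)
      (product_semi_measure S \<A> S' \<B> \<xi> T \<eta>)"
  show "hilbert_schmidt T"
  proof (rule ccontr)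
    assume "\<not> hilbert_schmidt T"
    \<comment> \<open>The unbounded example lives on full power sets, which are admissible
      \<sigma>-algebras in (i).\<close>
    then show False
    proof (rule not_Hilbert_Schmidt_unbounded[OF assms(1) _ assms(2,3)])
      fix \<xi> :: "'s set \<Rightarrow> 'k" and \<eta> :: "'t set \<Rightarrow> 'h"
      assume vm: "vector_measure UNIV (Pow UNIV) \<xi>" "vector_measure UNIV (Pow UNIV) \<eta>"
        and nb: "\<not> bounded_semi_measure (UNIV \<times> UNIV) (product_algebra UNIV (Pow UNIV) UNIV (Pow UNIV))
          (product_semi_measure UNIV (Pow UNIV) UNIV (Pow UNIV) \<xi> T \<eta>)"
      show False
        using extends_to_measure_bounded[OF assms(1) vm ext[rule_format, OF vm]] nb by contradiction
    qed
  qed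
next
  assume bd: "\<forall>(\<xi> :: nat set \<Rightarrow> 'k) (\<eta> :: nat set \<Rightarrow> 'h).
    vector_measure UNIV (Pow UNIV) \<xi> \<longrightarrow> orthogonal_on (Pow UNIV) \<xi> \<longrightarrow>
    (\<forall>A. \<xi> A \<in> closure (range T)) \<longrightarrow>
    vector_measure UNIV (Pow UNIV) \<eta> \<longrightarrow> orthogonal_on (Pow UNIV) \<eta> \<longrightarrow>
    (\<forall>B. \<eta> B \<in> orthogonal_complement {x. T x = 0}) \<longrightarrow>
    bounded_semi_measure (UNIV \<times> UNIV) (product_algebra UNIV (Pow UNIV) UNIV (Pow UNIV))
      (product_semi_measure UNIV (Pow UNIV) UNIV (Pow UNIV) \<xi> T \<eta>)"
  show "hilbert_schmidt T"
  proof (rule ccontr)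
    assume "\<not> hilbert_schmidt T"
    then show False
      by (rule not_Hilbert_Schmidt_unbounded[OF assms(1) _ infinite_UNIV_nat infinite_UNIV_nat])
        (use bd in blast)
  qed
next
  fix \<xi> :: "nat set \<Rightarrow> 'k" and \<eta> :: "nat set \<Rightarrow> 'h"
  assume "hilbert_schmidt T" and vm: "vector_measure UNIV (Pow UNIV) \<xi>" "vector_measure UNIV (Pow UNIV) \<eta>"
  then show "bounded_semi_measure (UNIV \<times> UNIV) (product_algebra UNIV (Pow UNIV) UNIV (Pow UNIV))
      (product_semi_measure UNIV (Pow UNIV) UNIV (Pow UNIV) \<xi> T \<eta>)"
    by (intro extends_to_measure_bounded[OF assms(1) vm] Hilbert_Schmidt_extends)
qed (rule Hilbert_Schmidt_extends)

end
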